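(* Let $u=\mathrm{sh}(k)$ be a solution, on some interval $[0,T]$, of $$ iu_t+ug^T+gu-(1+p)m=\big(ip_t+[g,p]+u\overline m\big)(1+p)^{-1}u . $$ Then $$ \|u(T)\|_{L^2}\le\Big(\int_0^T\|m\|_{L^2}\,dt+\|u(0)\|_{L^2}\Big)\exp\Big(\int_0^T\|m\|_{L^2}\,dt\Big). $$
   Context: Kernels on $\mathbb{R}^3\times\mathbb{R}^3$ are regarded as operators on $L^2(\mathbb{R}^3)$: products are compositions $(ab)(x,y)=\int a(x,z)b(z,y)\,dz$, $1$ is the identity (kernel $\delta(x-y)$), $\overline a$ is the complex conjugate kernel, $a^T(x,y)=a(y,x)$; $\|\cdot\|_{L^2}$ is the norm of $L^2(\mathbb{R}^6)=L^2(dx\,dy)$ (Hilbert-Schmidt norm). $v$ is an even real potential on $\mathbb{R}^3$, $\phi(t,x)$ is a smooth solution of the Hartree equation $i\partial_t\phi+\Delta\phi-(v*|\phi|^2)\phi=0$, and $g(t,x,y)=-\Delta_x\delta(x-y)+v(x-y)\phi(t,x)\overline\phi(t,y)+(v*|\phi|^2)(t,x)\delta(x-y)$, $m(t,x,y)=-v(x-y)\overline\phi(t,x)\overline\phi(t,y)$. For a time-dependent symmetric kernel $k(t)\in L^2(\mathbb{R}^6)$: $u=\mathrm{sh}(k)=k+\frac1{3!}k\overline kk+\cdots$ (a symmetric kernel) and $1+p=\mathrm{ch}(k)=1+\frac1{2!}k\overline k+\cdots$; thus $p$ is self-adjoint, positive semi-definite, and $(1+p)^2=1+u\overline u$. *)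

theory Defs
  imports "HOL-Analysis.Analysis"
begin

type_synonym kernel = "(real^3) \<times> (real^3) \<Rightarrow> complex"

section \<open>Smooth functions and Laplacians\<close>

primrec Ck_on :: "nat \<Rightarrow> 'a::euclidean_space set \<Rightarrow> ('a \<Rightarrow> 'b::real_normed_vector) \<Rightarrow> bool" where
  "Ck_on 0 X f \<longleftrightarrow> continuous_on X f"
| "Ck_on (Suc n) X f \<longleftrightarrow>
     (\<exists>f'. (\<forall>x\<in>X. (f has_derivative f' x) (at x within X)) \<and> (\<forall>d. Ck_on n X (\<lambda>x. f' x d)))"

definition smooth_on :: "'a::euclidean_space set \<Rightarrow> ('a \<Rightarrow> 'b::real_normed_vector) \<Rightarrow> bool" where
  "smooth_on X f \<longleftrightarrow> (\<forall>n. Ck_on n X f)"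

definition laplacian :: "('a::euclidean_space \<Rightarrow> complex) \<Rightarrow> 'a \<Rightarrow> complex" where
  "laplacian f x =
     (\<Sum>b\<in>Basis. vector_derivative (\<lambda>s. vector_derivative (\<lambda>r. f (x + r *\<^sub>R b)) (at s)) (at 0))"

definition lap_x :: "kernel \<Rightarrow> kernel" where
  "lap_x f = (\<lambda>(x, y). laplacian (\<lambda>x'. f (x', y)) x)"

definition lap_y :: "kernel \<Rightarrow> kernel" where
  "lap_y f = (\<lambda>(x, y). laplacian (\<lambda>y'. f (x, y')) y)"

definition test_fun :: "kernel \<Rightarrow> bool" where
  "test_fun \<psi> \<longleftrightarrow> smooth_on UNIV \<psi> \<and> compact (closure {z. \<psi> z \<noteq> 0})"

section \<open>Kernels as operators\<close>

text \<open>Kernels are functions; two kernels define the same operator iff they agree almost everywhere.\<close>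

definition L2_kernel :: "kernel \<Rightarrow> bool" where
  "L2_kernel a \<longleftrightarrow> a \<in> borel_measurable lborel \<and> integrable lborel (\<lambda>z. (cmod (a z))\<^sup>2)"

definition L2_norm :: "kernel \<Rightarrow> real" where
  "L2_norm a = sqrt (\<integral>z. (cmod (a z))\<^sup>2 \<partial>lborel)"

definition kcomp :: "kernel \<Rightarrow> kernel \<Rightarrow> kernel"  (infixl "\<odot>" 75) where
  "a \<odot> b = (\<lambda>(x, y). \<integral>z. a (x, z) * b (z, y) \<partial>lborel)"

definition kconj :: "kernel \<Rightarrow> kernel" where
  "kconj a = (\<lambda>z. cnj (a z))"

definition ktranspose :: "kernel \<Rightarrow> kernel" where
  "ktranspose a = (\<lambda>(x, y). a (y, x))"

definition symmetric_kernel :: "kernel \<Rightarrow> bool" where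
  "symmetric_kernel a \<longleftrightarrow> (AE z in lborel. ktranspose a z = a z)"

definition L2_sums :: "(nat \<Rightarrow> kernel) \<Rightarrow> kernel \<Rightarrow> bool" where
  "L2_sums f a \<longleftrightarrow>
     L2_kernel a \<and> (\<lambda>n. L2_norm (\<lambda>z. a z - (\<Sum>j<n. f j z))) \<longlonglongrightarrow> 0"

text \<open>The alternating product of \<open>n + 1\<close> factors: \<open>k\<close>, \<open>k (kconj k)\<close>, \<open>k (kconj k) k\<close>, and so on.\<close>

primrec alt_prod :: "kernel \<Rightarrow> nat \<Rightarrow> kernel" where
  "alt_prod k 0 = k"
| "alt_prod k (Suc n) = k \<odot> kconj (alt_prod k n)"

definition is_sh :: "kernel \<Rightarrow> kernel \<Rightarrow> bool" where
  "is_sh k u \<longleftrightarrow> L2_sums (\<lambda>n z. alt_prod k (2 * n) z / fact (2 * n + 1)) u"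

text \<open>\<open>is_ch_minus_one k p\<close> means \<open>1 + p = ch(k)\<close>; the identity operator has no kernel in \<open>L\<^sup>2\<close>,
  so it is split off.\<close>

definition is_ch_minus_one :: "kernel \<Rightarrow> kernel \<Rightarrow> bool" where
  "is_ch_minus_one k p \<longleftrightarrow> L2_sums (\<lambda>n z. alt_prod k (2 * n + 1) z / fact (2 * n + 2)) p"

text \<open>\<open>(1 + p)\<^sup>-\<^sup>1 = 1 + r\<close>. The inverse always has this form, with \<open>r = - (1 + p)\<^sup>-\<^sup>1 p\<close> in
  \<open>L\<^sup>2\<close>, when \<open>p\<close> in \<open>L\<^sup>2\<close> is positive semi-definite.\<close>

definition is_inverse_one_plus :: "kernel \<Rightarrow> kernel \<Rightarrow> bool" where
  "is_inverse_one_plus p r \<longleftrightarrow> L2_kernel r \<and>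
     (AE z in lborel. p z + r z + (p \<odot> r) z = 0) \<and>
     (AE z in lborel. p z + r z + (r \<odot> p) z = 0)"

section \<open>Time-dependent kernels\<close>

definition kernel_path :: "real \<Rightarrow> (real \<Rightarrow> kernel) \<Rightarrow> bool" where
  "kernel_path T a \<longleftrightarrow> set_borel_measurable lborel ({0..T} \<times> UNIV) (\<lambda>(t, z). a t z)"

definition L1_L2 :: "real \<Rightarrow> (real \<Rightarrow> kernel) \<Rightarrow> bool" where
  "L1_L2 T a \<longleftrightarrow> kernel_path T a \<and>
     (AE t in lborel. t \<in> {0..T} \<longrightarrow> L2_kernel (a t)) \<and>
     set_integrable lborel {0..T} (\<lambda>t. L2_norm (a t))"

definition Linf_L2 :: "real \<Rightarrow> (real \<Rightarrow> kernel) \<Rightarrow> bool" where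
  "Linf_L2 T a \<longleftrightarrow> kernel_path T a \<and>
     (\<forall>t\<in>{0..T}. L2_kernel (a t)) \<and> (\<exists>C. \<forall>t\<in>{0..T}. L2_norm (a t) \<le> C)"

definition pairing :: "kernel \<Rightarrow> kernel \<Rightarrow> complex" where
  "pairing a \<psi> = (\<integral>z. a z * \<psi> z \<partial>lborel)"

text \<open>\<open>i a\<^sub>t + D a + B = S\<close> on \<open>[0,T]\<close>, in the sense of distributions in space and integrated in
  time. The differential operator \<open>D\<close> has constant real coefficients and only even order terms,
  so it is its own transpose and is moved unchanged onto the test function. The equation at every
  \<open>t\<close> fixes the value \<open>a t\<close> and not only its class modulo null sets of times.\<close>

definition weak_evolution ::
  "real \<Rightarrow> (kernel \<Rightarrow> kernel) \<Rightarrow> (real \<Rightarrow> kernel) \<Rightarrow> (real \<Rightarrow> kernel) \<Rightarrow> (real \<Rightarrow> kernel) \<Rightarrow> bool" where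
  "weak_evolution T D a B S \<longleftrightarrow>
     Linf_L2 T a \<and> L1_L2 T B \<and> L1_L2 T S \<and>
     (\<forall>\<psi>. test_fun \<psi> \<longrightarrow> (\<forall>t\<in>{0..T}.
        \<i> * (pairing (a t) \<psi> - pairing (a 0) \<psi>)
          + (LINT s:{0..t}|lborel. pairing (a s) (D \<psi>) + pairing (B s) \<psi>)
        = (LINT s:{0..t}|lborel. pairing (S s) \<psi>)))"

section \<open>The Hartree equation and the kernels built from its solution\<close>

definition hartree_potential :: "(real^3 \<Rightarrow> real) \<Rightarrow> (real^3 \<Rightarrow> complex) \<Rightarrow> real^3 \<Rightarrow> real" where
  "hartree_potential v f x = (\<integral>y. v (x - y) * (cmod (f y))\<^sup>2 \<partial>lborel)"

definition hartree_solution ::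
  "(real^3 \<Rightarrow> real) \<Rightarrow> real \<Rightarrow> (real \<Rightarrow> real^3 \<Rightarrow> complex) \<Rightarrow> bool" where
  "hartree_solution v T \<phi> \<longleftrightarrow>
     smooth_on ({0..T} \<times> UNIV) (\<lambda>(t, x). \<phi> t x) \<and>
     (\<forall>t\<in>{0..T}. \<forall>x.
        integrable lborel (\<lambda>y. v (x - y) * (cmod (\<phi> t y))\<^sup>2) \<and>
        \<i> * vector_derivative (\<lambda>s. \<phi> s x) (at t within {0..T}) + laplacian (\<phi> t) x
          - complex_of_real (hartree_potential v (\<phi> t) x) * \<phi> t x = 0)"

definition m_kernel :: "(real^3 \<Rightarrow> real) \<Rightarrow> (real^3 \<Rightarrow> complex) \<Rightarrow> kernel" where
  "m_kernel v f = (\<lambda>(x, y). - complex_of_real (v (x - y)) * cnj (f x) * cnj (f y))"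

text \<open>As an operator, \<open>g\<close> is the sum of minus the Laplacian, multiplication by
  \<open>hartree_potential v f\<close>, and the integral operator with kernel \<open>exchange_kernel v f\<close>. The first two
  are their own transposes.\<close>

definition exchange_kernel :: "(real^3 \<Rightarrow> real) \<Rightarrow> (real^3 \<Rightarrow> complex) \<Rightarrow> kernel" where
  "exchange_kernel v f = (\<lambda>(x, y). complex_of_real (v (x - y)) * f x * cnj (f y))"

text \<open>The part of \<open>g u + u g\<^sup>T\<close> without derivatives.\<close>

definition g_sym :: "(real^3 \<Rightarrow> real) \<Rightarrow> (real^3 \<Rightarrow> complex) \<Rightarrow> kernel \<Rightarrow> kernel" where
  "g_sym v f u = (\<lambda>(x, y).
     complex_of_real (hartree_potential v f x + hartree_potential v f y) * u (x, y)
     + (exchange_kernel v f \<odot> u) (x, y) + (u \<odot> ktranspose (exchange_kernel v f)) (x, y))"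

text \<open>The part of \<open>[g, p] = g p - p g\<close> without derivatives.\<close>

definition g_comm :: "(real^3 \<Rightarrow> real) \<Rightarrow> (real^3 \<Rightarrow> complex) \<Rightarrow> kernel \<Rightarrow> kernel" where
  "g_comm v f p = (\<lambda>(x, y).
     complex_of_real (hartree_potential v f x - hartree_potential v f y) * p (x, y)
     + (exchange_kernel v f \<odot> p) (x, y) - (p \<odot> exchange_kernel v f) (x, y))"

text \<open>\<open>S\<close> is \<open>i u\<^sub>t + u g\<^sup>T + g u\<close> and \<open>W\<close> is \<open>i p\<^sub>t + [g, p]\<close>.
  The equation is then an identity between kernels in \<open>L\<^sup>2\<close> at almost every time.\<close>

definition solves_u_equation ::
  "(real^3 \<Rightarrow> real) \<Rightarrow> (real \<Rightarrow> real^3 \<Rightarrow> complex) \<Rightarrow> real \<Rightarrow>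
   (real \<Rightarrow> kernel) \<Rightarrow> (real \<Rightarrow> kernel) \<Rightarrow> bool" where
  "solves_u_equation v \<phi> T u p \<longleftrightarrow> (\<exists>S W.
     weak_evolution T (\<lambda>\<psi> z. - lap_x \<psi> z - lap_y \<psi> z) u (\<lambda>t. g_sym v (\<phi> t) (u t)) S \<and>
     weak_evolution T (\<lambda>\<psi> z. - lap_x \<psi> z + lap_y \<psi> z) p (\<lambda>t. g_comm v (\<phi> t) (p t)) W \<and>
     (AE t in lborel. t \<in> {0..T} \<longrightarrow>
        (let m = m_kernel v (\<phi> t) in
         \<exists>r. is_inverse_one_plus (p t) r \<and>
           (AE z in lborel.
              S t z - (m z + (p t \<odot> m) z) =
              ((\<lambda>z'. W t z' + (u t \<odot> kconj m) z') \<odot> (\<lambda>z'. u t z' + (r \<odot> u t) z')) z))))"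

end

theory Submission
  imports Defs
begin

text \<open>Write \<open>c = 1 + p\<close>, \<open>W = i p\<^sub>t + [g, p]\<close> and \<open>S = i u\<^sub>t + g u + u g\<^sup>T\<close>, and let \<open>*\<close> denote the adjoint.
  Differentiating \<open>c\<^sup>2 = 1 + u (kconj u)\<close> gives \<open>S (kconj u) - u (kconj S) = W c + c W\<close>, while the equation for \<open>u\<close>
  and its adjoint give \<open>W c\<^sup>-\<^sup>1 + c\<^sup>-\<^sup>1 W = c\<^sup>-\<^sup>1 m (kconj u) - u (kconj m) c\<^sup>-\<^sup>1\<close>, because \<open>W* = - W\<close> and \<open>S\<close> is symmetric.
  Taking the trace of \<open>S (kconj u)\<close> and inserting the second identity, everything except
  \<open>tr (m (kconj u) c)\<close> is real, so that \<open>d/dt \<parallel>u\<parallel>\<^sup>2 = 2 Im (tr (m (kconj u) c)) \<le> 2 \<parallel>m\<parallel> \<parallel>u\<parallel> (1 + \<parallel>u\<parallel>\<^sup>2)\<^sup>1\<^sup>/\<^sup>2\<close>,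
  and a Gronwall argument for \<open>\<parallel>u\<parallel>\<close> finishes the proof. Neither \<open>u\<close> nor \<open>p\<close> is differentiable, and the two
  differentiations are one statement: a product rule for weak solutions, proved by testing against
  translates of an even mollifier. The evenness makes the contributions of the Laplacians cancel
  exactly before the mollification is removed.\<close>

section \<open>Square integrable functions\<close>

text \<open>The identity c^2 = 1 + u (kconj u) is never differentiated as such. Both of its sides,
  without the unit, are paths that solve weak equations with the same Laplacian part, and such an
  equation determines its source at almost every time; equating the sources yields the first
  identity. The same uniqueness makes the source for u symmetric and the source for p skew-adjoint.
  The obstacle is that only kernels in L^2 can be composed, which excludes the identity, the
  Laplacian and the potential. Hence c and its inverse appear expanded, as 1 + p and 1 + r, in an
  algebra without unit; the Laplacian stays on the test functions until it cancels; the potential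
  cancels pointwise under the integral sign. Only afterwards is the rest of g restored, by algebra.
  The shape of the bound comes from sqrt (y + y^2) <= q (1 + q) with q = sqrt y = norm of u:
  formally q' <= norm of m times (1 + q), so 1 + q(T) <= (1 + q(0)) e^M, where M is the time
  integral of the norm of m. The inequality e^M - 1 <= M e^M then turns this into the stated
  form.\<close>

lemma borel_measurable_cnj [measurable (raw)]:
  "f \<in> borel_measurable M \<Longrightarrow> (\<lambda>x. cnj (f x)) \<in> borel_measurable M"
  by (rule measurable_compose[OF _ borel_measurable_continuous_onI]) (auto intro: continuous_intros)

text \<open>The notion of \<open>L2_kernel\<close> over an arbitrary Euclidean space: sections of
  kernels, functions of one variable and mollifiers have to be handled as well.\<close>

definition sqint :: "('a::euclidean_space \<Rightarrow> complex) \<Rightarrow> bool" where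
  "sqint f \<longleftrightarrow> f \<in> borel_measurable borel \<and> integrable lborel (\<lambda>x. (cmod (f x))\<^sup>2)"

definition l2n :: "('a::euclidean_space \<Rightarrow> complex) \<Rightarrow> real" where
  "l2n f = sqrt (\<integral>x. (cmod (f x))\<^sup>2 \<partial>lborel)"

lemma L2_kernel_iff_sqint: "L2_kernel a \<longleftrightarrow> sqint a"
  by (simp add: L2_kernel_def sqint_def)

lemma L2_norm_eq_l2n: "L2_norm a = l2n a"
  by (simp add: L2_norm_def l2n_def)

lemma sqint_measurable [measurable_dest]: "sqint f \<Longrightarrow> f \<in> borel_measurable borel"
  by (simp add: sqint_def)

lemma sqintD: "sqint f \<Longrightarrow> integrable lborel (\<lambda>x. (cmod (f x))\<^sup>2)"
  by (simp add: sqint_def)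

lemma l2n_nonneg [simp]: "0 \<le> l2n f"
  by (simp add: l2n_def)

lemma l2n_square: "(l2n f)\<^sup>2 = (\<integral>x. (cmod (f x))\<^sup>2 \<partial>lborel)"
  by (simp add: l2n_def)

lemma sqint_iff_nn:
  "sqint f \<longleftrightarrow> f \<in> borel_measurable borel \<and> (\<integral>\<^sup>+x. ennreal ((cmod (f x))\<^sup>2) \<partial>lborel) < \<infinity>"
  unfolding sqint_def integrable_iff_bounded by auto

lemma nn_l2n: "sqint f \<Longrightarrow> (\<integral>\<^sup>+x. ennreal ((cmod (f x))\<^sup>2) \<partial>lborel) = ennreal ((l2n f)\<^sup>2)"
  unfolding l2n_square by (intro nn_integral_eq_integral) (auto simp: sqint_def)

text \<open>Finiteness of the \<open>ennreal\<close> integral already contains integrability, so a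
  single estimate yields membership in L^2 together with the norm bound.\<close>

lemma l2n_le_of_nn:
  assumes "(\<integral>\<^sup>+x. ennreal ((cmod (f x))\<^sup>2) \<partial>lborel) \<le> ennreal (c\<^sup>2)" "0 \<le> c" "f \<in> borel_measurable borel"
  shows "sqint f" "l2n f \<le> c"
proof -
  show s: "sqint f"
    using assms by (auto simp: sqint_iff_nn intro: le_less_trans)
  have "ennreal ((l2n f)\<^sup>2) \<le> ennreal (c\<^sup>2)"
    using assms(1) nn_l2n[OF s] by simp
  then have "(l2n f)\<^sup>2 \<le> c\<^sup>2" by (simp add: ennreal_le_iff)
  then show "l2n f \<le> c" using assms(2) power2_le_imp_le by blast
qed

lemma sqint_mult_integrable:
  fixes f g :: "'a::euclidean_space \<Rightarrow> complex"
  assumes "sqint f" "sqint g"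
  shows "integrable lborel (\<lambda>x. f x * g x)"
proof (rule Bochner_Integration.integrable_bound)
  show "integrable lborel (\<lambda>x. (cmod (f x))\<^sup>2 + (cmod (g x))\<^sup>2)"
    using assms by (auto simp: sqint_def)
  show "(\<lambda>x. f x * g x) \<in> borel_measurable lborel"
    using assms by (auto simp: sqint_def)
  have "norm (f x * g x) \<le> norm ((cmod (f x))\<^sup>2 + (cmod (g x))\<^sup>2)" for x
  proof -
    have "2 * (cmod (f x) * cmod (g x)) \<le> (cmod (f x))\<^sup>2 + (cmod (g x))\<^sup>2"
      using sum_squares_bound[of "cmod (f x)" "cmod (g x)"] by (simp add: mult.assoc)
    moreover have "0 \<le> cmod (f x) * cmod (g x)" by simp
    ultimately show ?thesis unfolding norm_mult real_norm_def by linarith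
  qed
  then show "AE x in lborel. norm (f x * g x) \<le> norm ((cmod (f x))\<^sup>2 + (cmod (g x))\<^sup>2)"
    by auto
qed

lemma nn_cauchy_schwarz:
  fixes f g :: "'a::euclidean_space \<Rightarrow> complex"
  assumes [measurable]: "f \<in> borel_measurable borel" "g \<in> borel_measurable borel"
  shows "(\<integral>\<^sup>+x. ennreal (cmod (f x) * cmod (g x)) \<partial>lborel)\<^sup>2
     \<le> (\<integral>\<^sup>+x. ennreal ((cmod (f x))\<^sup>2) \<partial>lborel) * (\<integral>\<^sup>+x. ennreal ((cmod (g x))\<^sup>2) \<partial>lborel)"
  using Cauchy_Schwarz_nn_integral[of "\<lambda>x. ennreal (cmod (f x))" lborel "\<lambda>x. ennreal (cmod (g x))"]
  by (simp add: ennreal_mult ennreal_power)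

lemma cauchy_schwarz_norm:
  fixes f g :: "'a::euclidean_space \<Rightarrow> complex"
  assumes f: "sqint f" and g: "sqint g"
  shows "(\<integral>x. cmod (f x * g x) \<partial>lborel) \<le> l2n f * l2n g"
proof -
  have i: "integrable lborel (\<lambda>x. cmod (f x * g x))"
    using sqint_mult_integrable[OF f g] by simp
  have "(\<integral>\<^sup>+x. ennreal (cmod (f x) * cmod (g x)) \<partial>lborel) = ennreal (\<integral>x. cmod (f x * g x) \<partial>lborel)"
    using nn_integral_eq_integral[OF i] by (simp add: norm_mult)
  then have "ennreal ((\<integral>x. cmod (f x * g x) \<partial>lborel)\<^sup>2) \<le> ennreal ((l2n f * l2n g)\<^sup>2)"
    using nn_cauchy_schwarz[of f g] f g
    by (simp add: sqint_measurable nn_l2n ennreal_power power_mult_distrib ennreal_mult)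
  then have "(\<integral>x. cmod (f x * g x) \<partial>lborel)\<^sup>2 \<le> (l2n f * l2n g)\<^sup>2"
    by (simp add: ennreal_le_iff)
  then show ?thesis by (meson l2n_nonneg mult_nonneg_nonneg power2_le_imp_le)
qed

lemma cauchy_schwarz_l2n:
  fixes f g :: "'a::euclidean_space \<Rightarrow> complex"
  assumes f: "sqint f" and g: "sqint g"
  shows "cmod (\<integral>x. f x * g x \<partial>lborel) \<le> l2n f * l2n g"
  using integral_norm_bound[of lborel "\<lambda>x. f x * g x"] cauchy_schwarz_norm[OF f g] by linarith

lemma sqint_zero [simp]: "sqint (\<lambda>x. 0)" and l2n_zero [simp]: "l2n (\<lambda>x. 0) = 0"
  by (auto simp: sqint_def l2n_def)

lemma sqint_cmult: "sqint f \<Longrightarrow> sqint (\<lambda>x. c * f x)"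
  by (auto simp: sqint_def norm_mult power_mult_distrib)

lemma l2n_cmult: "l2n (\<lambda>x. c * f x) = cmod c * l2n f"
  by (simp add: l2n_def norm_mult power_mult_distrib real_sqrt_mult)

lemma sqint_uminus: "sqint f \<Longrightarrow> sqint (\<lambda>x. - f x)"
  by (auto simp: sqint_def)

lemma sqint_cnj: "sqint f \<Longrightarrow> sqint (\<lambda>x. cnj (f x))"
  by (auto simp: sqint_def)

lemma l2n_cnj [simp]: "l2n (\<lambda>x. cnj (f x)) = l2n f"
  by (simp add: l2n_def)

lemma sqint_add:
  assumes "sqint f" "sqint g"
  shows "sqint (\<lambda>x. f x + g x)"
proof -
  have "integrable lborel (\<lambda>x. 2 * (cmod (f x))\<^sup>2 + 2 * (cmod (g x))\<^sup>2)"
    using assms by (auto simp: sqint_def)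
  moreover have "(cmod (f x + g x))\<^sup>2 \<le> 2 * (cmod (f x))\<^sup>2 + 2 * (cmod (g x))\<^sup>2" for x
  proof -
    have "(cmod (f x + g x))\<^sup>2 \<le> (cmod (f x) + cmod (g x))\<^sup>2"
      by (simp add: norm_triangle_ineq power_mono)
    then show ?thesis using sum_squares_bound[of "cmod (f x)" "cmod (g x)"]
      by (simp add: power2_sum)
  qed
  ultimately have "integrable lborel (\<lambda>x. (cmod (f x + g x))\<^sup>2)"
    using assms by (elim Bochner_Integration.integrable_bound) (auto simp: sqint_def)
  then show ?thesis using assms by (auto simp: sqint_def)
qed

lemma sqint_diff: "sqint f \<Longrightarrow> sqint g \<Longrightarrow> sqint (\<lambda>x. f x - g x)"
  using sqint_add[of f "\<lambda>x. - g x"] sqint_uminus[of g] by simp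

lemma sqint_sum: "(\<And>i. i \<in> I \<Longrightarrow> sqint (f i)) \<Longrightarrow> sqint (\<lambda>x. \<Sum>i\<in>I. f i x)"
  by (induction I rule: infinite_finite_induct) (auto intro: sqint_add)

lemma l2n_triangle:
  assumes f: "sqint f" and g: "sqint g"
  shows "l2n (\<lambda>x. f x + g x) \<le> l2n f + l2n g"
proof -
  have i: "integrable lborel (\<lambda>x. cmod (f x * g x))"
    using sqint_mult_integrable[OF f g] by simp
  have "(l2n (\<lambda>x. f x + g x))\<^sup>2
      \<le> (\<integral>x. (cmod (f x))\<^sup>2 + 2 * cmod (f x * g x) + (cmod (g x))\<^sup>2 \<partial>lborel)"
    unfolding l2n_square
  proof (rule integral_mono)
    show "integrable lborel (\<lambda>x. (cmod (f x + g x))\<^sup>2)"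
      using sqint_add[OF f g] by (simp add: sqint_def)
    show "integrable lborel (\<lambda>x. (cmod (f x))\<^sup>2 + 2 * cmod (f x * g x) + (cmod (g x))\<^sup>2)"
      using f g i by (auto simp: sqint_def)
    fix x
    have "(cmod (f x + g x))\<^sup>2 \<le> (cmod (f x) + cmod (g x))\<^sup>2"
      by (simp add: norm_triangle_ineq power_mono)
    then show "(cmod (f x + g x))\<^sup>2 \<le> (cmod (f x))\<^sup>2 + 2 * cmod (f x * g x) + (cmod (g x))\<^sup>2"
      by (simp add: power2_sum norm_mult)
  qed
  also have "\<dots> = (l2n f)\<^sup>2 + 2 * (\<integral>x. cmod (f x * g x) \<partial>lborel) + (l2n g)\<^sup>2"
    unfolding l2n_square using f g i by (simp add: sqint_def)
  also have "\<dots> \<le> (l2n f + l2n g)\<^sup>2"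
    using cauchy_schwarz_norm[OF f g] by (simp add: power2_sum)
  finally show ?thesis by (meson add_nonneg_nonneg l2n_nonneg power2_le_imp_le)
qed

lemma l2n_uminus [simp]: "l2n (\<lambda>x. - f x) = l2n f"
  by (simp add: l2n_def)

lemma l2n_minus_commute: "l2n (\<lambda>x. f x - g x) = l2n (\<lambda>x. g x - f x)"
  by (simp add: l2n_def norm_minus_commute)

lemma l2n_triangle_diff:
  "sqint f \<Longrightarrow> sqint g \<Longrightarrow> l2n (\<lambda>x. f x - g x) \<le> l2n f + l2n g"
  using l2n_triangle[of f "\<lambda>x. - g x"] sqint_uminus[of g] by simp

lemma l2n_eq_0_iff:
  assumes "sqint f"
  shows "l2n f = 0 \<longleftrightarrow> (AE x in lborel. f x = 0)"
  using assms by (simp add: l2n_def sqint_def integral_nonneg_eq_0_iff_AE)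

section \<open>Translations and reflections\<close>

text \<open>The Jacobian of x -> t + c x is a power of |c|, hence 1. The values c = 1 and c = -1
  supply translations and reflections.\<close>

lemma lborel_distr_affine_unit:
  fixes t :: "'a::euclidean_space"
  assumes "\<bar>c\<bar> = 1"
  shows "distr lborel borel (\<lambda>x. t + c *\<^sub>R x) = lborel"
  using lborel_affine[of c t] assms by (auto simp: density_1)

lemma integral_affine_unit:
  fixes t :: "'a::euclidean_space" and f :: "'a \<Rightarrow> 'b::{banach, second_countable_topology}"
  assumes "\<bar>c\<bar> = 1" and [measurable]: "f \<in> borel_measurable borel"
  shows "(\<integral>x. f (t + c *\<^sub>R x) \<partial>lborel) = (\<integral>x. f x \<partial>lborel)"
  by (subst (2) lborel_distr_affine_unit[OF assms(1), of t, symmetric]) (simp add: integral_distr)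

lemma integrable_affine_unit:
  fixes t :: "'a::euclidean_space" and f :: "'a \<Rightarrow> 'b::{banach, second_countable_topology}"
  assumes "\<bar>c\<bar> = 1" and [measurable]: "f \<in> borel_measurable borel"
  shows "integrable lborel (\<lambda>x. f (t + c *\<^sub>R x)) \<longleftrightarrow> integrable lborel f"
  by (subst (2) lborel_distr_affine_unit[OF assms(1), of t, symmetric]) (simp add: integrable_distr_eq)

lemmas integral_shift = integral_affine_unit[of 1, simplified]
lemmas integrable_shift = integrable_affine_unit[of 1, simplified]
lemmas integral_reflect = integral_affine_unit[of "-1", simplified]
lemma sqint_shift: "sqint f \<Longrightarrow> sqint (\<lambda>x. f (h + x))"
  using integrable_shift[of "\<lambda>x. (cmod (f x))\<^sup>2" h] by (auto simp: sqint_def)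

lemma l2n_shift: "f \<in> borel_measurable borel \<Longrightarrow> l2n (\<lambda>x. f (h + x)) = l2n f"
  using integral_shift[of "\<lambda>x. (cmod (f x))\<^sup>2" h] by (simp add: l2n_def)

section \<open>Fubini on products of Euclidean spaces\<close>

lemma fst_snd_swap_borel [measurable]:
  "fst \<in> (borel :: ('a::second_countable_topology \<times> 'b::second_countable_topology) measure) \<rightarrow>\<^sub>M borel"
  "snd \<in> (borel :: ('a::second_countable_topology \<times> 'b::second_countable_topology) measure) \<rightarrow>\<^sub>M borel"
  "prod.swap \<in> (borel :: ('a::second_countable_topology \<times> 'b::second_countable_topology) measure) \<rightarrow>\<^sub>M borel"
  unfolding prod.swap_def borel_prod[symmetric] by measurable

lemma AE_lborel_prodD:
  assumes "AE z in (lborel :: ('a::euclidean_space \<times> 'b::euclidean_space) measure). P z"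
  shows "AE x in lborel. AE y in lborel. P (x, y)"
  using assms unfolding lborel_prod[symmetric] by (rule lborel_pair.AE_pair)

lemma AE_lborel_prod_swap:
  fixes P :: "'a::euclidean_space \<times> 'b::euclidean_space \<Rightarrow> bool"
  assumes "AE z in lborel. P z"
  shows "AE z in lborel. P (prod.swap z)"
proof -
  have "AE z in distr (lborel \<Otimes>\<^sub>M lborel) (lborel \<Otimes>\<^sub>M lborel) (\<lambda>(x, y). (y, x)). P z"
    using assms unfolding lborel_prod[symmetric] by (subst lborel_pair.distr_pair_swap[symmetric])
  then have "AE z in (lborel \<Otimes>\<^sub>M lborel). P (case z of (x, y) \<Rightarrow> (y, x))"
    by (rule AE_distrD[rotated]) simp
  then show ?thesis unfolding lborel_prod[symmetric] by (simp add: case_prod_beta prod.swap_def)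
qed

lemma AE_lborel_prodD2:
  assumes "AE z in (lborel :: ('a::euclidean_space \<times> 'b::euclidean_space) measure). P z"
  shows "AE y in lborel. AE x in lborel. P (x, y)"
  using AE_lborel_prodD[OF AE_lborel_prod_swap[OF assms]] by simp

lemma AE_lborel_prodI:
  fixes P :: "'a::euclidean_space \<times> 'b::euclidean_space \<Rightarrow> bool"
  assumes "Measurable.pred borel P" "AE x in lborel. AE y in lborel. P (x, y)"
  shows "AE z in lborel. P z"
proof -
  have "{z. P z} \<in> sets borel" using assms(1) by (simp add: pred_def)
  then have "{z \<in> space (lborel \<Otimes>\<^sub>M lborel). P z} \<in> sets (lborel \<Otimes>\<^sub>M lborel)"
    unfolding lborel_prod by simp
  from lborel_pair.AE_pair_measure[OF this assms(2)] have "AE z in (lborel \<Otimes>\<^sub>M lborel). P z" .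
  then show ?thesis unfolding lborel_prod .
qed

lemma nn_integral_lborel_pair:
  fixes f :: "'a::euclidean_space \<times> 'b::euclidean_space \<Rightarrow> ennreal"
  assumes "f \<in> borel_measurable borel"
  shows "(\<integral>\<^sup>+z. f z \<partial>lborel) = (\<integral>\<^sup>+x. \<integral>\<^sup>+y. f (x, y) \<partial>lborel \<partial>lborel)"
  using lborel.nn_integral_fst[of f lborel] assms by (simp add: lborel_prod)

lemma nn_integral_lborel_pair_swap:
  fixes f :: "'a::euclidean_space \<times> 'b::euclidean_space \<Rightarrow> ennreal"
  assumes "f \<in> borel_measurable borel"
  shows "(\<integral>\<^sup>+z. f z \<partial>lborel) = (\<integral>\<^sup>+y. \<integral>\<^sup>+x. f (x, y) \<partial>lborel \<partial>lborel)"
  using lborel_pair.nn_integral_snd[of f] assms by (simp add: lborel_prod)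

lemma integral_lborel_pair:
  fixes f :: "'a::euclidean_space \<times> 'b::euclidean_space \<Rightarrow> complex"
  assumes "integrable lborel f"
  shows "(\<integral>z. f z \<partial>lborel) = (\<integral>x. \<integral>y. f (x, y) \<partial>lborel \<partial>lborel)"
  using lborel_pair.integral_fst'[of f] assms by (simp add: lborel_prod)

lemma integral_lborel_pair_swap:
  fixes f :: "'a::euclidean_space \<times> 'b::euclidean_space \<Rightarrow> complex"
  assumes "integrable lborel f"
  shows "(\<integral>z. f z \<partial>lborel) = (\<integral>y. \<integral>x. f (x, y) \<partial>lborel \<partial>lborel)"
  using lborel_pair.integral_snd[of "\<lambda>x y. f (x, y)"] assms by (simp add: lborel_prod)

lemma integral_swap_vars:
  fixes f :: "'a::euclidean_space \<times> 'b::euclidean_space \<Rightarrow> complex"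
  assumes "f \<in> borel_measurable borel"
  shows "(\<integral>z. f (prod.swap z) \<partial>lborel) = (\<integral>z. f z \<partial>lborel)"
  using lborel_pair.integral_product_swap[of f] assms
  by (simp add: lborel_prod prod.swap_def case_prod_beta')

lemma integrable_swap_vars:
  fixes f :: "'a::euclidean_space \<times> 'b::euclidean_space \<Rightarrow> 'c::{banach, second_countable_topology}"
  shows "integrable lborel (\<lambda>z. f (prod.swap z)) \<longleftrightarrow> integrable lborel f"
  using lborel_pair.integrable_product_swap_iff[of f]
  by (simp add: lborel_prod prod.swap_def case_prod_beta')

lemma AE_integrable_section:
  fixes f :: "'a::euclidean_space \<times> 'b::euclidean_space \<Rightarrow> 'c::{banach, second_countable_topology}"
  assumes "integrable lborel f"
  shows "AE x in lborel. integrable lborel (\<lambda>y. f (x, y))"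
  using lborel_pair.AE_integrable_fst'[of f] assms by (simp add: lborel_prod)

lemma sqint_swap:
  assumes "sqint (a :: 'a::euclidean_space \<times> 'b::euclidean_space \<Rightarrow> complex)"
  shows "sqint (\<lambda>z. a (prod.swap z))"
proof -
  have [measurable]: "a \<in> borel_measurable borel" using assms by (rule sqint_measurable)
  have "(\<lambda>z. a (prod.swap z)) \<in> borel_measurable borel" by measurable
  then show ?thesis
    using assms integrable_swap_vars[of "\<lambda>z. (cmod (a z))\<^sup>2"] by (auto simp: sqint_def)
qed

lemma l2n_swap:
  assumes "(a :: 'a::euclidean_space \<times> 'b::euclidean_space \<Rightarrow> complex) \<in> borel_measurable borel"
  shows "l2n (\<lambda>z. a (prod.swap z)) = l2n a"
proof -
  have "(\<integral>z. complex_of_real ((cmod (a (prod.swap z)))\<^sup>2) \<partial>lborel) = (\<integral>z. complex_of_real ((cmod (a z))\<^sup>2) \<partial>lborel)"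
    using assms by (intro integral_swap_vars[of "\<lambda>z. complex_of_real ((cmod (a z))\<^sup>2)"]) measurable
  then show ?thesis unfolding l2n_def integral_complex_of_real of_real_eq_iff by simp
qed

lemma borel_measurable_section [measurable (raw)]:
  assumes "a \<in> borel_measurable (borel :: ('a::euclidean_space \<times> 'b::euclidean_space) measure)"
  shows "(\<lambda>y. a (x, y)) \<in> borel_measurable borel" "(\<lambda>y. a (y, z)) \<in> borel_measurable borel"
  using assms by measurable

lemma AE_sqint_section:
  assumes a: "sqint (a :: 'a::euclidean_space \<times> 'b::euclidean_space \<Rightarrow> complex)"
  shows "AE x in lborel. sqint (\<lambda>y. a (x, y))"
  using AE_integrable_section[OF sqintD[OF a]] borel_measurable_section(1)[OF sqint_measurable[OF a]]
  by (auto simp: sqint_def)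

lemma AE_sqint_section2:
  assumes a: "sqint (a :: 'a::euclidean_space \<times> 'b::euclidean_space \<Rightarrow> complex)"
  shows "AE y in lborel. sqint (\<lambda>x. a (x, y))"
  using AE_sqint_section[OF sqint_swap[OF a]] by simp

lemma sqint_tensor:
  fixes f :: "'a::euclidean_space \<Rightarrow> complex" and g :: "'b::euclidean_space \<Rightarrow> complex"
  assumes f: "sqint f" and g: "sqint g"
  shows "sqint (\<lambda>(x, y). f x * g y)" "l2n (\<lambda>(x, y). f x * g y) \<le> l2n f * l2n g"
proof -
  have [measurable]: "f \<in> borel_measurable borel" "g \<in> borel_measurable borel"
    using assms by (auto simp: sqint_def)
  have m: "(\<lambda>(x, y). f x * g y) \<in> borel_measurable (borel :: ('a \<times> 'b) measure)"
    unfolding borel_prod[symmetric] by measurable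
  then have "(\<integral>\<^sup>+z. ennreal ((cmod (case z of (x, y) \<Rightarrow> f x * g y))\<^sup>2) \<partial>lborel)
      = (\<integral>\<^sup>+x. \<integral>\<^sup>+y. ennreal ((cmod (f x))\<^sup>2) * ennreal ((cmod (g y))\<^sup>2) \<partial>lborel \<partial>lborel)"
    by (subst nn_integral_lborel_pair) (auto simp: norm_mult power_mult_distrib ennreal_mult)
  also have "\<dots> = ennreal ((l2n f * l2n g)\<^sup>2)"
    using nn_l2n[OF f] nn_l2n[OF g]
    by (simp add: nn_integral_cmult nn_integral_multc power_mult_distrib ennreal_mult)
  finally have "(\<integral>\<^sup>+z. ennreal ((cmod (case z of (x, y) \<Rightarrow> f x * g y))\<^sup>2) \<partial>lborel) \<le> ennreal ((l2n f * l2n g)\<^sup>2)"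
    by simp
  from l2n_le_of_nn[OF this _ m]
  show "sqint (\<lambda>(x, y). f x * g y)" "l2n (\<lambda>(x, y). f x * g y) \<le> l2n f * l2n g" by auto
qed

text \<open>Integrability may fail: the Bochner integral is then 0 by convention. This permits an
  estimate of \<open>a \<odot> b\<close> at every point, even where its defining integral
  diverges.\<close>

lemma norm_integral_le_nn:
  fixes f :: "'a \<Rightarrow> 'b::{banach, second_countable_topology}"
  shows "ennreal (norm (integral\<^sup>L M f)) \<le> (\<integral>\<^sup>+x. ennreal (norm (f x)) \<partial>M)"
  by (cases "integrable M f") (auto simp: not_integrable_integral_eq intro: integral_norm_bound_ennreal)

text \<open>Fubini applies because the tensor product of f and g and the kernel b both lie in L^2,
  so that their product is integrable. With sections of two kernels for f and g this becomes
  associativity of composition.\<close>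

lemma bilinear_integral_swap:
  fixes f :: "'a::euclidean_space \<Rightarrow> complex" and g :: "'b::euclidean_space \<Rightarrow> complex"
  assumes f: "sqint f" and g: "sqint g" and b: "sqint b"
  shows "integrable lborel (\<lambda>z. f (fst z) * b z * g (snd z))"
    and "(\<integral>y. (\<integral>x. f x * b (x, y) \<partial>lborel) * g y \<partial>lborel) = (\<integral>z. f (fst z) * b z * g (snd z) \<partial>lborel)"
    and "(\<integral>x. f x * (\<integral>y. b (x, y) * g y \<partial>lborel) \<partial>lborel) = (\<integral>z. f (fst z) * b z * g (snd z) \<partial>lborel)"
proof -
  have "integrable lborel (\<lambda>z. (case z of (x, y) \<Rightarrow> f x * g y) * b z)"
    by (rule sqint_mult_integrable[OF sqint_tensor(1)[OF f g] b])
  then show i: "integrable lborel (\<lambda>z. f (fst z) * b z * g (snd z))"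
    by (simp add: case_prod_beta mult_ac)
  show "(\<integral>y. (\<integral>x. f x * b (x, y) \<partial>lborel) * g y \<partial>lborel) = (\<integral>z. f (fst z) * b z * g (snd z) \<partial>lborel)"
    by (subst integral_lborel_pair_swap[OF i]) simp
  show "(\<integral>x. f x * (\<integral>y. b (x, y) * g y \<partial>lborel) \<partial>lborel) = (\<integral>z. f (fst z) * b z * g (snd z) \<partial>lborel)"
    by (subst integral_lborel_pair[OF i]) (simp add: mult.assoc)
qed

section \<open>Composition of square integrable kernels\<close>

lemma kcomp_measurable [measurable (raw)]:
  assumes [measurable]: "a \<in> borel_measurable borel" "b \<in> borel_measurable borel"
  shows "a \<odot> b \<in> borel_measurable borel"
proof -
  have "(\<lambda>z. \<integral>w. a (fst z, w) * b (w, snd z) \<partial>lborel) \<in> borel_measurable borel"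
    by measurable
  then show ?thesis by (simp add: kcomp_def case_prod_beta)
qed

text \<open>Cauchy-Schwarz in the contracted variable bounds the square at (x, y) by a function of x
  times a function of y, and the double integral of such a product factors.\<close>

lemma kcomp_bound:
  assumes a: "sqint a" and b: "sqint b"
  shows sqint_kcomp: "sqint (a \<odot> b)" and l2n_kcomp: "l2n (a \<odot> b) \<le> l2n a * l2n b"
proof -
  have [measurable]: "a \<in> borel_measurable borel" "b \<in> borel_measurable borel"
    using assms by (auto simp: sqint_def)
  define \<alpha> where "\<alpha> x = (\<integral>\<^sup>+w. ennreal ((cmod (a (x, w)))\<^sup>2) \<partial>lborel)" for x
  define \<beta> where "\<beta> y = (\<integral>\<^sup>+w. ennreal ((cmod (b (w, y)))\<^sup>2) \<partial>lborel)" for y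
  have [measurable]: "\<alpha> \<in> borel_measurable borel" "\<beta> \<in> borel_measurable borel"
    unfolding \<alpha>_def \<beta>_def by measurable
  have "ennreal ((cmod ((a \<odot> b) (x, y)))\<^sup>2) \<le> \<alpha> x * \<beta> y" for x y
  proof -
    have "ennreal (cmod ((a \<odot> b) (x, y))) \<le> (\<integral>\<^sup>+w. ennreal (cmod (a (x, w)) * cmod (b (w, y))) \<partial>lborel)"
      using norm_integral_le_nn[of lborel "\<lambda>w. a (x, w) * b (w, y)"] by (simp add: kcomp_def norm_mult)
    then have "ennreal (cmod ((a \<odot> b) (x, y))) ^ 2 \<le> (\<integral>\<^sup>+w. ennreal (cmod (a (x, w)) * cmod (b (w, y))) \<partial>lborel) ^ 2"
      by (rule power_mono) simp
    also have "\<dots> \<le> \<alpha> x * \<beta> y"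
      unfolding \<alpha>_def \<beta>_def by (rule nn_cauchy_schwarz) measurable
    finally show ?thesis by (simp add: ennreal_power)
  qed
  then have "(\<integral>\<^sup>+z. ennreal ((cmod ((a \<odot> b) z))\<^sup>2) \<partial>lborel) \<le> (\<integral>\<^sup>+x. \<integral>\<^sup>+y. \<alpha> x * \<beta> y \<partial>lborel \<partial>lborel)"
    by (subst nn_integral_lborel_pair) (auto intro!: nn_integral_mono)
  also have "\<dots> = (\<integral>\<^sup>+x. \<alpha> x \<partial>lborel) * (\<integral>\<^sup>+y. \<beta> y \<partial>lborel)"
    by (simp add: nn_integral_cmult nn_integral_multc)
  also have "(\<integral>\<^sup>+x. \<alpha> x \<partial>lborel) = ennreal ((l2n a)\<^sup>2)"
    unfolding \<alpha>_def nn_l2n[OF a, symmetric] by (rule nn_integral_lborel_pair[symmetric]) measurable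
  also have "(\<integral>\<^sup>+y. \<beta> y \<partial>lborel) = ennreal ((l2n b)\<^sup>2)"
    unfolding \<beta>_def nn_l2n[OF b, symmetric] by (rule nn_integral_lborel_pair_swap[symmetric]) measurable
  finally have "(\<integral>\<^sup>+z. ennreal ((cmod ((a \<odot> b) z))\<^sup>2) \<partial>lborel) \<le> ennreal ((l2n a * l2n b)\<^sup>2)"
    by (simp add: ennreal_mult power_mult_distrib)
  from l2n_le_of_nn[OF this] show "sqint (a \<odot> b)" "l2n (a \<odot> b) \<le> l2n a * l2n b" by auto
qed

text \<open>Almost every section of a square integrable kernel is square integrable. The exceptional
  points are the reason why the distributive and associative laws below hold only almost
  everywhere.\<close>

lemma AE_kcomp_integrable:
  assumes a: "sqint a" and b: "sqint b"
  shows "AE x in lborel. AE y in lborel. integrable lborel (\<lambda>z. a (x, z) * b (z, y))"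
  using AE_sqint_section[OF a]
proof eventually_elim
  case (elim x)
  show ?case using AE_sqint_section2[OF b]
    by eventually_elim (rule sqint_mult_integrable[OF elim])
qed

lemma AE_kernelI:
  fixes f g :: kernel
  assumes [measurable]: "f \<in> borel_measurable borel" "g \<in> borel_measurable borel"
    and "AE x in lborel. AE y in lborel. f (x, y) = g (x, y)"
  shows "AE z in lborel. f z = g z"
  using assms(3) by (intro AE_lborel_prodI) measurable

lemma kcomp_cong:
  assumes "sqint a" "sqint a'" "sqint b" "sqint b'"
    and aa: "AE z in lborel. a z = a' z" and bb: "AE z in lborel. b z = b' z"
  shows "AE z in lborel. (a \<odot> b) z = (a' \<odot> b') z"
proof -
  have [measurable]: "a \<in> borel_measurable borel" "b \<in> borel_measurable borel"
    "a' \<in> borel_measurable borel" "b' \<in> borel_measurable borel"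
    using assms by (auto simp: sqint_def)
  show ?thesis
  proof (rule AE_kernelI)
    show "AE x in lborel. AE y in lborel. (a \<odot> b) (x, y) = (a' \<odot> b') (x, y)"
      using AE_lborel_prodD[OF aa]
    proof eventually_elim
      case (elim x)
      show ?case using AE_lborel_prodD2[OF bb]
      proof eventually_elim
        case (elim y)
        then have "AE z in lborel. a (x, z) * b (z, y) = a' (x, z) * b' (z, y)"
          using \<open>AE z in lborel. a (x, z) = a' (x, z)\<close> by eventually_elim simp
        then show ?case unfolding kcomp_def by (simp, intro integral_cong_AE) auto
      qed
    qed
  qed measurable
qed

lemma kcomp_add_left:
  assumes a: "sqint a" and a': "sqint a'" and b: "sqint b"
  shows "AE z in lborel. ((\<lambda>z. a z + a' z) \<odot> b) z = (a \<odot> b) z + (a' \<odot> b) z"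
proof -
  have [measurable]: "a \<in> borel_measurable borel" "b \<in> borel_measurable borel" "a' \<in> borel_measurable borel"
    using assms by (auto simp: sqint_def)
  show ?thesis
  proof (rule AE_kernelI)
    show "AE x in lborel. AE y in lborel.
        ((\<lambda>z. a z + a' z) \<odot> b) (x, y) = (a \<odot> b) (x, y) + (a' \<odot> b) (x, y)"
      using AE_kcomp_integrable[OF a b] AE_kcomp_integrable[OF a' b]
    proof eventually_elim
      case (elim x)
      then show ?case by eventually_elim (simp add: kcomp_def algebra_simps)
    qed
  qed measurable
qed

lemma kcomp_add_right:
  assumes a: "sqint a" and b: "sqint b" and b': "sqint b'"
  shows "AE z in lborel. (a \<odot> (\<lambda>z. b z + b' z)) z = (a \<odot> b) z + (a \<odot> b') z"
proof -
  have [measurable]: "a \<in> borel_measurable borel" "b \<in> borel_measurable borel" "b' \<in> borel_measurable borel"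
    using assms by (auto simp: sqint_def)
  show ?thesis
  proof (rule AE_kernelI)
    show "AE x in lborel. AE y in lborel.
        (a \<odot> (\<lambda>z. b z + b' z)) (x, y) = (a \<odot> b) (x, y) + (a \<odot> b') (x, y)"
      using AE_kcomp_integrable[OF a b] AE_kcomp_integrable[OF a b']
    proof eventually_elim
      case (elim x)
      then show ?case by eventually_elim (simp add: kcomp_def algebra_simps)
    qed
  qed measurable
qed

lemma kcomp_cmult_left: "(\<lambda>z. c * a z) \<odot> b = (\<lambda>z. c * (a \<odot> b) z)"
  by (auto simp: kcomp_def fun_eq_iff mult.assoc)

lemma kcomp_cmult_right: "a \<odot> (\<lambda>z. c * b z) = (\<lambda>z. c * (a \<odot> b) z)"
  by (auto simp: kcomp_def fun_eq_iff mult.left_commute)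

lemma kcomp_assoc:
  assumes a: "sqint a" and b: "sqint b" and c: "sqint c"
  shows "AE z in lborel. ((a \<odot> b) \<odot> c) z = (a \<odot> (b \<odot> c)) z"
proof -
  have [measurable]: "a \<in> borel_measurable borel" "b \<in> borel_measurable borel" "c \<in> borel_measurable borel"
    using assms by (auto simp: sqint_def)
  show ?thesis
  proof (rule AE_kernelI)
    show "AE x in lborel. AE y in lborel. ((a \<odot> b) \<odot> c) (x, y) = (a \<odot> (b \<odot> c)) (x, y)"
      using AE_sqint_section[OF a]
    proof eventually_elim
      case (elim x)
      show ?case using AE_sqint_section2[OF c]
        by eventually_elim (simp add: kcomp_def bilinear_integral_swap[OF elim _ b])
    qed
  qed measurable
qed

text \<open>The trace of the operator ab for two Hilbert-Schmidt operators, written directly as an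
  integral, so that no trace class operators have to be introduced.\<close>

definition ktrace2 :: "kernel \<Rightarrow> kernel \<Rightarrow> complex" where
  "ktrace2 a b = (\<integral>z. a z * b (prod.swap z) \<partial>lborel)"

lemma ktranspose_swap: "ktranspose a = (\<lambda>z. a (prod.swap z))"
  by (auto simp: ktranspose_def)

lemma ktrace2_pair:
  assumes a: "sqint a" and b: "sqint b"
  shows "ktrace2 a b = (\<integral>x. \<integral>y. a (x, y) * b (y, x) \<partial>lborel \<partial>lborel)"
  unfolding ktrace2_def
  by (subst integral_lborel_pair[OF sqint_mult_integrable[OF a sqint_swap[OF b]]]) simp

lemma ktrace2_assoc:
  assumes a: "sqint a" and b: "sqint b" and c: "sqint c"
  shows "ktrace2 (a \<odot> b) c = ktrace2 a (b \<odot> c)"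
proof -
  have [measurable]: "a \<in> borel_measurable borel" "b \<in> borel_measurable borel" "c \<in> borel_measurable borel"
    using assms by (auto simp: sqint_def)
  have ab[measurable]: "a \<odot> b \<in> borel_measurable borel" and bc[measurable]: "b \<odot> c \<in> borel_measurable borel"
    by measurable
  have "AE x in lborel. (\<integral>y. (a \<odot> b) (x, y) * c (y, x) \<partial>lborel) = (\<integral>y. a (x, y) * (b \<odot> c) (y, x) \<partial>lborel)"
    using AE_sqint_section[OF a] AE_sqint_section2[OF c]
    by eventually_elim (simp add: kcomp_def bilinear_integral_swap[OF _ _ b])
  then have "(\<integral>x. \<integral>y. (a \<odot> b) (x, y) * c (y, x) \<partial>lborel \<partial>lborel)
      = (\<integral>x. \<integral>y. a (x, y) * (b \<odot> c) (y, x) \<partial>lborel \<partial>lborel)"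
    by (rule integral_cong_AE[rotated 2]) measurable
  then show ?thesis
    using assms by (simp add: ktrace2_pair sqint_kcomp)
qed

lemma ktrace2_commute:
  assumes "a \<in> borel_measurable borel" "b \<in> borel_measurable borel"
  shows "ktrace2 a b = ktrace2 b a"
proof -
  have [measurable]: "a \<in> borel_measurable borel" "b \<in> borel_measurable borel" by fact+
  have "(\<lambda>z. b z * a (prod.swap z)) \<in> borel_measurable borel" by measurable
  from integral_swap_vars[OF this] show ?thesis by (simp add: ktrace2_def mult.commute)
qed

section \<open>The algebra of Hilbert-Schmidt operators\<close>

\<comment> \<open>Kernel identities hold only almost everywhere; on classes they become equations in
  a ring, open to simplification. The relation is partial because only square integrable kernels
  have a class. The ring has no unit, since the identity operator is not Hilbert-Schmidt.\<close>
quotient_type hs = "(real^3) \<times> (real^3) \<Rightarrow> complex" / partial: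
  "\<lambda>a b. sqint a \<and> sqint b \<and> (AE z in lborel. a z = b z)"
proof (rule part_equivpI)
  show "\<exists>x::kernel. sqint x \<and> sqint x \<and> (AE z in lborel. x z = x z)"
    by (rule exI[of _ "\<lambda>_. 0"]) simp
  show "symp (\<lambda>a b::kernel. sqint a \<and> sqint b \<and> (AE z in lborel. a z = b z))"
    by (auto simp: symp_def elim!: AE_mp)
  show "transp (\<lambda>a b::kernel. sqint a \<and> sqint b \<and> (AE z in lborel. a z = b z))"
    by (auto simp: transp_def elim!: AE_mp)
qed

lemma integral_mult_cong_AE:
  fixes a b :: "'a::euclidean_space \<Rightarrow> complex"
  assumes "sqint a" "sqint a'" "sqint b" "sqint b'" "AE z in lborel. a z = a' z" "AE z in lborel. b z = b' z"
  shows "(\<integral>z. a z * b z \<partial>lborel) = (\<integral>z. a' z * b' z \<partial>lborel)"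
proof (rule integral_cong_AE)
  show "AE z in lborel. a z * b z = a' z * b' z" using assms(5,6) by eventually_elim simp
qed (use assms in \<open>auto simp: sqint_def\<close>)

lemma kconj_kcomp: "kconj (a \<odot> b) = kconj a \<odot> kconj b"
  by (auto simp: kconj_def kcomp_def fun_eq_iff simp flip: complex_cnj_mult)

lemma ktranspose_kcomp: "ktranspose (a \<odot> b) = ktranspose b \<odot> ktranspose a"
  by (auto simp: ktranspose_def kcomp_def fun_eq_iff mult.commute)

lemma sqint_kconj: "sqint a \<Longrightarrow> sqint (kconj a)"
  by (simp add: kconj_def sqint_cnj)

lemma sqint_ktranspose: "sqint a \<Longrightarrow> sqint (ktranspose a)"
  by (simp add: ktranspose_swap sqint_swap)

text \<open>The scalars are real on purpose: conjugation of kernels is real-linear but not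
  complex-linear, and over the reals it is an ordinary bounded linear map. Hence the real part in
  the inner product.\<close>

instantiation hs :: real_inner
begin

lift_definition zero_hs :: hs is "\<lambda>_. 0" by simp
lift_definition plus_hs :: "hs \<Rightarrow> hs \<Rightarrow> hs" is "\<lambda>a b z. a z + b z"
  by (auto intro: sqint_add)
lift_definition uminus_hs :: "hs \<Rightarrow> hs" is "\<lambda>a z. - a z"
  by (auto intro: sqint_uminus)
lift_definition minus_hs :: "hs \<Rightarrow> hs \<Rightarrow> hs" is "\<lambda>a b z. a z - b z"
  by (auto intro: sqint_diff)
lift_definition scaleR_hs :: "real \<Rightarrow> hs \<Rightarrow> hs" is "\<lambda>r a z. complex_of_real r * a z"
  by (auto intro: sqint_cmult)
lift_definition inner_hs :: "hs \<Rightarrow> hs \<Rightarrow> real" is "\<lambda>a b. Re (\<integral>z. a z * cnj (b z) \<partial>lborel)"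
  by (auto intro!: arg_cong[where f=Re] integral_mult_cong_AE sqint_cnj)
definition norm_hs :: "hs \<Rightarrow> real" where "norm_hs a = sqrt (inner a a)"
definition sgn_hs :: "hs \<Rightarrow> hs" where "sgn_hs a = inverse (norm a) *\<^sub>R a"
definition dist_hs :: "hs \<Rightarrow> hs \<Rightarrow> real" where "dist_hs a b = norm (a - b)"
definition uniformity_hs :: "(hs \<times> hs) filter" where
  "uniformity_hs = (INF e\<in>{0 <..}. principal {(x, y). dist x y < e})"
definition open_hs :: "hs set \<Rightarrow> bool" where
  "open_hs S = (\<forall>x\<in>S. \<forall>\<^sub>F (x', y) in uniformity. x' = x \<longrightarrow> y \<in> S)"

lemma integral_self_cnj:
  "Re (\<integral>z. a z * cnj (a z) \<partial>lborel) = (l2n a)\<^sup>2"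
proof -
  have "(\<lambda>z. a z * cnj (a z)) = (\<lambda>z. complex_of_real ((cmod (a z))\<^sup>2))"
    by (simp add: fun_eq_iff complex_norm_square[symmetric])
  then show ?thesis by (simp only: integral_complex_of_real l2n_square) simp
qed

instance
proof
  fix a b c :: hs and r s :: real
  show "a + b + c = a + (b + c)"
    by transfer (auto intro!: sqint_add simp: algebra_simps)
  show "a + b = b + a"
    by transfer (auto intro!: sqint_add simp: algebra_simps)
  show "0 + a = a" by transfer simp
  show "- a + a = 0" by transfer (auto intro!: sqint_add sqint_uminus)
  show "a - b = a + - b"
    by transfer (auto intro!: sqint_add sqint_uminus sqint_diff)
  show "r *\<^sub>R (a + b) = r *\<^sub>R a + r *\<^sub>R b"
    by transfer (auto intro!: sqint_add sqint_cmult simp: ring_distribs)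
  show "(r + s) *\<^sub>R a = r *\<^sub>R a + s *\<^sub>R a"
    by transfer (auto intro!: sqint_add sqint_cmult simp: ring_distribs)
  show "r *\<^sub>R s *\<^sub>R a = (r * s) *\<^sub>R a"
    by transfer (auto intro!: sqint_add sqint_cmult simp: mult.assoc)
  show "1 *\<^sub>R a = a" by transfer simp
  show "sgn a = inverse (norm a) *\<^sub>R a" by (simp add: sgn_hs_def)
  show "dist a b = norm (a - b)" by (simp add: dist_hs_def)
  show "(uniformity :: (hs \<times> hs) filter) = (INF e\<in>{0 <..}. principal {(x, y). dist x y < e})"
    by (rule uniformity_hs_def)
  show "open U = (\<forall>x\<in>U. \<forall>\<^sub>F (x', y) in uniformity. x' = x \<longrightarrow> y \<in> U)" for U :: "hs set"
    by (rule open_hs_def)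
  show "inner a b = inner b a"
  proof transfer
    fix a b :: kernel
    have "(\<integral>z. a z * cnj (b z) \<partial>lborel) = cnj (\<integral>z. b z * cnj (a z) \<partial>lborel)"
      using Bochner_Integration.integral_cnj[of lborel "\<lambda>z. b z * cnj (a z)"]
      by (simp only: complex_cnj_mult complex_cnj_cnj mult.commute)
    then show "Re (\<integral>z. a z * cnj (b z) \<partial>lborel) = Re (\<integral>z. b z * cnj (a z) \<partial>lborel)" by simp
  qed
  show "inner (a + b) c = inner a c + inner b c"
  proof transfer
    fix a b c :: kernel
    assume "sqint a \<and> sqint a \<and> (AE z in lborel. a z = a z)"
      "sqint b \<and> sqint b \<and> (AE z in lborel. b z = b z)"
      "sqint c \<and> sqint c \<and> (AE z in lborel. c z = c z)"
    then show "Re (\<integral>z. (a z + b z) * cnj (c z) \<partial>lborel)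
        = Re (\<integral>z. a z * cnj (c z) \<partial>lborel) + Re (\<integral>z. b z * cnj (c z) \<partial>lborel)"
      by (simp add: ring_distribs sqint_mult_integrable sqint_cnj)
  qed
  show "inner (r *\<^sub>R a) b = r * inner a b"
    by transfer (simp add: mult.assoc)
  show "0 \<le> inner a a" by transfer (simp add: integral_self_cnj)
  show "(inner a a = 0) = (a = 0)"
    by transfer (auto simp: integral_self_cnj l2n_eq_0_iff)
  show "norm a = sqrt (inner a a)" by (rule norm_hs_def)
qed

end

instantiation hs :: real_normed_algebra
begin

lift_definition times_hs :: "hs \<Rightarrow> hs \<Rightarrow> hs" is kcomp
  by (blast intro: sqint_kcomp kcomp_cong)

text \<open>The norm is defined from the inner product and not lifted, so \<open>transfer\<close>
  does not know it. Used as a transfer rule, this turns the norm of a class into \<open>l2n\<close>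
  of a representative.\<close>

lemma norm_hs_transfer: "rel_fun cr_hs (=) l2n (norm :: hs \<Rightarrow> real)"
  unfolding norm_hs_def rel_fun_def
proof (intro allI impI)
  fix a and x :: hs assume "cr_hs a x"
  then have "inner x x = Re (\<integral>z. a z * cnj (a z) \<partial>lborel)"
    using inner_hs.transfer by (auto simp: rel_fun_def)
  then show "l2n a = sqrt (inner x x)" by (simp add: integral_self_cnj)
qed

instance
proof
  fix a b c :: hs and r :: real
  show "a * b * c = a * (b * c)"
    by transfer (auto intro!: sqint_kcomp kcomp_assoc)
  show "(a + b) * c = a * c + b * c"
    by transfer (auto intro!: sqint_kcomp sqint_add kcomp_add_left)
  show "a * (b + c) = a * b + a * c"
    by transfer (auto intro!: sqint_kcomp sqint_add kcomp_add_right)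
  show "r *\<^sub>R a * b = r *\<^sub>R (a * b)"
    by transfer (auto intro!: sqint_kcomp sqint_cmult simp: kcomp_cmult_left)
  show "a * r *\<^sub>R b = r *\<^sub>R (a * b)"
    by transfer (auto intro!: sqint_kcomp sqint_cmult simp: kcomp_cmult_right)
  note norm_hs_transfer[transfer_rule]
  show "norm (a * b) \<le> norm a * norm b"
    by transfer (auto intro: l2n_kcomp)
qed

end

section \<open>Conjugation, transposition and the trace pairing on classes\<close>

lift_definition cj :: "hs \<Rightarrow> hs" is kconj
  by (auto simp: kconj_def intro: sqint_cnj)

lemma AE_eq_swap:
  fixes a b :: "'a::euclidean_space \<times> 'b::euclidean_space \<Rightarrow> complex"
  shows "AE z in lborel. a z = b z \<Longrightarrow> AE z in lborel. a (prod.swap z) = b (prod.swap z)"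
  by (rule AE_lborel_prod_swap)

lift_definition tp :: "hs \<Rightarrow> hs" is ktranspose
  unfolding ktranspose_swap by (blast intro: sqint_swap AE_eq_swap)

lift_definition tr2 :: "hs \<Rightarrow> hs \<Rightarrow> complex" is ktrace2
  unfolding ktrace2_def
  by (intro integral_mult_cong_AE) (blast intro: sqint_swap AE_eq_swap)+

text \<open>\<open>abs_hs\<close> is unspecified outside the domain of the partial quotient, which
  explains the \<open>sqint\<close> premises of nearly all rules below.\<close>

definition hs_of :: "kernel \<Rightarrow> hs" where "hs_of = abs_hs"

lemma hs_of_eq_iff: "sqint a \<Longrightarrow> sqint b \<Longrightarrow> hs_of a = hs_of b \<longleftrightarrow> (AE z in lborel. a z = b z)"
  unfolding hs_of_def using Quotient3_rel[OF Quotient3_hs, of a b] by auto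

lemma hs_of_add: "sqint a \<Longrightarrow> sqint b \<Longrightarrow> hs_of (\<lambda>z. a z + b z) = hs_of a + hs_of b"
  unfolding hs_of_def by (simp add: plus_hs.abs_eq)

lemma hs_of_diff: "sqint a \<Longrightarrow> sqint b \<Longrightarrow> hs_of (\<lambda>z. a z - b z) = hs_of a - hs_of b"
  unfolding hs_of_def by (simp add: minus_hs.abs_eq)

lemma hs_of_zero: "hs_of (\<lambda>z. 0) = 0"
  unfolding hs_of_def by (simp add: zero_hs.abs_eq)

lemma hs_of_scaleR: "sqint a \<Longrightarrow> hs_of (\<lambda>z. complex_of_real r * a z) = r *\<^sub>R hs_of a"
  unfolding hs_of_def by (simp add: scaleR_hs.abs_eq)

lemma hs_of_kcomp: "sqint a \<Longrightarrow> sqint b \<Longrightarrow> hs_of (a \<odot> b) = hs_of a * hs_of b"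
  unfolding hs_of_def by (simp add: times_hs.abs_eq)

lemma hs_of_kconj: "sqint a \<Longrightarrow> hs_of (kconj a) = cj (hs_of a)"
  unfolding hs_of_def by (simp add: cj.abs_eq)

lemma hs_of_ktranspose: "sqint a \<Longrightarrow> hs_of (ktranspose a) = tp (hs_of a)"
  unfolding hs_of_def by (simp add: tp.abs_eq)

lemma hs_of_sum: "(\<And>i. i \<in> I \<Longrightarrow> sqint (f i)) \<Longrightarrow> hs_of (\<lambda>z. \<Sum>i\<in>I. f i z) = (\<Sum>i\<in>I. hs_of (f i))"
  by (induction I rule: infinite_finite_induct) (auto simp: hs_of_zero hs_of_add sqint_sum)

lemma norm_hs_of: "sqint a \<Longrightarrow> norm (hs_of a) = l2n a"
  unfolding hs_of_def norm_hs_def by (simp add: inner_hs.abs_eq integral_self_cnj)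

lemma tr2_hs_of: "sqint a \<Longrightarrow> sqint b \<Longrightarrow> tr2 (hs_of a) (hs_of b) = ktrace2 a b"
  unfolding hs_of_def by (simp add: tr2.abs_eq)

lemma cj_add: "cj (a + b) = cj a + cj b"
  by transfer (auto simp: kconj_def intro!: sqint_cnj sqint_add)
lemma cj_diff: "cj (a - b) = cj a - cj b"
  by transfer (auto simp: kconj_def intro!: sqint_cnj sqint_diff)
lemma cj_scaleR: "cj (r *\<^sub>R a) = r *\<^sub>R cj a"
  by transfer (auto simp: kconj_def intro!: sqint_cnj sqint_cmult)
lemma cj_mult: "cj (a * b) = cj a * cj b"
  by transfer (auto simp: kconj_kcomp intro!: sqint_kcomp sqint_kconj)
lemma cj_cj [simp]: "cj (cj a) = a"
  by transfer (auto simp: kconj_def)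
lemma norm_cj [simp]: "norm (cj a) = norm a"
proof -
  note norm_hs_transfer[transfer_rule]
  show ?thesis by transfer (simp add: kconj_def)
qed

lemma tp_add: "tp (a + b) = tp a + tp b"
  by transfer (auto simp: ktranspose_swap intro!: sqint_swap sqint_add)
lemma tp_diff: "tp (a - b) = tp a - tp b"
  by transfer (auto simp: ktranspose_swap intro!: sqint_swap sqint_diff)
lemma tp_scaleR: "tp (r *\<^sub>R a) = r *\<^sub>R tp a"
  by transfer (auto simp: ktranspose_swap intro!: sqint_swap sqint_cmult)
lemma tp_mult: "tp (a * b) = tp b * tp a"
  by transfer (auto simp: ktranspose_kcomp intro!: sqint_kcomp sqint_ktranspose)
lemma tp_tp [simp]: "tp (tp a) = a"
  by transfer (auto simp: ktranspose_swap)
lemma tp_cj: "tp (cj a) = cj (tp a)"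
  by transfer (auto simp: ktranspose_swap kconj_def intro!: sqint_swap sqint_cnj)

lemma tr2_assoc: "tr2 (a * b) c = tr2 a (b * c)"
  by transfer (auto intro: ktrace2_assoc)
lemma tr2_commute: "tr2 a b = tr2 b a"
  by transfer (auto intro: ktrace2_commute sqint_measurable)
lemma tr2_add_left: "tr2 (a + b) c = tr2 a c + tr2 b c"
  by transfer (simp add: ktrace2_def ring_distribs sqint_mult_integrable sqint_swap)
lemma tr2_add_right: "tr2 a (b + c) = tr2 a b + tr2 a c"
  by (metis tr2_add_left tr2_commute)
lemma tr2_diff_left: "tr2 (a - b) c = tr2 a c - tr2 b c"
  by (metis add_diff_cancel diff_add_cancel tr2_add_left)
lemma tr2_diff_right: "tr2 a (b - c) = tr2 a b - tr2 a c"
  by (metis tr2_diff_left tr2_commute)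
lemma tr2_tp: "tr2 (tp a) (tp b) = tr2 a b"
proof transfer
  fix a b :: kernel
  assume "sqint a \<and> sqint a \<and> (AE z in lborel. a z = a z)" "sqint b \<and> sqint b \<and> (AE z in lborel. b z = b z)"
  then show "ktrace2 (ktranspose a) (ktranspose b) = ktrace2 a b"
    using ktrace2_commute[of a b] by (simp add: ktrace2_def ktranspose_swap sqint_measurable mult.commute)
qed
lemma tr2_cj: "tr2 (cj a) (cj b) = cnj (tr2 a b)"
proof transfer
  fix a b :: kernel
  show "ktrace2 (kconj a) (kconj b) = cnj (ktrace2 a b)"
    using Bochner_Integration.integral_cnj[of lborel "\<lambda>z. a z * b (prod.swap z)"]
    by (simp only: ktrace2_def kconj_def complex_cnj_mult)
qed
lemma norm_tr2_le: "cmod (tr2 a b) \<le> norm a * norm b"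
proof -
  note norm_hs_transfer[transfer_rule]
  show ?thesis
    by transfer (auto simp: ktrace2_def l2n_swap sqint_measurable
        intro!: order_trans[OF cauchy_schwarz_l2n] sqint_swap)
qed
lemma tr2_self_adjoint: "tr2 a (cj (tp a)) = complex_of_real ((norm a)\<^sup>2)"
proof -
  note norm_hs_transfer[transfer_rule]
  show ?thesis
  proof transfer
    fix a :: kernel
    have "(\<lambda>z. a z * cnj (a z)) = (\<lambda>z. complex_of_real ((cmod (a z))\<^sup>2))"
      by (simp add: fun_eq_iff complex_norm_square[symmetric])
    then show "ktrace2 a (kconj (ktranspose a)) = complex_of_real ((l2n a)\<^sup>2)"
      unfolding ktrace2_def kconj_def ktranspose_swap l2n_square
      by (simp flip: integral_complex_of_real)
  qed
qed

section \<open>Hyperbolic functions of a symmetric kernel\<close>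

text \<open>The limits are given, so completeness is not needed.\<close>

lemma Cauchy_product_sums_of_sums:
  fixes a b :: "nat \<Rightarrow> 'a::real_normed_algebra"
  assumes a: "summable (\<lambda>n. norm (a n))" and b: "summable (\<lambda>n. norm (b n))"
    and A: "a sums A" and B: "b sums B"
  shows "(\<lambda>n. \<Sum>i\<le>n. a i * b (n - i)) sums (A * B)"
proof -
  let ?S1 = "\<lambda>n::nat. {..<n} \<times> {..<n}"
  let ?S2 = "\<lambda>n::nat. {(i,j). i + j < n}"
  have sub: "?S2 n \<subseteq> ?S1 n" for n by auto
  have fin: "finite (?S1 n)" for n by simp
  let ?g = "\<lambda>(i,j). a i * b j"
  let ?f = "\<lambda>(i,j). norm (a i) * norm (b j)"
  \<comment> \<open>The real Cauchy product is applied to the norms: their sum over the square minus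
    the triangle of indices tends to 0, and it dominates the corresponding sum of the products
    themselves.\<close>
  have "(\<lambda>n. (\<Sum>k<n. norm (a k)) * (\<Sum>k<n. norm (b k))) \<longlonglongrightarrow> (\<Sum>k. norm (a k)) * (\<Sum>k. norm (b k))"
    by (intro tendsto_mult summable_LIMSEQ a b)
  moreover have "(\<lambda>n. \<Sum>k<n. \<Sum>i\<le>k. norm (a i) * norm (b (k - i))) \<longlonglongrightarrow> (\<Sum>k. norm (a k)) * (\<Sum>k. norm (b k))"
    using Cauchy_product_sums[of "\<lambda>n. norm (a n)" "\<lambda>n. norm (b n)"] a b by (simp add: sums_def)
  ultimately have "(\<lambda>n. (\<Sum>k<n. norm (a k)) * (\<Sum>k<n. norm (b k))
      - (\<Sum>k<n. \<Sum>i\<le>k. norm (a i) * norm (b (k - i)))) \<longlonglongrightarrow> 0"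
    using tendsto_diff by fastforce
  then have lim0: "(\<lambda>n. sum ?f (?S1 n - ?S2 n)) \<longlonglongrightarrow> 0"
    by (simp only: sum_product sum.cartesian_product sum_diff[OF fin sub]
        sum.triangle_reindex[of "\<lambda>i j. norm (a i) * norm (b j)", symmetric])
  have "(\<lambda>n. sum ?g (?S1 n - ?S2 n)) \<longlonglongrightarrow> 0"
  proof (rule tendsto_norm_zero_cancel, rule tendsto_sandwich[OF _ _ tendsto_const lim0])
    show "\<forall>\<^sub>F n in sequentially. norm (sum ?g (?S1 n - ?S2 n)) \<le> sum ?f (?S1 n - ?S2 n)"
      by (intro always_eventually allI order_trans[OF norm_sum] sum_mono) (auto simp: norm_mult_ineq)
  qed auto
  moreover have "(\<lambda>n. (\<Sum>k<n. a k) * (\<Sum>k<n. b k)) \<longlonglongrightarrow> A * B"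
    using A B by (intro tendsto_mult) (auto simp: sums_def)
  ultimately have "(\<lambda>n. (\<Sum>k<n. a k) * (\<Sum>k<n. b k) - sum ?g (?S1 n - ?S2 n)) \<longlonglongrightarrow> A * B - 0"
    by (intro tendsto_diff)
  then show ?thesis
    by (simp add: sums_def sum_product sum.cartesian_product sum_diff[OF fin sub]
        sum.triangle_reindex[of "\<lambda>i j. a i * b j", symmetric])
qed

section \<open>Alternating products in the algebra\<close>

primrec altp :: "hs \<Rightarrow> nat \<Rightarrow> hs" where
  "altp K 0 = K"
| "altp K (Suc n) = K * cj (altp K n)"

lemma hs_of_alt_prod:
  assumes "sqint k"
  shows "sqint (alt_prod k n)" "hs_of (alt_prod k n) = altp (hs_of k) n"
proof (induction n)
  case (Suc n)
  show "sqint (alt_prod k (Suc n))" "hs_of (alt_prod k (Suc n)) = altp (hs_of k) (Suc n)"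
    using assms Suc by (simp_all add: sqint_kcomp sqint_kconj hs_of_kcomp hs_of_kconj)
qed (use assms in auto)

lemma cj_funpow_mult: "(cj ^^ n) (a * b) = (cj ^^ n) a * (cj ^^ n) b"
  by (induction n) (auto simp: cj_mult)

text \<open>After \<open>m + 1\<close> alternating factors the next factor has to carry
  \<open>m + 1\<close> conjugations, whence the iterate of \<open>cj\<close>. Its parity gives the
  two special cases for the series of sh and ch.\<close>

lemma altp_mult: "altp K m * (cj ^^ Suc m) (altp K n) = altp K (m + n + 1)"
proof (induction m)
  case (Suc m)
  have "altp K (Suc m) * (cj ^^ Suc (Suc m)) (altp K n) = K * cj (altp K m * (cj ^^ Suc m) (altp K n))"
    by (simp add: cj_mult mult.assoc)
  then show ?case using Suc by simp
qed auto

lemma cj_funpow_even [simp]: "even n \<Longrightarrow> (cj ^^ n) a = a"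
  and cj_funpow_odd: "odd n \<Longrightarrow> (cj ^^ n) a = cj a"
proof -
  have "(cj ^^ n) a = (if even n then a else cj a)" by (induction n) auto
  then show "even n \<Longrightarrow> (cj ^^ n) a = a" "odd n \<Longrightarrow> (cj ^^ n) a = cj a" by auto
qed

lemma altp_odd_mult: "altp K (2 * i + 1) * altp K (2 * j + 1) = altp K (2 * (i + j + 1) + 1)"
  using altp_mult[of K "2 * i + 1" "2 * j + 1"] by (simp add: algebra_simps)

lemma altp_even_mult: "altp K (2 * i) * cj (altp K (2 * j)) = altp K (2 * (i + j) + 1)"
  using altp_mult[of K "2 * i" "2 * j"] by (simp add: algebra_simps)

text \<open>Transposition reverses the order and leaves each factor alone, so the product now starts
  with its former last factor, which carries \<open>n\<close> conjugations.\<close>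

lemma tp_altp:
  assumes K: "tp K = K"
  shows "tp (altp K n) = (cj ^^ n) (altp K n)"
proof (induction n)
  case (Suc n)
  have "tp (altp K (Suc n)) = cj ((cj ^^ n) (altp K n)) * K"
    using Suc K by (simp add: tp_mult tp_cj)
  also have "\<dots> = (cj ^^ Suc n) (altp K n * (cj ^^ Suc n) K)"
    by (simp add: cj_mult cj_funpow_mult) (metis cj_funpow_even cj_funpow_odd cj_cj)
  also have "altp K n * (cj ^^ Suc n) K = altp K (Suc n)"
    using altp_mult[of K n 0] by simp
  finally show ?case .
qed (use K in auto)

lemma norm_altp: "norm (altp K n) \<le> norm K ^ Suc n"
proof (induction n)
  case (Suc n)
  have "norm (altp K (Suc n)) \<le> norm K * norm (altp K n)"
    using norm_mult_ineq[of K "cj (altp K n)"] by simp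
  also have "\<dots> \<le> norm K * norm K ^ Suc n" by (rule mult_left_mono[OF Suc]) simp
  finally show ?case by simp
qed auto

lemma L2_sums_hs:
  assumes "L2_sums f a" "\<And>n. sqint (f n)"
  shows "sqint a" "(\<lambda>n. hs_of (f n)) sums hs_of a"
proof -
  show a: "sqint a" using assms by (simp add: L2_sums_def L2_kernel_iff_sqint)
  have "norm (hs_of a - (\<Sum>j<n. hs_of (f j))) = L2_norm (\<lambda>z. a z - (\<Sum>j<n. f j z))" for n
    using assms(2) a
    by (simp add: L2_norm_eq_l2n sqint_diff sqint_sum flip: norm_hs_of hs_of_diff hs_of_sum)
  then have "(\<lambda>n. norm (hs_of a - (\<Sum>j<n. hs_of (f j)))) \<longlonglongrightarrow> 0"
    using assms(1) by (simp add: L2_sums_def)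
  then have "(\<lambda>n. hs_of a - (\<Sum>j<n. hs_of (f j))) \<longlonglongrightarrow> 0" by (rule tendsto_norm_zero_cancel)
  from tendsto_diff[OF tendsto_const[of "hs_of a"] this] show "(\<lambda>n. hs_of (f n)) sums hs_of a"
    by (simp add: sums_def)
qed

lemma sum_even_odd_split:
  "(\<Sum>i\<le>2 * n. g i) = (\<Sum>i\<le>n. g (2 * i)) + (\<Sum>i<n. g (2 * i + 1 :: nat) :: 'a::comm_monoid_add)"
  by (induction n) (auto simp: algebra_simps)

text \<open>The coefficient of degree 2n + 4 in 2 (cosh - 1) + (cosh - 1)^2 = sinh^2. Multiplied by
  (2n + 4)! it says that the even and the odd binomial coefficients of row 2n + 4 have the same
  sum.\<close>

lemma cosh_sinh_coefficients:
  "2 / fact (2 * n + 4) + (\<Sum>i\<le>n. 1 / (fact (2 * i + 2) * fact (2 * (n - i) + 2)))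
    = (\<Sum>i\<le>Suc n. 1 / (fact (2 * i + 1) * fact (2 * (Suc n - i) + 1)) :: real)"
proof -
  define c where "c j = real ((2 * (n + 2)) choose j)" for j
  have b: "c j = fact (2 * n + 4) * (1 / (fact j * fact (2 * n + 4 - j)))"
    if "j \<le> 2 * n + 4" for j
  proof -
    have "2 * (n + 2) = 2 * n + 4" by simp
    then show ?thesis using binomial_fact[of j "2 * n + 4", where 'a=real] that
      unfolding c_def by (simp only:) simp
  qed
  have "(\<Sum>i\<le>2 * (n + 2). (- 1) ^ i * c i) = 0" unfolding c_def by (rule choose_alternating_sum) simp
  then have eq: "(\<Sum>i\<le>n + 2. c (2 * i)) = (\<Sum>i<n + 2. c (2 * i + 1))"
    unfolding sum_even_odd_split by (simp add: sum_negf)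
  \<comment> \<open>The two ends of the row, each equal to 1, are split off; they are the
    contribution of the linear term 2 (cosh - 1).\<close>
  have "(\<Sum>i\<le>n + 2. c (2 * i))
      = 2 + (\<Sum>i\<le>n. c (2 * i + 2))"
    using b[of 0] b[of "2 * n + 4"]
    unfolding add_2_eq_Suc' sum.atMost_Suc_shift[of _ "Suc n"] sum.atMost_Suc[of _ n] by (simp add: eval_nat_numeral)
  also have "(\<Sum>i\<le>n. c (2 * i + 2))
      = (\<Sum>i\<le>n. fact (2 * n + 4) * (1 / (fact (2 * i + 2) * fact (2 * (n - i) + 2))))"
  proof (intro sum.cong refl)
    fix i assume "i \<in> {..n}"
    then have "2 * n + 4 - (2 * i + 2) = 2 * (n - i) + 2" "2 * i + 2 \<le> 2 * n + 4" by auto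
    with b[of "2 * i + 2"] show "c (2 * i + 2) = fact (2 * n + 4) * (1 / (fact (2 * i + 2) * fact (2 * (n - i) + 2)))"
      by (simp only:)
  qed
  finally have 1: "(\<Sum>i\<le>n + 2. c (2 * i))
      = fact (2 * n + 4) * (2 / fact (2 * n + 4) + (\<Sum>i\<le>n. 1 / (fact (2 * i + 2) * fact (2 * (n - i) + 2))))"
    by (simp add: distrib_left sum_distrib_left)
  have "(\<Sum>i<n + 2. c (2 * i + 1))
      = (\<Sum>i\<le>Suc n. fact (2 * n + 4) * (1 / (fact (2 * i + 1) * fact (2 * (Suc n - i) + 1))))"
    unfolding add_2_eq_Suc' lessThan_Suc_atMost
  proof (intro sum.cong refl)
    fix i assume "i \<in> {..Suc n}"
    then have "2 * n + 4 - (2 * i + 1) = 2 * (Suc n - i) + 1" "2 * i + 1 \<le> 2 * n + 4" by auto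
    with b[of "2 * i + 1"] show "c (2 * i + 1)
        = fact (2 * n + 4) * (1 / (fact (2 * i + 1) * fact (2 * (Suc n - i) + 1)))"
      by simp
  qed
  then have 2: "(\<Sum>i<n + 2. c (2 * i + 1))
      = fact (2 * n + 4) * (\<Sum>i\<le>Suc n. 1 / (fact (2 * i + 1) * fact (2 * (Suc n - i) + 1)))"
    by (simp only: sum_distrib_left)
  show ?thesis using eq unfolding 1 2 by (simp only: mult_cancel_left) simp
qed

lemma bounded_linear_cj: "bounded_linear cj"
  by (rule bounded_linear_intro[of _ 1]) (auto simp: cj_add cj_scaleR)

lemma norm_tp [simp]: "norm (tp a) = norm a"
proof -
  note norm_hs_transfer[transfer_rule]
  show ?thesis by transfer (simp add: ktranspose_swap l2n_swap sqint_measurable)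
qed

lemma bounded_linear_tp: "bounded_linear tp"
  by (rule bounded_linear_intro[of _ 1]) (auto simp: tp_add tp_scaleR)

text \<open>Domination by the exponential series in the norm of \<open>K\<close>. The injection
  \<open>f\<close> selects the even products for sh and the odd ones for ch - 1.\<close>

lemma summable_altp:
  assumes "inj f"
  shows "summable (\<lambda>n. norm ((1 / fact (Suc (f n))) *\<^sub>R altp K (f n)))"
proof (rule summable_comparison_test')
  have "summable (\<lambda>n. norm K ^ n / fact n)"
    using summable_exp[of "norm K"] by (simp add: field_simps)
  then have "summable (\<lambda>n. norm K ^ Suc n / fact (Suc n))" by (subst summable_Suc_iff)
  then have "summable ((\<lambda>n. norm K ^ Suc n / fact (Suc n)) \<circ> f)"
    using assms by (intro summable_reindex) auto
  then show "summable (\<lambda>n. norm K ^ Suc (f n) / fact (Suc (f n)))" by (simp add: o_def)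
  fix n :: nat
  have "norm (altp K (f n)) / fact (Suc (f n)) \<le> norm K ^ Suc (f n) / fact (Suc (f n))"
    by (rule divide_right_mono[OF norm_altp]) simp
  then show "norm (norm ((1 / fact (Suc (f n))) *\<^sub>R altp K (f n))) \<le> norm K ^ Suc (f n) / fact (Suc (f n))"
    by simp
qed

text \<open>All conclusions are read off termwise from the series. The last one is ch(k)^2 = 1 +
  sh(k) (kconj sh(k)) with the unit cancelled: by Cauchy products both sides are series in the odd
  alternating products, with the same coefficients \<open>r n\<close>.\<close>

lemma sh_ch_identities:
  assumes k: "L2_kernel k" "symmetric_kernel k" and sh: "is_sh k u" and ch: "is_ch_minus_one k p"
  shows "sqint u" "sqint p"
    and "tp (hs_of u) = hs_of u"
    and "cj (tp (hs_of p)) = hs_of p"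
    and "2 *\<^sub>R hs_of p + hs_of p * hs_of p = hs_of u * cj (hs_of u)"
proof -
  define K where "K = hs_of k"
  have k1: "sqint k" using k by (simp add: L2_kernel_iff_sqint)
  have "hs_of (ktranspose k) = hs_of k"
    using k k1 by (simp add: hs_of_eq_iff sqint_ktranspose symmetric_kernel_def)
  then have K: "tp K = K" using k1 by (simp add: K_def hs_of_ktranspose)
  have trm: "(\<lambda>z. alt_prod k n z / fact m) = (\<lambda>z. complex_of_real (1 / fact m) * alt_prod k n z)" for n m
    by (simp add: fun_eq_iff)
  have sq: "sqint (\<lambda>z. alt_prod k n z / fact m)" for n m
    unfolding trm by (intro sqint_cmult hs_of_alt_prod k1)
  have hs: "hs_of (\<lambda>z. alt_prod k n z / fact m) = (1 / fact m) *\<^sub>R altp K n" for n m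
    unfolding trm by (simp only: hs_of_scaleR hs_of_alt_prod k1 K_def)
  show u: "sqint u" using L2_sums_hs(1) sh sq unfolding is_sh_def by blast
  show p: "sqint p" using L2_sums_hs(1) ch sq unfolding is_ch_minus_one_def by blast
  define U where "U = hs_of u"
  define P where "P = hs_of p"
  have U: "(\<lambda>n. (1 / fact (2 * n + 1)) *\<^sub>R altp K (2 * n)) sums U"
    using L2_sums_hs(2)[OF sh[unfolded is_sh_def] sq] unfolding hs U_def .
  have P: "(\<lambda>n. (1 / fact (2 * n + 2)) *\<^sub>R altp K (2 * n + 1)) sums P"
    using L2_sums_hs(2)[OF ch[unfolded is_ch_minus_one_def] sq] unfolding hs P_def .
  have "(\<lambda>n. tp ((1 / fact (2 * n + 1)) *\<^sub>R altp K (2 * n))) sums tp U"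
    by (rule bounded_linear.sums[OF bounded_linear_tp U])
  then have "tp U = U" using U by (simp add: tp_scaleR tp_altp[OF K] sums_unique2)
  then show "tp (hs_of u) = hs_of u" by (simp add: U_def)
  have "(\<lambda>n. cj (tp ((1 / fact (2 * n + 2)) *\<^sub>R altp K (2 * n + 1)))) sums cj (tp P)"
    by (intro bounded_linear.sums[OF bounded_linear_cj] bounded_linear.sums[OF bounded_linear_tp P])
  moreover have "cj (tp ((1 / fact (2 * n + 2)) *\<^sub>R altp K (2 * n + 1))) = (1 / fact (2 * n + 2)) *\<^sub>R altp K (2 * n + 1)" for n
    using tp_altp[OF K, of "2 * n + 1"] by (simp only: tp_scaleR cj_scaleR) (simp add: cj_funpow_odd del: altp.simps funpow.simps)
  ultimately have "cj (tp P) = P" using P by (simp only: sums_unique2)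
  then show "cj (tp (hs_of p)) = hs_of p" by (simp add: P_def)
  have injs: "inj (\<lambda>n::nat. 2 * n)" "inj (\<lambda>n::nat. 2 * n + 1)" by (auto simp: inj_def)
  have sU: "summable (\<lambda>n. norm ((1 / fact (2 * n + 1)) *\<^sub>R altp K (2 * n)))"
    using summable_altp[OF injs(1), of K] by (simp only: Suc_eq_plus1)
  have sP: "summable (\<lambda>n. norm ((1 / fact (2 * n + 2)) *\<^sub>R altp K (2 * n + 1)))"
    using summable_altp[OF injs(2), of K] by (simp only: Suc_eq_plus1 add.assoc one_add_one)
  define q where "q n = (\<Sum>i\<le>n. 1 / (fact (2 * i + 2) * fact (2 * (n - i) + 2)) :: real)" for n
  define r where "r n = (\<Sum>i\<le>n. 1 / (fact (2 * i + 1) * fact (2 * (n - i) + 1)) :: real)" for n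
  have "(\<lambda>n. \<Sum>i\<le>n. ((1 / fact (2 * i + 2)) *\<^sub>R altp K (2 * i + 1)) * ((1 / fact (2 * (n - i) + 2)) *\<^sub>R altp K (2 * (n - i) + 1))) sums (P * P)"
    by (rule Cauchy_product_sums_of_sums[OF sP sP P P])
  moreover have "(\<Sum>i\<le>n. ((1 / fact (2 * i + 2)) *\<^sub>R altp K (2 * i + 1)) * ((1 / fact (2 * (n - i) + 2)) *\<^sub>R altp K (2 * (n - i) + 1)))
      = q n *\<^sub>R altp K (2 * (n + 1) + 1)" for n
    unfolding q_def scaleR_sum_left
  proof (intro sum.cong refl)
    fix i assume "i \<in> {..n}"
    then have "altp K (2 * i + 1) * altp K (2 * (n - i) + 1) = altp K (2 * (n + 1) + 1)"
      using altp_odd_mult[of K i "n - i"] by (simp del: altp.simps)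
    then show "((1 / fact (2 * i + 2)) *\<^sub>R altp K (2 * i + 1)) * ((1 / fact (2 * (n - i) + 2)) *\<^sub>R altp K (2 * (n - i) + 1))
      = (1 / (fact (2 * i + 2) * fact (2 * (n - i) + 2))) *\<^sub>R altp K (2 * (n + 1) + 1)"
      by (simp only: mult_scaleR_left mult_scaleR_right scaleR_scaleR) (simp add: mult.commute)
  qed
  ultimately have "(\<lambda>n. q n *\<^sub>R altp K (2 * (n + 1) + 1)) sums (P * P)" by simp
  \<comment> \<open>The square of ch - 1 starts one index later than ch - 1 itself. The inserted 0
    aligns the two series so that they can be added term by term.\<close>
  moreover define f where "f n = (case n of 0 \<Rightarrow> 0 | Suc m \<Rightarrow> q m *\<^sub>R altp K (2 * n + 1))" for n
  ultimately have "(\<lambda>n. f (Suc n)) sums (P * P)" by (simp del: altp.simps)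
  then have "f sums (P * P)" using sums_Suc_iff[of f "P * P"] by (simp add: f_def)
  with sums_scaleR_right[OF P, of 2]
  have "(\<lambda>n. 2 *\<^sub>R ((1 / fact (2 * n + 2)) *\<^sub>R altp K (2 * n + 1)) + f n) sums (2 *\<^sub>R P + P * P)"
    by (rule sums_add)
  moreover have "2 *\<^sub>R ((1 / fact (2 * n + 2)) *\<^sub>R altp K (2 * n + 1)) + f n = r n *\<^sub>R altp K (2 * n + 1)" for n
  proof (cases n)
    case 0 then show ?thesis by (simp add: f_def r_def)
  next
    case (Suc m)
    have "2 / fact (2 * n + 2) + q m = r n"
    proof -
      have "2 * Suc m + 2 = 2 * m + 4" by simp
      then show ?thesis using cosh_sinh_coefficients[of m] unfolding Suc q_def r_def by (simp only:)
    qed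
    then show ?thesis unfolding f_def Suc by (simp del: altp.simps flip: scaleR_left_distrib)
  qed
  ultimately have 1: "(\<lambda>n. r n *\<^sub>R altp K (2 * n + 1)) sums (2 *\<^sub>R P + P * P)" by simp
  have cU: "(\<lambda>n. cj ((1 / fact (2 * n + 1)) *\<^sub>R altp K (2 * n))) sums cj U"
    by (rule bounded_linear.sums[OF bounded_linear_cj U])
  have "(\<lambda>n. \<Sum>i\<le>n. ((1 / fact (2 * i + 1)) *\<^sub>R altp K (2 * i)) * cj ((1 / fact (2 * (n - i) + 1)) *\<^sub>R altp K (2 * (n - i)))) sums (U * cj U)"
    by (rule Cauchy_product_sums_of_sums[OF sU _ U cU]) (use sU in simp)
  moreover have "(\<Sum>i\<le>n. ((1 / fact (2 * i + 1)) *\<^sub>R altp K (2 * i)) * cj ((1 / fact (2 * (n - i) + 1)) *\<^sub>R altp K (2 * (n - i))))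
      = r n *\<^sub>R altp K (2 * n + 1)" for n
    unfolding r_def scaleR_sum_left
  proof (intro sum.cong refl)
    fix i assume "i \<in> {..n}"
    then have "altp K (2 * i) * cj (altp K (2 * (n - i))) = altp K (2 * n + 1)"
      using altp_even_mult[of K i "n - i"] by (simp del: altp.simps)
    then show "((1 / fact (2 * i + 1)) *\<^sub>R altp K (2 * i)) * cj ((1 / fact (2 * (n - i) + 1)) *\<^sub>R altp K (2 * (n - i)))
      = (1 / (fact (2 * i + 1) * fact (2 * (n - i) + 1))) *\<^sub>R altp K (2 * n + 1)"
      by (simp only: cj_scaleR mult_scaleR_left mult_scaleR_right scaleR_scaleR) (simp add: mult.commute)
  qed
  ultimately have "(\<lambda>n. r n *\<^sub>R altp K (2 * n + 1)) sums (U * cj U)" by simp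
  from sums_unique2[OF 1 this] show "2 *\<^sub>R hs_of p + hs_of p * hs_of p = hs_of u * cj (hs_of u)"
    by (simp add: U_def P_def)
qed

section \<open>Smooth functions with compact support\<close>

lemma Ck_on_SucD: "Ck_on (Suc n) X f \<Longrightarrow> Ck_on n X f"
proof (induction n arbitrary: f)
  case 0
  then show ?case by (auto intro: has_derivative_continuous_on)
next
  case (Suc n)
  then obtain f' where "\<forall>x\<in>X. (f has_derivative f' x) (at x within X)" "\<forall>d. Ck_on (Suc n) X (\<lambda>x. f' x d)"
    unfolding Ck_on.simps(2)[of "Suc n"] by blast
  then show ?case using Suc.IH unfolding Ck_on.simps(2)[of n] by blast
qed

lemma Ck_on_const: "Ck_on n X (\<lambda>x. c)"
proof (induction n arbitrary: c)
  case (Suc n)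
  then show ?case by (auto intro!: exI[of _ "\<lambda>x d. 0"])
qed auto

lemma Ck_on_add:
  "Ck_on n X f \<Longrightarrow> Ck_on n X g \<Longrightarrow> Ck_on n X (\<lambda>x. f x + g x)"
proof (induction n arbitrary: f g)
  case (Suc n)
  then obtain f' g' where "\<forall>x\<in>X. (f has_derivative f' x) (at x within X)" "\<forall>d. Ck_on n X (\<lambda>x. f' x d)"
    "\<forall>x\<in>X. (g has_derivative g' x) (at x within X)" "\<forall>d. Ck_on n X (\<lambda>x. g' x d)"
    by auto
  then show ?case using Suc.IH
    by (auto intro!: exI[of _ "\<lambda>x d. f' x d + g' x d"] derivative_intros)
qed (auto intro: continuous_intros)

lemma Ck_on_mult:
  fixes f g :: "'a::euclidean_space \<Rightarrow> 'b::real_normed_algebra"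
  shows "Ck_on n X f \<Longrightarrow> Ck_on n X g \<Longrightarrow> Ck_on n X (\<lambda>x. f x * g x)"
proof (induction n arbitrary: f g)
  case (Suc n)
  have "Ck_on n X f" "Ck_on n X g" using Suc.prems Ck_on_SucD by blast+
  moreover from Suc obtain f' g' where "\<forall>x\<in>X. (f has_derivative f' x) (at x within X)" "\<forall>d. Ck_on n X (\<lambda>x. f' x d)"
    "\<forall>x\<in>X. (g has_derivative g' x) (at x within X)" "\<forall>d. Ck_on n X (\<lambda>x. g' x d)"
    by auto
  ultimately show ?case using Suc.IH
    by (auto intro!: exI[of _ "\<lambda>x d. f x * g' x d + f' x d * g x"] has_derivative_mult Ck_on_add)
qed (auto intro: continuous_intros)

lemma Ck_on_prod:
  fixes f :: "'i \<Rightarrow> 'a::euclidean_space \<Rightarrow> 'b::{real_normed_algebra, comm_ring_1}"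
  shows "(\<And>i. i \<in> I \<Longrightarrow> Ck_on n X (f i)) \<Longrightarrow> Ck_on n X (\<lambda>x. \<Prod>i\<in>I. f i x)"
  by (induction I rule: infinite_finite_induct) (auto intro: Ck_on_const Ck_on_mult)

lemma Ck_on_linear:
  assumes L: "bounded_linear L"
  shows "Ck_on n X f \<Longrightarrow> Ck_on n X (\<lambda>x. L (f x))"
proof (induction n arbitrary: f)
  case 0
  then show ?case by (auto intro: bounded_linear.continuous_on[OF L])
next
  case (Suc n)
  then obtain f' where "\<forall>x\<in>X. (f has_derivative f' x) (at x within X)" "\<forall>d. Ck_on n X (\<lambda>x. f' x d)"
    by auto
  then show ?case using Suc.IH
    by (auto intro!: exI[of _ "\<lambda>x d. L (f' x d)"] bounded_linear.has_derivative[OF L])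
qed

lemma Ck_on_compose_affine:
  fixes L :: "'a::euclidean_space \<Rightarrow> 'c::euclidean_space"
  assumes L: "bounded_linear L"
  shows "Ck_on n UNIV f \<Longrightarrow> Ck_on n UNIV (\<lambda>x. f (c + L x))"
proof (induction n arbitrary: f)
  case 0
  then show ?case
    by (auto intro!: continuous_intros bounded_linear.continuous_on[OF L]
        continuous_on_compose2[of UNIV f UNIV "\<lambda>x. c + L x"])
next
  case (Suc n)
  then obtain f' where f': "\<And>x. (f has_derivative f' x) (at x)" "\<And>d. Ck_on n UNIV (\<lambda>x. f' x d)"
    by auto
  have "((\<lambda>x. f (c + L x)) has_derivative (\<lambda>h. f' (c + L x) (L h))) (at x)" for x
  proof -
    have "((\<lambda>x. c + L x) has_derivative L) (at x)"
      using bounded_linear.has_derivative[OF L has_derivative_ident]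
      by (auto intro!: derivative_eq_intros)
    from has_derivative_compose[OF this f'(1)] show ?thesis .
  qed
  then show ?case using Suc.IH[OF f'(2)]
    by (auto intro!: exI[of _ "\<lambda>x d. f' (c + L x) (L d)"])
qed

text \<open>The classical flat function exp(-1/x), together with its quotients by powers of x:
  differentiation leads to linear combinations inside this family, so smoothness follows by one
  induction over all \<open>k\<close>.\<close>

definition flat_exp :: "nat \<Rightarrow> real \<Rightarrow> real" where
  "flat_exp k x = (if x > 0 then exp (- 1 / x) / x ^ k else 0)"

lemma flat_exp_tendsto_0: "(flat_exp k \<longlongrightarrow> 0) (at 0)"
  unfolding filterlim_at_split
proof
  show "(flat_exp k \<longlongrightarrow> 0) (at_left 0)"
    by (rule tendsto_eventually) (auto simp: flat_exp_def eventually_at_filter)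
  have "((\<lambda>x::real. inverse x ^ k / exp (inverse x)) \<longlongrightarrow> 0) (at_right 0)"
    by (rule filterlim_compose[OF tendsto_power_div_exp_0 filterlim_inverse_at_top_right])
  moreover have "\<forall>\<^sub>F x::real in at_right 0. inverse x ^ k / exp (inverse x) = flat_exp k x"
    by (auto simp: flat_exp_def eventually_at_filter exp_minus field_simps)
  ultimately show "(flat_exp k \<longlongrightarrow> 0) (at_right 0)" by (rule Lim_transform_eventually)
qed

lemma flat_exp_DERIV: "(flat_exp k has_real_derivative flat_exp (k + 2) x - real k * flat_exp (k + 1) x) (at x)"
proof (cases "x = 0")
  \<comment> \<open>At the origin the difference quotient of \<open>flat_exp k\<close> is exactly
    \<open>flat_exp (k + 1)\<close>, so the limit already proved for every exponent gives the
    derivative 0.\<close>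
  case True
  have "\<forall>\<^sub>F h in at 0. flat_exp (k + 1) h = (flat_exp k (0 + h) - flat_exp k 0) / h"
    by (auto simp: flat_exp_def eventually_at_filter)
  with flat_exp_tendsto_0 have "((\<lambda>h. (flat_exp k (0 + h) - flat_exp k 0) / h) \<longlongrightarrow> 0) (at 0)"
    by (rule Lim_transform_eventually)
  then show ?thesis unfolding True by (simp add: DERIV_def flat_exp_def)
next
  case False
  show ?thesis
  proof (cases "x > 0")
    case True
    have "((\<lambda>x. exp (- 1 / x) / x ^ k) has_real_derivative flat_exp (k + 2) x - real k * flat_exp (k + 1) x) (at x)"
    proof (cases k)
      case 0
      then show ?thesis using True
        by (auto intro!: derivative_eq_intros simp: flat_exp_def power2_eq_square field_simps)
    next
      case (Suc j)
      then show ?thesis using True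
        by (auto intro!: derivative_eq_intros simp: flat_exp_def power2_eq_square)
          (cases j; simp add: field_simps)
    qed
    moreover have ev: "\<forall>\<^sub>F y in nhds x. exp (- 1 / y) / y ^ k = flat_exp k y"
      using eventually_nhds_in_open[of "{0<..}" x] True
      by (auto elim!: eventually_mono simp: flat_exp_def)
    ultimately show ?thesis unfolding DERIV_cong_ev[OF refl ev refl] by blast
  next
    case neg: False
    have ev: "\<forall>\<^sub>F y in nhds x. 0 = flat_exp k y"
      using eventually_nhds_in_open[of "{..<0}" x] neg False
      by (auto elim!: eventually_mono simp: flat_exp_def)
    then have "(flat_exp k has_real_derivative 0) (at x)"
      unfolding DERIV_cong_ev[OF refl ev refl, symmetric] by simp
    then show ?thesis using neg by (simp add: flat_exp_def)
  qed
qed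

lemma Ck_on_flat_exp: "Ck_on n UNIV (flat_exp k)"
proof (induction n arbitrary: k)
  case 0
  have "isCont (flat_exp k) x" for x using flat_exp_DERIV DERIV_isCont by blast
  then show ?case by (simp add: continuous_at_imp_continuous_on)
next
  case (Suc n)
  let ?D = "\<lambda>x. flat_exp (k + 2) x + (- real k) * flat_exp (k + 1) x"
  have "(flat_exp k has_derivative (\<lambda>d. ?D x * d)) (at x)" for x
    using flat_exp_DERIV[of k x] by (simp add: has_field_derivative_def)
  moreover have "Ck_on n UNIV (\<lambda>x. ?D x * d)" for d
    by (intro Ck_on_mult Ck_on_add Ck_on_const Suc)
  ultimately show ?case by (auto intro!: exI[of _ "\<lambda>x d. ?D x * d"])
qed

definition bump1 :: "real \<Rightarrow> real" where
  "bump1 s = flat_exp 0 (1 - s) * flat_exp 0 (1 + s)"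

lemma bump1_simps:
  "0 \<le> bump1 s" "bump1 (- s) = bump1 s" "1 \<le> \<bar>s\<bar> \<Longrightarrow> bump1 s = 0" "\<bar>s\<bar> < 1 \<Longrightarrow> 0 < bump1 s"
  by (auto simp: bump1_def flat_exp_def)

text \<open>For positive \<open>N\<close> the support lies in the cube of half-width 1/N about the
  origin. The function is even in each coordinate, because \<open>bump1\<close> is even.\<close>

definition bumpn :: "real \<Rightarrow> 'a::euclidean_space \<Rightarrow> real" where
  "bumpn N z = (\<Prod>b\<in>Basis. bump1 (N * (z \<bullet> b)))"

lemma Ck_on_bumpn: "Ck_on n UNIV (bumpn N :: 'a::euclidean_space \<Rightarrow> real)"
proof -
  have "Ck_on n UNIV (\<lambda>z::'a. flat_exp 0 (1 + N * (z \<bullet> b)))" "Ck_on n UNIV (\<lambda>z::'a. flat_exp 0 (1 + - (N * (z \<bullet> b))))" for b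
    by (intro Ck_on_compose_affine Ck_on_flat_exp bounded_linear_minus
        bounded_linear_const_mult bounded_linear_inner_left)+
  then show ?thesis
    unfolding bumpn_def bump1_def by (intro Ck_on_prod Ck_on_mult) simp_all
qed

text \<open>Support in a ball rather than a compact closure is the form that translates and tensor
  products inherit directly. Tensor products of two such functions are the only test functions that
  enter the weak equations.\<close>

definition compact_smooth :: "('a::euclidean_space \<Rightarrow> complex) \<Rightarrow> bool" where
  "compact_smooth f \<longleftrightarrow> smooth_on UNIV f \<and> (\<exists>R. \<forall>x. R < norm x \<longrightarrow> f x = 0)"

lemma continuous_compact_support:
  fixes f :: "'a::euclidean_space \<Rightarrow> complex"
  assumes c: "continuous_on UNIV f" and R: "\<And>x. R < norm x \<Longrightarrow> f x = 0"
  shows "integrable lborel f" "sqint f"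
proof -
  have m: "f \<in> borel_measurable borel" using c by (rule borel_measurable_continuous_onI)
  have i: "integrable lborel g" if "continuous_on UNIV g" "\<And>x. R < norm x \<Longrightarrow> g x = 0"
    for g :: "'a \<Rightarrow> 'b::{banach, second_countable_topology}"
  proof -
    have "set_integrable lborel (cball 0 R) g"
      unfolding set_integrable_def
      using that(1) by (intro borel_integrable_compact) (auto intro: continuous_on_subset)
    moreover have "(\<lambda>x. indicator (cball 0 R) x *\<^sub>R g x) = g"
      using that(2) by (force simp: indicator_def fun_eq_iff)
    ultimately show ?thesis by (simp add: set_integrable_def)
  qed
  show "integrable lborel f" by (rule i[OF c R])
  have "integrable lborel (\<lambda>x. (cmod (f x))\<^sup>2)"
    by (rule i) (auto intro!: continuous_intros c simp: R)
  then show "sqint f" using m by (simp add: sqint_def)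
qed

lemma smooth_onD: "smooth_on UNIV f \<Longrightarrow> continuous_on UNIV f"
  by (metis Ck_on.simps(1) smooth_on_def)

lemma compact_smooth_integrable: "compact_smooth f \<Longrightarrow> integrable lborel f"
  and compact_smooth_sqint: "compact_smooth f \<Longrightarrow> sqint f"
  unfolding compact_smooth_def using continuous_compact_support smooth_onD by blast+

lemma compact_smooth_shift:
  assumes "compact_smooth f"
  shows "compact_smooth (\<lambda>z. f (z - w))"
proof -
  have "Ck_on n UNIV (\<lambda>z. f (- w + z))" for n
    using assms Ck_on_compose_affine[OF bounded_linear_ident, of n f "- w"]
    by (simp add: compact_smooth_def smooth_on_def)
  moreover obtain R where R: "\<And>x. R < norm x \<Longrightarrow> f x = 0" using assms by (auto simp: compact_smooth_def)
  have "f (z - w) = 0" if "R + norm w < norm z" for z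
    using that norm_triangle_ineq2[of z w] by (intro R) linarith
  ultimately show ?thesis by (auto simp: compact_smooth_def smooth_on_def)
qed

lemma test_fun_tensor:
  assumes f: "compact_smooth f" and g: "compact_smooth g"
  shows "test_fun (\<lambda>(x, y). f x * g y)"
proof -
  have "Ck_on n UNIV (\<lambda>z :: (real^3) \<times> (real^3). f (fst z) * g (snd z))" for n
    using assms Ck_on_compose_affine[OF bounded_linear_fst, of n f 0]
      Ck_on_compose_affine[OF bounded_linear_snd, of n g 0]
    by (intro Ck_on_mult) (auto simp: compact_smooth_def smooth_on_def)
  moreover obtain R where R: "\<And>x. R < norm x \<Longrightarrow> f x = 0" using f by (auto simp: compact_smooth_def)
  obtain S where S: "\<And>x. S < norm x \<Longrightarrow> g x = 0" using g by (auto simp: compact_smooth_def)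
  have "{z. (\<lambda>(x, y). f x * g y) z \<noteq> 0} \<subseteq> cball 0 R \<times> cball 0 S"
    using R S by force
  then have "bounded {z. (\<lambda>(x, y). f x * g y) z \<noteq> 0}"
    using bounded_Times bounded_cball bounded_subset by blast
  ultimately show ?thesis
    unfolding test_fun_def smooth_on_def case_prod_beta' by (simp add: compact_closure)
qed

section \<open>The Laplacian of a smooth function\<close>

text \<open>\<open>laplacian\<close> is built from \<open>vector_derivative\<close>, a choice
  operator. The directional derivatives obtained here as actual functions make it computable through
  \<open>laplacian_eqI\<close>.\<close>

lemma smooth_second_derivatives:
  assumes "smooth_on UNIV f"
  obtains f1 f2 where
    "\<And>b x s. ((\<lambda>r. f (x + r *\<^sub>R b)) has_vector_derivative f1 b (x + s *\<^sub>R b)) (at s)"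
    "\<And>b x s. ((\<lambda>r. f1 b (x + r *\<^sub>R b)) has_vector_derivative f2 b (x + s *\<^sub>R b)) (at s)"
    "\<And>b. continuous_on UNIV (f2 b)"
proof -
  have line: "((\<lambda>r. g (x + r *\<^sub>R b)) has_vector_derivative g' (x + s *\<^sub>R b) b) (at s)"
    if "\<And>x. (g has_derivative g' x) (at x)" for g :: "'a \<Rightarrow> 'b" and g' b x s
  proof -
    have "((\<lambda>r. x + r *\<^sub>R b) has_derivative (\<lambda>r. r *\<^sub>R b)) (at s)"
      by (auto intro!: derivative_eq_intros)
    from has_derivative_compose[OF this that]
    have "((\<lambda>r. g (x + r *\<^sub>R b)) has_derivative (\<lambda>r. g' (x + s *\<^sub>R b) (r *\<^sub>R b))) (at s)" .
    moreover have "g' (x + s *\<^sub>R b) (r *\<^sub>R b) = r *\<^sub>R g' (x + s *\<^sub>R b) b" for r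
      using has_derivative_linear[OF that] by (rule linear_scale)
    ultimately show ?thesis by (simp add: has_vector_derivative_def)
  qed
  have "Ck_on (Suc (Suc 0)) UNIV f" using assms unfolding smooth_on_def by blast
  then obtain f' where f': "\<And>x. (f has_derivative f' x) (at x)" "\<And>d. Ck_on (Suc 0) UNIV (\<lambda>x. f' x d)"
    by auto
  then have "\<forall>d. \<exists>g. (\<forall>x. ((\<lambda>x. f' x d) has_derivative g x) (at x)) \<and> (\<forall>e. continuous_on UNIV (\<lambda>x. g x e))"
    by auto
  then obtain g where g: "\<And>d x. ((\<lambda>x. f' x d) has_derivative g d x) (at x)" "\<And>d e. continuous_on UNIV (\<lambda>x. g d x e)"
    by metis
  show thesis
  proof
    show "((\<lambda>r. f (x + r *\<^sub>R b)) has_vector_derivative (\<lambda>b x. f' x b) b (x + s *\<^sub>R b)) (at s)" for b x s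
      using line[OF f'(1)] by simp
    show "((\<lambda>r. (\<lambda>b x. f' x b) b (x + r *\<^sub>R b)) has_vector_derivative (\<lambda>b x. g b x b) b (x + s *\<^sub>R b)) (at s)" for b x s
      using line[OF g(1)] by simp
    show "continuous_on UNIV ((\<lambda>b x. g b x b) b)" for b using g(2) by simp
  qed
qed

lemma laplacian_eqI:
  assumes "\<And>b x s. ((\<lambda>r. f (x + r *\<^sub>R b)) has_vector_derivative f1 b (x + s *\<^sub>R b)) (at s)"
    and "\<And>b x s. ((\<lambda>r. f1 b (x + r *\<^sub>R b)) has_vector_derivative f2 b (x + s *\<^sub>R b)) (at s)"
  shows "laplacian f x = (\<Sum>b\<in>Basis. f2 b x)"
proof -
  have "vector_derivative (\<lambda>r. f (x + r *\<^sub>R b)) (at s) = f1 b (x + s *\<^sub>R b)" for b s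
    by (rule vector_derivative_at[OF assms(1)])
  then show ?thesis
    unfolding laplacian_def using vector_derivative_at[OF assms(2)[of _ x 0]] by simp
qed

lemma laplacian_cmult:
  assumes "smooth_on UNIV f"
  shows "laplacian (\<lambda>x. f x * c) x = laplacian f x * c" "laplacian (\<lambda>x. c * f x) x = c * laplacian f x"
proof -
  obtain f1 f2 where f: "\<And>b x s. ((\<lambda>r. f (x + r *\<^sub>R b)) has_vector_derivative f1 b (x + s *\<^sub>R b)) (at s)"
    "\<And>b x s. ((\<lambda>r. f1 b (x + r *\<^sub>R b)) has_vector_derivative f2 b (x + s *\<^sub>R b)) (at s)"
    using smooth_second_derivatives[OF assms] by metis
  have "laplacian (\<lambda>x. f x * c) x = (\<Sum>b\<in>Basis. f2 b x * c)"
    by (rule laplacian_eqI[where ?f1.0 = "\<lambda>b x. f1 b x * c"]) (intro has_vector_derivative_mult_left f)+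
  then show *: "laplacian (\<lambda>x. f x * c) x = laplacian f x * c"
    by (simp add: laplacian_eqI[OF f] sum_distrib_right)
  show "laplacian (\<lambda>x. c * f x) x = c * laplacian f x"
    using * by (simp add: mult.commute)
qed

lemma laplacian_shift: "laplacian (\<lambda>z. f (z - w)) x = laplacian f (x - w)"
  by (simp add: laplacian_def algebra_simps)

text \<open>First derivatives of an even function are odd, second ones are even again. The Laplacian
  of an even mollifier is therefore admissible in \<open>molpair_swap_even\<close>.\<close>

lemma laplacian_even:
  assumes "smooth_on UNIV f" and even: "\<And>x. f (- x) = f x"
  shows "laplacian f (- x) = laplacian f x"
proof -
  obtain f1 f2 where f: "\<And>b x s. ((\<lambda>r. f (x + r *\<^sub>R b)) has_vector_derivative f1 b (x + s *\<^sub>R b)) (at s)"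
    "\<And>b x s. ((\<lambda>r. f1 b (x + r *\<^sub>R b)) has_vector_derivative f2 b (x + s *\<^sub>R b)) (at s)"
    using smooth_second_derivatives[OF assms(1)] by metis
  have neg: "((\<lambda>r. g (x + r *\<^sub>R b)) has_vector_derivative - g' (- x)) (at 0)"
    if "\<And>x s. ((\<lambda>r. h (x + r *\<^sub>R b)) has_vector_derivative g' (x + s *\<^sub>R b)) (at s)" "\<And>x. h (- x) = g x"
    for h g :: "'a \<Rightarrow> complex" and g' b x
  proof -
    have "((\<lambda>r::real. - r) has_vector_derivative - 1) (at 0)"
      by (auto intro!: derivative_eq_intros)
    from vector_diff_chain_at[OF this] that(1)[of "- x" 0]
    have "((\<lambda>r. h (- x + r *\<^sub>R b)) \<circ> (\<lambda>r. - r) has_vector_derivative - 1 *\<^sub>R g' (- x)) (at 0)"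
      by auto
    moreover have "(\<lambda>r. h (- x + r *\<^sub>R b)) \<circ> (\<lambda>r. - r) = (\<lambda>r. g (x + r *\<^sub>R b))"
    proof
      fix r
      have "- x + - r *\<^sub>R b = - (x + r *\<^sub>R b)" by (simp add: algebra_simps)
      then show "((\<lambda>r. h (- x + r *\<^sub>R b)) \<circ> (\<lambda>r. - r)) r = g (x + r *\<^sub>R b)"
        using that(2)[of "x + r *\<^sub>R b"] by (simp only: o_def)
    qed
    ultimately show ?thesis by (simp only:) simp
  qed
  have f1: "f1 b (- x) = - f1 b x" for b x
    using vector_derivative_unique_at[OF neg[OF f(1) even] f(1)[of x b 0, simplified]]
    by (metis add.inverse_inverse scale_zero_left add.right_neutral)
  have "((\<lambda>r. - f1 b (x + r *\<^sub>R b)) has_vector_derivative - f2 b (x + s *\<^sub>R b)) (at s)" for b x s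
    by (intro derivative_intros f)
  then have "- f2 b x = - f2 b (- x)" for b
    using vector_derivative_unique_at[OF neg[OF f(2), of b "\<lambda>x. - f1 b x" x]] f1
    by (metis add.inverse_inverse scale_zero_left add.right_neutral)
  then show ?thesis by (simp add: laplacian_eqI[OF f])
qed

text \<open>Outside a closed ball the function vanishes on an open set, hence so do both
  derivatives; the Laplacian is continuous with bounded support.\<close>

lemma laplacian_integrable:
  fixes f :: "'a::euclidean_space \<Rightarrow> complex"
  assumes "compact_smooth f"
  shows "integrable lborel (laplacian f)" "sqint (laplacian f)"
proof -
  obtain f1 f2 where f: "\<And>b x s. ((\<lambda>r. f (x + r *\<^sub>R b)) has_vector_derivative f1 b (x + s *\<^sub>R b)) (at s)"
    "\<And>b x s. ((\<lambda>r. f1 b (x + r *\<^sub>R b)) has_vector_derivative f2 b (x + s *\<^sub>R b)) (at s)"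
    "\<And>b. continuous_on UNIV (f2 b)"
    using smooth_second_derivatives[of f] assms unfolding compact_smooth_def by metis
  obtain R where R: "\<And>x. R < norm x \<Longrightarrow> f x = 0" using assms by (auto simp: compact_smooth_def)
  have zero: "g' x = 0"
    if g: "\<And>x s. ((\<lambda>r. g (x + r *\<^sub>R b)) has_vector_derivative g' (x + s *\<^sub>R b)) (at s)"
      and 0: "\<And>x. R < norm x \<Longrightarrow> g x = 0" and x: "R < norm x" for g g' :: "'a \<Rightarrow> complex" and b x
  proof -
    have "open ((\<lambda>r. norm (x + r *\<^sub>R b)) -` {R<..})"
      by (intro continuous_open_vimage) (auto intro!: continuous_intros)
    then have "((\<lambda>r. g (x + r *\<^sub>R b)) has_vector_derivative 0) (at 0)"
      using x by (intro has_vector_derivative_transform_within_open[OF has_vector_derivative_const[of 0]])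
        (auto simp: 0)
    from vector_derivative_unique_at[OF this g[of x 0]] show ?thesis by simp
  qed
  have "f2 b x = 0" if "R < norm x" for b x
    by (rule zero[OF f(2) zero[OF f(1) R] that])
  then have "\<And>x. R < norm x \<Longrightarrow> laplacian f x = 0" by (simp add: laplacian_eqI[OF f(1,2)])
  moreover have "continuous_on UNIV (laplacian f)"
    unfolding laplacian_eqI[OF f(1,2)] by (intro continuous_intros f)
  ultimately show "integrable lborel (laplacian f)" "sqint (laplacian f)"
    using continuous_compact_support[of "laplacian f" R] by auto
qed

lemma lap_tensor:
  fixes f g :: "real^3 \<Rightarrow> complex"
  assumes "compact_smooth f" "compact_smooth g"
  shows "lap_x (\<lambda>(x, y). f x * g y) = (\<lambda>(x, y). laplacian f x * g y)"
    "lap_y (\<lambda>(x, y). f x * g y) = (\<lambda>(x, y). f x * laplacian g y)"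
  using assms laplacian_cmult by (auto simp: lap_x_def lap_y_def compact_smooth_def fun_eq_iff)

section \<open>Mollifiers\<close>

text \<open>The equation with \<open>cmod\<close> says that the values are real and nonnegative.
  Together with integral 1 this gives L^1 norm 1, so mollification does not increase the L^2
  norm.\<close>

definition mollifier :: "(nat \<Rightarrow> 'a::euclidean_space \<Rightarrow> complex) \<Rightarrow> bool" where
  "mollifier \<eta> \<longleftrightarrow> (\<forall>n. compact_smooth (\<eta> n) \<and> (\<forall>z. \<eta> n (- z) = \<eta> n z)
     \<and> (\<forall>z. \<eta> n z = complex_of_real (cmod (\<eta> n z)))
     \<and> (\<forall>z. 1 / real (Suc n) \<le> norm z \<longrightarrow> \<eta> n z = 0) \<and> (\<integral>z. \<eta> n z \<partial>lborel) = 1)"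

lemma mollifier_exists: "\<exists>\<eta> :: nat \<Rightarrow> 'a::euclidean_space \<Rightarrow> complex. mollifier \<eta>"
proof -
  \<comment> \<open>The factor DIM makes the sum of the absolute coordinates smaller than 1/(n + 1)
    on the cube of half-width 1/N, so the cube fits into the required ball.\<close>
  define N where "N n = real (Suc n) * DIM('a)" for n
  have N: "N n > 0" for n by (simp add: N_def)
  define c where "c n = (\<integral>z. bumpn (N n) (z::'a) \<partial>lborel)" for n
  define \<eta> where "\<eta> n z = complex_of_real (bumpn (N n) z / c n)" for n and z :: 'a
  have nonneg: "0 \<le> bumpn M z" for M and z :: 'a
    unfolding bumpn_def by (intro prod_nonneg) (simp add: bump1_simps)
  have supp: "bumpn (N n) z = 0" if "1 / real (Suc n) \<le> norm z" for n and z :: 'a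
  proof -
    have "\<exists>b\<in>Basis. 1 \<le> \<bar>N n * (z \<bullet> b)\<bar>"
    proof (rule ccontr)
      assume "\<not> ?thesis"
      then have "\<bar>z \<bullet> b\<bar> < 1 / N n" if "b \<in> Basis" for b
        using that N[of n] by (auto simp: abs_mult field_simps not_le)
      then have "(\<Sum>b\<in>Basis. \<bar>z \<bullet> b\<bar>) < (\<Sum>b\<in>(Basis::'a set). 1 / N n)"
        by (intro sum_strict_mono) auto
      also have "\<dots> = 1 / real (Suc n)" by (simp add: N_def)
      finally show False using that norm_le_l1[of z] by linarith
    qed
    then obtain b where "b \<in> Basis" "1 \<le> \<bar>N n * (z \<bullet> b)\<bar>" by blast
    then show ?thesis unfolding bumpn_def by (intro prod_zero finite_Basis bexI[of _ b] bump1_simps(3))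
  qed
  have smooth: "smooth_on UNIV (\<eta> n)" for n
  proof -
    have "Ck_on k UNIV (\<eta> n)" for k
      unfolding \<eta>_def of_real_divide divide_inverse of_real_inverse
      by (intro Ck_on_mult Ck_on_const Ck_on_linear[OF bounded_linear_of_real] Ck_on_bumpn)
    then show ?thesis by (simp add: smooth_on_def)
  qed
  have cs: "compact_smooth (\<eta> n)" for n
    using smooth supp by (auto simp: compact_smooth_def \<eta>_def intro!: exI[of _ "1 / real (Suc n)"])
  have int: "integrable lborel (bumpn (N n) :: 'a \<Rightarrow> real)" for n
  proof -
    have "continuous_on UNIV (\<lambda>z::'a. complex_of_real (bumpn (N n) z))"
      using Ck_on_bumpn[of 0] by (auto intro!: continuous_intros)
    then have "integrable lborel (\<lambda>z::'a. complex_of_real (bumpn (N n) z))"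
      by (rule continuous_compact_support[of _ "1 / real (Suc n)"]) (simp add: supp)
    then show ?thesis by (simp only: complex_of_real_integrable_eq)
  qed
  \<comment> \<open>The bump is nonnegative and positive on a nonempty open set, which is not a null
    set; so its integral cannot vanish and may serve as divisor.\<close>
  have c: "c n > 0" for n
  proof (rule ccontr)
    assume "\<not> c n > 0"
    moreover have "0 \<le> c n" unfolding c_def by (rule integral_nonneg_AE) (simp add: nonneg)
    ultimately have "(\<integral>z. bumpn (N n) (z::'a) \<partial>lborel) = 0" unfolding c_def by linarith
    then have ae: "AE z in lborel. bumpn (N n) (z::'a) = 0"
      by (subst (asm) integral_nonneg_eq_0_iff_AE) (auto simp: int nonneg)
    define S where "S = {z::'a. bumpn (N n) z > 0}"
    have "bumpn (N n) (0::'a) > 0" unfolding bumpn_def by (intro prod_pos) (simp add: bump1_simps)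
    then have "S \<noteq> {}" by (auto simp: S_def)
    moreover have o: "open S"
      unfolding S_def using Ck_on_bumpn[of 0 "N n"]
      by (intro open_Collect_less) (auto intro: continuous_intros)
    ultimately have "S \<notin> null_sets lborel"
      using open_not_negligible negligible_iff_null_sets null_sets_completionI by blast
    moreover have "S \<in> null_sets lborel"
    proof (rule AE_iff_null_sets[THEN iffD2])
      show "S \<in> sets lborel" using o by (simp add: borel_open)
      show "AE z in lborel. z \<notin> S" using ae by eventually_elim (simp add: S_def)
    qed
    ultimately show False by simp
  qed
  have "mollifier \<eta>"
    unfolding mollifier_def
  proof (intro allI conjI impI)
    fix n and z :: 'a
    show "compact_smooth (\<eta> n)" by (rule cs)
    show "\<eta> n (- z) = \<eta> n z" by (simp add: \<eta>_def bumpn_def bump1_simps)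
    show "\<eta> n z = complex_of_real (cmod (\<eta> n z))"
      using nonneg[of "N n" z] c[of n] by (simp add: \<eta>_def norm_divide)
    show "\<eta> n z = 0" if "1 / real (Suc n) \<le> norm z" using supp[OF that] by (simp add: \<eta>_def)
    show "(\<integral>z. \<eta> n z \<partial>lborel) = 1"
      unfolding \<eta>_def integral_complex_of_real using c[of n] by (simp add: c_def)
  qed
  then show ?thesis by blast
qed

section \<open>Continuity of translations in the mean\<close>

definition transl_cont :: "('a::euclidean_space \<Rightarrow> complex) \<Rightarrow> bool" where
  "transl_cont f \<longleftrightarrow> ((\<lambda>h. l2n (\<lambda>x. f (h + x) - f x)) \<longlongrightarrow> 0) (at 0)"

lemma transl_cont_add:
  assumes "sqint f" "sqint g" "transl_cont f" "transl_cont g"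
  shows "transl_cont (\<lambda>x. f x + g x)"
  unfolding transl_cont_def
proof (rule tendsto_sandwich[OF always_eventually always_eventually tendsto_const])
  show "((\<lambda>h. l2n (\<lambda>x. f (h + x) - f x) + l2n (\<lambda>x. g (h + x) - g x)) \<longlongrightarrow> 0) (at 0)"
    using assms(3,4) unfolding transl_cont_def by (auto intro: tendsto_add_zero)
  show "\<forall>h. l2n (\<lambda>x. f (h + x) + g (h + x) - (f x + g x)) \<le> l2n (\<lambda>x. f (h + x) - f x) + l2n (\<lambda>x. g (h + x) - g x)"
  proof
    fix h
    have "l2n (\<lambda>x. (f (h + x) - f x) + (g (h + x) - g x)) \<le> l2n (\<lambda>x. f (h + x) - f x) + l2n (\<lambda>x. g (h + x) - g x)"
      using assms(1,2) by (intro l2n_triangle sqint_diff sqint_shift)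
    then show "l2n (\<lambda>x. f (h + x) + g (h + x) - (f x + g x)) \<le> l2n (\<lambda>x. f (h + x) - f x) + l2n (\<lambda>x. g (h + x) - g x)"
      by (simp add: algebra_simps)
  qed
qed simp

lemma transl_cont_cmult:
  assumes "transl_cont f"
  shows "transl_cont (\<lambda>x. c * f x)"
proof -
  have "l2n (\<lambda>x. c * f (h + x) - c * f x) = cmod c * l2n (\<lambda>x. f (h + x) - f x)" for h
    unfolding l2n_cmult[symmetric] by (simp add: algebra_simps)
  then show ?thesis using assms unfolding transl_cont_def by (simp add: tendsto_mult_right_zero)
qed

lemma transl_cont_zero: "transl_cont (\<lambda>x. 0)"
  by (simp add: transl_cont_def)

lemma transl_cont_sum:
  "(\<And>i. i \<in> I \<Longrightarrow> sqint (f i)) \<Longrightarrow> (\<And>i. i \<in> I \<Longrightarrow> transl_cont (f i)) \<Longrightarrow> transl_cont (\<lambda>x. \<Sum>i\<in>I. f i x)"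
proof (induction I rule: infinite_finite_induct)
  case (insert i I)
  then show ?case using transl_cont_add[of "f i" "\<lambda>x. \<Sum>i\<in>I. f i x"] sqint_sum[of I f] by simp
qed (simp_all add: transl_cont_zero)

text \<open>A three-epsilon argument: translation preserves the L^2 norm, so the approximation error
  of f by g enters twice, whatever the shift h is.\<close>

lemma transl_cont_approx:
  assumes f: "sqint f"
    and approx: "\<And>e. e > 0 \<Longrightarrow> \<exists>g. sqint g \<and> transl_cont g \<and> l2n (\<lambda>x. f x - g x) < e"
  shows "transl_cont f"
  unfolding transl_cont_def
proof (rule tendstoI)
  fix e :: real assume "e > 0"
  then obtain g where g: "sqint g" "transl_cont g" "l2n (\<lambda>x. f x - g x) < e / 3"
    using approx[of "e / 3"] by auto
  have "\<forall>\<^sub>F h in at 0. dist (l2n (\<lambda>x. g (h + x) - g x)) 0 < e / 3"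
    using g(2) \<open>e > 0\<close> unfolding transl_cont_def by (intro tendstoD) auto
  then show "\<forall>\<^sub>F h in at 0. dist (l2n (\<lambda>x. f (h + x) - f x)) 0 < e"
  proof eventually_elim
    case (elim h)
    have m: "(\<lambda>x. f x - g x) \<in> borel_measurable borel" using f g by (auto simp: sqint_def)
    have "l2n (\<lambda>x. (f (h + x) - g (h + x)) + ((g (h + x) - g x) + (g x - f x)))
        \<le> l2n (\<lambda>x. f (h + x) - g (h + x)) + l2n (\<lambda>x. (g (h + x) - g x) + (g x - f x))"
      using f g(1) by (intro l2n_triangle sqint_add sqint_diff sqint_shift)
    also have "l2n (\<lambda>x. (g (h + x) - g x) + (g x - f x)) \<le> l2n (\<lambda>x. g (h + x) - g x) + l2n (\<lambda>x. g x - f x)"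
      using f g(1) by (intro l2n_triangle sqint_diff sqint_shift)
    also have "l2n (\<lambda>x. f (h + x) - g (h + x)) = l2n (\<lambda>x. f x - g x)"
      using l2n_shift[OF m, of h] .
    also have "l2n (\<lambda>x. g x - f x) = l2n (\<lambda>x. f x - g x)" by (rule l2n_minus_commute)
    finally have "l2n (\<lambda>x. f (h + x) - f x) \<le> 2 * l2n (\<lambda>x. f x - g x) + l2n (\<lambda>x. g (h + x) - g x)"
      by simp
    then show ?case using elim g(3) by simp
  qed
qed

lemma sqint_indicator:
  fixes A :: "'a::euclidean_space set"
  assumes "A \<in> sets borel" "emeasure lborel A < \<infinity>"
  shows "sqint (indicator A)" "(l2n (indicator A))\<^sup>2 = measure lborel A"
proof -
  have eq: "(\<lambda>x. (cmod (indicator A x))\<^sup>2) = (indicator A :: 'a \<Rightarrow> real)"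
    by (auto simp: fun_eq_iff indicator_def)
  show "sqint (indicator A)" unfolding sqint_def eq using assms by simp
  show "(l2n (indicator A))\<^sup>2 = measure lborel A"
    unfolding l2n_square eq by simp
qed

text \<open>The squared distance of the two indicators is twice the measure of U minus twice the
  overlap. Openness gives pointwise convergence of the overlap: a point of U stays in U under small
  shifts, and off U the product is 0.\<close>

lemma transl_cont_open:
  fixes U :: "'a::euclidean_space set"
  assumes U: "open U" "emeasure lborel U < \<infinity>"
  shows "transl_cont (indicator U)"
  unfolding transl_cont_def tendsto_at_iff_sequentially o_def
proof (intro allI impI)
  fix X :: "nat \<Rightarrow> 'a" assume X: "X \<longlonglongrightarrow> 0"
  have [measurable]: "U \<in> sets borel" using U by simp
  let ?I = "indicator U :: 'a \<Rightarrow> real"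
  have iU: "integrable lborel ?I" using U by simp
  have iS: "integrable lborel (\<lambda>x. ?I (h + x))" for h using iU by (subst integrable_shift) auto
  have iP: "integrable lborel (\<lambda>x. ?I (h + x) * ?I x)" for h
    by (rule Bochner_Integration.integrable_bound[OF iU]) (auto simp: indicator_def)
  have sq: "(l2n (\<lambda>x. indicator U (h + x) - indicator U x))\<^sup>2
      = 2 * measure lborel U - 2 * (\<integral>x. ?I (h + x) * ?I x \<partial>lborel)" for h
  proof -
    have "(\<lambda>x. (cmod (indicator U (h + x) - indicator U x))\<^sup>2) = (\<lambda>x. ?I (h + x) + ?I x - 2 * (?I (h + x) * ?I x))"
      by (auto simp: fun_eq_iff indicator_def)
    then have "(l2n (\<lambda>x. indicator U (h + x) - indicator U x))\<^sup>2
      = (\<integral>x. ?I (h + x) \<partial>lborel) + (\<integral>x. ?I x \<partial>lborel) - 2 * (\<integral>x. ?I (h + x) * ?I x \<partial>lborel)"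
      unfolding l2n_square using iU iS iP by simp
    moreover have "(\<integral>x. ?I (h + x) \<partial>lborel) = (\<integral>x. ?I x \<partial>lborel)"
      by (rule integral_shift) simp
    ultimately show ?thesis by simp
  qed
  have "(\<lambda>n. \<integral>x. ?I (X n + x) * ?I x \<partial>lborel) \<longlonglongrightarrow> (\<integral>x. ?I x \<partial>lborel)"
  proof (rule integral_dominated_convergence[where w = ?I])
    show "AE x in lborel. (\<lambda>n. ?I (X n + x) * ?I x) \<longlonglongrightarrow> ?I x"
    proof (rule AE_I2)
      fix x :: 'a
      show "(\<lambda>n. ?I (X n + x) * ?I x) \<longlonglongrightarrow> ?I x"
      proof (cases "x \<in> U")
        case True
        have "(\<lambda>n. X n + x) \<longlonglongrightarrow> 0 + x" by (intro tendsto_intros X)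
        then have "\<forall>\<^sub>F n in sequentially. X n + x \<in> U"
          using U(1) True by (simp add: topological_tendstoD)
        then have "\<forall>\<^sub>F n in sequentially. ?I (X n + x) * ?I x = ?I x"
          by eventually_elim simp
        then show ?thesis by (rule tendsto_eventually)
      qed simp
    qed
  qed (use iU in \<open>auto simp: indicator_def\<close>)
  then have "(\<lambda>n. (l2n (\<lambda>x. indicator U (X n + x) - indicator U x))\<^sup>2) \<longlonglongrightarrow> 2 * measure lborel U - 2 * (\<integral>x. ?I x \<partial>lborel)"
    unfolding sq by (intro tendsto_intros)
  then have "(\<lambda>n. (l2n (\<lambda>x. indicator U (X n + x) - indicator U x))\<^sup>2) \<longlonglongrightarrow> 0" by simp
  from tendsto_real_sqrt[OF this] show "(\<lambda>n. l2n (\<lambda>x. indicator U (X n + x) - indicator U x)) \<longlonglongrightarrow> 0"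
    by simp
qed

text \<open>By outer regularity B is approximated by an open set whose excess over B has measure
  below e^2, that is, by an indicator at L^2 distance below e.\<close>

lemma transl_cont_indicator:
  fixes B :: "'a::euclidean_space set"
  assumes B: "B \<in> sets borel" "emeasure lborel B < \<infinity>"
  shows "transl_cont (indicator B)"
proof (rule transl_cont_approx[OF sqint_indicator(1)[OF B]])
  fix e :: real assume "e > 0"
  then obtain U where U: "open U" "B \<subseteq> U" "emeasure lborel (U - B) < ennreal (e\<^sup>2)"
    using outer_regular_lborel[OF B(1), of "e\<^sup>2"] by auto
  have [measurable]: "U \<in> sets borel" using U by simp
  have fD: "emeasure lborel (U - B) < \<infinity>"
    using less_trans[OF U(3) ennreal_less_top] by simp
  have "emeasure lborel U = emeasure lborel (U - B) + emeasure lborel B"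
    using U(2) B(1) by (subst plus_emeasure) (auto simp: Un_absorb2)
  then have fU: "emeasure lborel U < \<infinity>" using fD B(2) by simp
  have "l2n (\<lambda>x. indicator B x - indicator U x) = l2n (indicator (U - B) :: 'a \<Rightarrow> complex)"
    unfolding l2n_def by (intro arg_cong[where f=sqrt] Bochner_Integration.integral_cong) (use U(2) in \<open>auto simp: indicator_def\<close>)
  moreover have "(l2n (indicator (U - B) :: 'a \<Rightarrow> complex))\<^sup>2 < e\<^sup>2"
    using sqint_indicator(2)[of "U - B"] fD U(3) B(1) \<open>e > 0\<close>
    by (simp add: emeasure_eq_ennreal_measure ennreal_less_iff)
  ultimately have "l2n (\<lambda>x. indicator B x - indicator U x) < e"
    using \<open>e > 0\<close> by (simp add: power2_less_imp_less)
  then show "\<exists>g. sqint g \<and> transl_cont g \<and> l2n (\<lambda>x. indicator B x - g x) < e"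
    using transl_cont_open[OF U(1) fU] sqint_indicator(1)[OF _ fU] by auto
qed

text \<open>f is a pointwise limit of simple functions bounded by 2|f|, hence also their L^2 limit,
  and a simple function is a finite combination of indicators.\<close>

lemma transl_cont_sqint:
  fixes f :: "'a::euclidean_space \<Rightarrow> complex"
  assumes f: "sqint f"
  shows "transl_cont f"
proof (rule transl_cont_approx[OF f])
  fix e :: real assume "e > 0"
  have [measurable]: "f \<in> borel_measurable borel" using f by (rule sqint_measurable)
  have "\<exists>s. (\<forall>i. simple_function lborel (s i)) \<and> (\<forall>x\<in>space lborel. (\<lambda>i. s i x) \<longlonglongrightarrow> f x)
      \<and> (\<forall>i. \<forall>x\<in>space lborel. dist (s i x) 0 \<le> 2 * dist (f x) 0)"
    by (rule borel_measurable_implies_sequence_metric) simp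
  then obtain s where s0: "\<forall>i. simple_function lborel (s i)" "\<forall>x\<in>space lborel. (\<lambda>i. s i x) \<longlonglongrightarrow> f x"
    "\<forall>i. \<forall>x\<in>space lborel. dist (s i x) 0 \<le> 2 * dist (f x) 0"
    by (elim exE conjE)
  have s: "simple_function lborel (s i)" "(\<lambda>i. s i x) \<longlonglongrightarrow> f x" "norm (s i x) \<le> 2 * norm (f x)" for i x
  proof -
    have x: "x \<in> space lborel" by simp
    show "simple_function lborel (s i)" by (rule spec[OF s0(1)])
    show "(\<lambda>i. s i x) \<longlonglongrightarrow> f x" by (rule bspec[OF s0(2) x])
    show "norm (s i x) \<le> 2 * norm (f x)"
      using bspec[OF spec[OF s0(3), of i] x] unfolding dist_norm diff_zero .
  qed
  have [measurable]: "s i \<in> borel_measurable borel" for i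
    using borel_measurable_simple_function[OF s(1)[of i]] by simp
  have ss: "sqint (s i)" for i
  proof -
    have le: "norm ((cmod (s i x))\<^sup>2) \<le> norm (4 * (cmod (f x))\<^sup>2)" for x
    proof -
      have "(cmod (s i x))\<^sup>2 \<le> (2 * cmod (f x))\<^sup>2" by (rule power_mono[OF s(3)]) simp
      then show ?thesis by (simp add: power_mult_distrib)
    qed
    have "integrable lborel (\<lambda>x. (cmod (s i x))\<^sup>2)"
    proof (rule Bochner_Integration.integrable_bound)
      show "integrable lborel (\<lambda>x. 4 * (cmod (f x))\<^sup>2)" using sqintD[OF f] by simp
      show "(\<lambda>x. (cmod (s i x))\<^sup>2) \<in> borel_measurable lborel" by measurable
      show "AE x in lborel. norm ((cmod (s i x))\<^sup>2) \<le> norm (4 * (cmod (f x))\<^sup>2)"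
        by (rule AE_I2) (rule le)
    qed
    then show ?thesis by (simp add: sqint_def)
  qed
  have "(\<lambda>i. \<integral>x. (cmod (f x - s i x))\<^sup>2 \<partial>lborel) \<longlonglongrightarrow> (\<integral>x. 0 \<partial>(lborel :: 'a measure))"
  proof (rule integral_dominated_convergence[where w = "\<lambda>x. 9 * (cmod (f x))\<^sup>2"])
    show "AE x in lborel. (\<lambda>i. (cmod (f x - s i x))\<^sup>2) \<longlonglongrightarrow> 0"
    proof (rule AE_I2)
      fix x
      have "(\<lambda>i. (cmod (f x - s i x))\<^sup>2) \<longlonglongrightarrow> (cmod (f x - f x))\<^sup>2" by (intro tendsto_intros s(2))
      then show "(\<lambda>i. (cmod (f x - s i x))\<^sup>2) \<longlonglongrightarrow> 0" by simp
    qed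
    fix i
    \<comment> \<open>The bound 1 + 2 = 3 for the ratio to |f| is the source of the 9 in the
      dominating function.\<close>
    have "cmod (f x - s i x) \<le> 3 * cmod (f x)" for x
      using norm_triangle_ineq4[of "f x" "s i x"] s(3)[of i x] by linarith
    then have "(cmod (f x - s i x))\<^sup>2 \<le> 9 * (cmod (f x))\<^sup>2" for x
      using power_mono[of "cmod (f x - s i x)" "3 * cmod (f x)" 2] by (simp add: power_mult_distrib)
    then show "AE x in lborel. norm ((cmod (f x - s i x))\<^sup>2) \<le> 9 * (cmod (f x))\<^sup>2" by simp
  next
    show "integrable lborel (\<lambda>x. 9 * (cmod (f x))\<^sup>2)" using sqintD[OF f] by simp
  qed measurable
  then have "(\<lambda>i. l2n (\<lambda>x. f x - s i x)) \<longlonglongrightarrow> sqrt 0"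
    unfolding l2n_def by (intro tendsto_real_sqrt) simp
  then have "\<forall>\<^sub>F i in sequentially. l2n (\<lambda>x. f x - s i x) < e"
    by (rule order_tendstoD(2)) (use \<open>e > 0\<close> in simp)
  then obtain i where "l2n (\<lambda>x. f x - s i x) < e"
    using eventually_happens'[OF sequentially_bot] by blast
  moreover have "transl_cont (s i)"
  proof -
    \<comment> \<open>Level sets of nonzero values have finite measure because the simple function
      is in L^2. The level set of 0 may be infinite, but its term in the sum vanishes.\<close>
    have ind: "sqint (indicator (s i -` {y}) :: 'a \<Rightarrow> complex)" "transl_cont (indicator (s i -` {y}))" if "y \<noteq> 0" for y
    proof -
      have m: "s i -` {y} \<in> sets borel"
        using measurable_sets[of "s i" borel borel "{y}"] by simp
      have le: "norm ((cmod y)\<^sup>2 * indicator (s i -` {y}) x :: real) \<le> norm ((cmod (s i x))\<^sup>2)" for x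
        by (simp add: indicator_def)
      have "integrable lborel (\<lambda>x. (cmod y)\<^sup>2 * indicator (s i -` {y}) x :: real)"
      proof (rule Bochner_Integration.integrable_bound[OF sqintD[OF ss[of i]]])
        show "(\<lambda>x. (cmod y)\<^sup>2 * indicator (s i -` {y}) x :: real) \<in> borel_measurable lborel"
          using m by measurable
      qed (rule AE_I2, rule le)
      then have "integrable lborel (indicator (s i -` {y}) :: 'a \<Rightarrow> real)" using that by simp
      then have "emeasure lborel (s i -` {y}) < \<infinity>" using m by (simp add: integrable_indicator_iff)
      with m show "sqint (indicator (s i -` {y}) :: 'a \<Rightarrow> complex)" "transl_cont (indicator (s i -` {y}))"
        by (auto intro: sqint_indicator transl_cont_indicator)
    qed
    have eq: "s i = (\<lambda>x. \<Sum>y\<in>range (s i). y * indicator (s i -` {y}) x)"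
    proof
      fix x
      have "s i x = (\<Sum>y\<in>range (s i). indicator (s i -` {y}) x *\<^sub>R y)"
        using simple_function_indicator_representation_banach[OF s(1)[of i], of x]
        unfolding space_lborel space_borel Int_UNIV_right by blast
      also have "\<dots> = (\<Sum>y\<in>range (s i). y * indicator (s i -` {y}) x)"
        by (intro sum.cong refl) (auto simp: indicator_def)
      finally show "s i x = (\<Sum>y\<in>range (s i). y * indicator (s i -` {y}) x)" .
    qed
    have "sqint (\<lambda>x. y * indicator (s i -` {y}) x) \<and> transl_cont (\<lambda>x. y * indicator (s i -` {y}) x)" for y
    proof (cases "y = 0")
      case True
      then show ?thesis by (simp add: transl_cont_zero)
    next
      case False
      with ind show ?thesis by (blast intro: sqint_cmult transl_cont_cmult)
    qed
    then have "transl_cont (\<lambda>x. \<Sum>y\<in>range (s i). y * indicator (s i -` {y}) x)"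
      by (intro transl_cont_sum) blast+
    then show ?thesis by (simp only: eq[symmetric])
  qed
  ultimately show "\<exists>g. sqint g \<and> transl_cont g \<and> l2n (\<lambda>x. f x - g x) < e" using ss[of i] by (intro exI[of _ "s i"] conjI)
qed

lemma correlation_continuous:
  assumes A: "sqint A" and B: "sqint B"
  shows "((\<lambda>h. \<integral>x. A x * B (h + x) \<partial>lborel) \<longlongrightarrow> (\<integral>x. A x * B x \<partial>lborel)) (at 0)"
proof (rule Lim_transform2[OF tendsto_const], rule tendsto_norm_zero_cancel,
    rule tendsto_sandwich[OF always_eventually always_eventually tendsto_const])
  show "((\<lambda>h. l2n A * l2n (\<lambda>x. B (h + x) - B x)) \<longlongrightarrow> 0) (at 0)"
    using transl_cont_sqint[OF B] unfolding transl_cont_def by (rule tendsto_mult_right_zero)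
  show "\<forall>h. norm ((\<integral>x. A x * B x \<partial>lborel) - (\<integral>x. A x * B (h + x) \<partial>lborel)) \<le> l2n A * l2n (\<lambda>x. B (h + x) - B x)"
  proof
    fix h
    have "(\<integral>x. A x * B (h + x) \<partial>lborel) - (\<integral>x. A x * B x \<partial>lborel) = (\<integral>x. A x * (B (h + x) - B x) \<partial>lborel)"
      using A B by (simp add: right_diff_distrib sqint_mult_integrable sqint_shift)
    then show "norm ((\<integral>x. A x * B x \<partial>lborel) - (\<integral>x. A x * B (h + x) \<partial>lborel)) \<le> l2n A * l2n (\<lambda>x. B (h + x) - B x)"
      using cauchy_schwarz_l2n[OF A sqint_diff[OF sqint_shift[OF B] B], of h]
      unfolding norm_minus_commute[of "\<integral>x. A x * B x \<partial>lborel"] by (simp only:)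
  qed
qed simp

section \<open>Pairing with translated mollifiers\<close>

text \<open>Convolution of A with the reflection of \<sigma>, written as a pairing with a translate:
  this is the quantity that a weak equation controls for every centre w.\<close>

definition mol :: "('a::euclidean_space \<Rightarrow> complex) \<Rightarrow> ('a \<Rightarrow> complex) \<Rightarrow> 'a \<Rightarrow> complex" where
  "mol \<sigma> A w = (\<integral>z. A z * \<sigma> (z - w) \<partial>lborel)"

definition molpair :: "('a::euclidean_space \<Rightarrow> complex) \<Rightarrow> ('a \<Rightarrow> complex) \<Rightarrow> ('a \<Rightarrow> complex) \<Rightarrow> ('a \<Rightarrow> complex) \<Rightarrow> complex" where
  "molpair \<sigma> \<tau> A B = (\<integral>w. mol \<sigma> A w * mol \<tau> B w \<partial>lborel)"

lemma integrable_tensor: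
  fixes f :: "'a::euclidean_space \<Rightarrow> complex" and g :: "'b::euclidean_space \<Rightarrow> complex"
  assumes f: "integrable lborel f" and g: "integrable lborel g"
  shows "integrable lborel (\<lambda>z. f (fst z) * g (snd z))"
    "(\<integral>z. f (fst z) * g (snd z) \<partial>lborel) = (\<integral>x. f x \<partial>lborel) * (\<integral>y. g y \<partial>lborel)"
proof -
  have [measurable]: "f \<in> borel_measurable borel" "g \<in> borel_measurable borel"
    using borel_measurable_integrable[OF f] borel_measurable_integrable[OF g] by simp_all
  have "integrable (lborel \<Otimes>\<^sub>M lborel) (\<lambda>z. f (fst z) * g (snd z))"
    by (rule lborel_pair.Fubini_integrable) (use f g in \<open>auto simp: norm_mult\<close>)
  then show i: "integrable lborel (\<lambda>z. f (fst z) * g (snd z))" by (simp add: lborel_prod)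
  show "(\<integral>z. f (fst z) * g (snd z) \<partial>lborel) = (\<integral>x. f x \<partial>lborel) * (\<integral>y. g y \<partial>lborel)"
    by (simp add: integral_lborel_pair[OF i])
qed

lemma mol_measurable [measurable (raw)]:
  assumes [measurable]: "\<sigma> \<in> borel_measurable borel" "A \<in> borel_measurable borel"
  shows "mol \<sigma> A \<in> borel_measurable borel"
  unfolding mol_def[abs_def] by measurable

lemma mol_shift:
  assumes [measurable]: "\<sigma> \<in> borel_measurable borel" "A \<in> borel_measurable borel"
  shows "mol \<sigma> A w = (\<integral>s. A (w + s) * \<sigma> s \<partial>lborel)"
  unfolding mol_def by (subst integral_shift[where t = w, symmetric]) (auto simp: algebra_simps)

text \<open>After a change of variables A and B enter only through their correlation
  \<open>T\<close>, evaluated at the difference of the two mollifier arguments. The bound, the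
  symmetry and the limit of \<open>molpair\<close> all follow from this formula.\<close>

lemma molpair_correlation:
  fixes A B \<sigma> \<tau> :: "'a::euclidean_space \<Rightarrow> complex"
  assumes A: "sqint A" and B: "sqint B" and \<sigma>: "integrable lborel \<sigma>" and \<tau>: "integrable lborel \<tau>"
  defines "T \<equiv> \<lambda>h. \<integral>x. A x * B (h + x) \<partial>lborel"
  shows "integrable lborel (\<lambda>w. mol \<sigma> A w * mol \<tau> B w)"
    and "integrable lborel (\<lambda>z. \<sigma> (fst z) * \<tau> (snd z) * T (snd z - fst z))"
    and "molpair \<sigma> \<tau> A B = (\<integral>z. \<sigma> (fst z) * \<tau> (snd z) * T (snd z - fst z) \<partial>lborel)"
proof -
  have [measurable]: "A \<in> borel_measurable borel" "B \<in> borel_measurable borel"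
    "\<sigma> \<in> borel_measurable borel" "\<tau> \<in> borel_measurable borel"
    using A B borel_measurable_integrable[OF \<sigma>] borel_measurable_integrable[OF \<tau>] by (auto simp: sqint_def)
  let ?F = "\<lambda>(z :: 'a \<times> 'a, w :: 'a). (\<sigma> (fst z) * \<tau> (snd z)) * (A (w + fst z) * B (w + snd z))"
  have AB: "integrable lborel (\<lambda>w. A (w + s) * B (w + s'))" for s s'
    using sqint_mult_integrable[OF sqint_shift[OF A, of s] sqint_shift[OF B, of s']] by (simp add: add.commute)
  have AB_le: "(\<integral>w. cmod (A (w + s) * B (w + s')) \<partial>lborel) \<le> l2n A * l2n B" for s s'
    using cauchy_schwarz_norm[OF sqint_shift[OF A, of s] sqint_shift[OF B, of s']]
    using l2n_shift[OF sqint_measurable[OF A], of s] l2n_shift[OF sqint_measurable[OF B], of s']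
    by (simp add: add.commute)
  have "integrable (lborel \<Otimes>\<^sub>M lborel) ?F"
  proof (rule lborel_pair.Fubini_integrable)
    show "?F \<in> borel_measurable (lborel \<Otimes>\<^sub>M lborel)" by measurable
    show "AE z in lborel. integrable lborel (\<lambda>w. ?F (z, w))" using AB by auto
    show "integrable lborel (\<lambda>z. \<integral>w. norm (?F (z, w)) \<partial>lborel)"
    proof (rule Bochner_Integration.integrable_bound)
      show "integrable lborel (\<lambda>z. (\<sigma> (fst z) * \<tau> (snd z)) * complex_of_real (l2n A * l2n B))"
        using integrable_tensor(1)[OF \<sigma> \<tau>] by simp
      show "(\<lambda>z. \<integral>w. norm (?F (z, w)) \<partial>lborel) \<in> borel_measurable lborel" by measurable
      show "AE z in lborel. norm (\<integral>w. norm (?F (z, w)) \<partial>lborel) \<le> norm ((\<sigma> (fst z) * \<tau> (snd z)) * complex_of_real (l2n A * l2n B))"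
      proof (rule AE_I2)
        fix z :: "'a \<times> 'a"
        have "(\<integral>w. norm (?F (z, w)) \<partial>lborel) = cmod (\<sigma> (fst z) * \<tau> (snd z)) * (\<integral>w. cmod (A (w + fst z) * B (w + snd z)) \<partial>lborel)"
          by (simp add: norm_mult)
        then have "norm (\<integral>w. norm (?F (z, w)) \<partial>lborel) = cmod (\<sigma> (fst z) * \<tau> (snd z)) * (\<integral>w. cmod (A (w + fst z) * B (w + snd z)) \<partial>lborel)"
          by (simp add: abs_mult integral_nonneg_AE)
        also have "\<dots> \<le> cmod (\<sigma> (fst z) * \<tau> (snd z)) * (l2n A * l2n B)"
          by (intro mult_left_mono AB_le) simp
        also have "\<dots> = norm ((\<sigma> (fst z) * \<tau> (snd z)) * complex_of_real (l2n A * l2n B))"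
          by (simp add: norm_mult)
        finally show "norm (\<integral>w. norm (?F (z, w)) \<partial>lborel) \<le> norm ((\<sigma> (fst z) * \<tau> (snd z)) * complex_of_real (l2n A * l2n B))" .
      qed
    qed
  qed
  then have F: "integrable lborel ?F" by (simp add: lborel_prod)
  have 1: "(\<integral>z. ?F (z, w) \<partial>lborel) = mol \<sigma> A w * mol \<tau> B w"
    if "integrable lborel (\<lambda>z. ?F (z, w))" for w
  proof -
    have "(\<integral>z. ?F (z, w) \<partial>lborel) = (\<integral>s. \<integral>s'. ?F ((s, s'), w) \<partial>lborel \<partial>lborel)"
      using integral_lborel_pair[OF that] .
    also have "\<dots> = (\<integral>s. \<integral>s'. (A (w + s) * \<sigma> s) * (B (w + s') * \<tau> s') \<partial>lborel \<partial>lborel)"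
      by (simp add: mult_ac)
    finally show ?thesis by (simp add: mol_shift)
  qed
  have sec: "AE w in lborel. integrable lborel (\<lambda>z. ?F (z, w))"
    using AE_integrable_section[OF integrable_swap_vars[THEN iffD2, OF F]] by simp
  have i2: "integrable lborel (\<lambda>w. \<integral>z. ?F (z, w) \<partial>lborel)"
    using lborel_pair.integrable_fst'[of "\<lambda>z. ?F (prod.swap z)"] integrable_swap_vars[THEN iffD2, OF F]
    by (simp add: lborel_prod)
  have ae: "AE w in lborel. (\<integral>z. ?F (z, w) \<partial>lborel) = mol \<sigma> A w * mol \<tau> B w"
    by (rule eventually_mono[OF sec]) (rule 1)
  show "integrable lborel (\<lambda>w. mol \<sigma> A w * mol \<tau> B w)"
    by (rule integrable_cong_AE_imp[OF i2 _ ae]) measurable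
  have 2: "(\<integral>w. ?F (z, w) \<partial>lborel) = \<sigma> (fst z) * \<tau> (snd z) * T (snd z - fst z)" for z
  proof -
    have "(\<integral>w. A (w + fst z) * B (w + snd z) \<partial>lborel) = T (snd z - fst z)"
      unfolding T_def by (subst integral_shift[where t = "- fst z", symmetric]) (auto simp: algebra_simps)
    then show ?thesis by simp
  qed
  show "integrable lborel (\<lambda>z. \<sigma> (fst z) * \<tau> (snd z) * T (snd z - fst z))"
    using lborel_pair.integrable_fst'[of ?F] F unfolding 2 by (simp add: lborel_prod 2)
  have "molpair \<sigma> \<tau> A B = (\<integral>w. \<integral>z. ?F (z, w) \<partial>lborel \<partial>lborel)"
    unfolding molpair_def
  proof (rule integral_cong_AE)
    show "AE w in lborel. mol \<sigma> A w * mol \<tau> B w = (\<integral>z. ?F (z, w) \<partial>lborel)"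
      using ae by eventually_elim (rule sym)
    show "(\<lambda>w. \<integral>z. ?F (z, w) \<partial>lborel) \<in> borel_measurable lborel"
      using i2 by (rule borel_measurable_integrable)
  qed measurable
  also have "\<dots> = (\<integral>z. \<integral>w. ?F (z, w) \<partial>lborel \<partial>lborel)"
    using integral_lborel_pair[OF F] integral_lborel_pair_swap[OF F] by simp
  finally show "molpair \<sigma> \<tau> A B = (\<integral>z. \<sigma> (fst z) * \<tau> (snd z) * T (snd z - fst z) \<partial>lborel)"
    unfolding 2 .
qed

lemma molpair_bound:
  fixes A B \<sigma> \<tau> :: "'a::euclidean_space \<Rightarrow> complex"
  assumes A: "sqint A" and B: "sqint B" and \<sigma>: "integrable lborel \<sigma>" and \<tau>: "integrable lborel \<tau>"
  shows "cmod (molpair \<sigma> \<tau> A B) \<le> (\<integral>x. cmod (\<sigma> x) \<partial>lborel) * (\<integral>x. cmod (\<tau> x) \<partial>lborel) * (l2n A * l2n B)"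
proof -
  let ?T = "\<lambda>h. \<integral>x. A x * B (h + x) \<partial>lborel"
  have T: "cmod (?T h) \<le> l2n A * l2n B" for h
    using cauchy_schwarz_l2n[OF A sqint_shift[OF B, of h]] B by (simp add: l2n_shift sqint_measurable)
  have i: "integrable lborel (\<lambda>z. complex_of_real (cmod (\<sigma> (fst z))) * complex_of_real (cmod (\<tau> (snd z))))"
    and e: "(\<integral>z. complex_of_real (cmod (\<sigma> (fst z))) * complex_of_real (cmod (\<tau> (snd z))) \<partial>lborel)
      = complex_of_real ((\<integral>x. cmod (\<sigma> x) \<partial>lborel) * (\<integral>x. cmod (\<tau> x) \<partial>lborel))"
    using integrable_tensor[of "\<lambda>x. complex_of_real (cmod (\<sigma> x))" "\<lambda>x. complex_of_real (cmod (\<tau> x))"] \<sigma> \<tau>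
    by simp_all
  have i': "integrable lborel (\<lambda>z. cmod (\<sigma> (fst z)) * cmod (\<tau> (snd z)))"
    using i by (simp flip: of_real_mult add: complex_of_real_integrable_eq)
  have e': "(\<integral>z. cmod (\<sigma> (fst z)) * cmod (\<tau> (snd z)) \<partial>lborel) = (\<integral>x. cmod (\<sigma> x) \<partial>lborel) * (\<integral>x. cmod (\<tau> x) \<partial>lborel)"
    using e unfolding of_real_mult[symmetric] integral_complex_of_real of_real_eq_iff .
  have "cmod (molpair \<sigma> \<tau> A B) \<le> (\<integral>z. cmod (\<sigma> (fst z)) * cmod (\<tau> (snd z)) * (l2n A * l2n B) \<partial>lborel)"
    unfolding molpair_correlation(3)[OF assms]
    by (rule Bochner_Integration.integral_norm_bound_integral[OF molpair_correlation(2)[OF assms]])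
      (use i' in \<open>auto simp: norm_mult intro!: mult_left_mono T\<close>)
  then show ?thesis using e' by simp
qed

text \<open>Young's inequality, obtained from \<open>molpair\<close> by taking the complex
  conjugates of \<sigma> and A as the second pair, which turns it into the squared norm of
  \<open>mol \<sigma> A\<close>.\<close>

lemma sqint_mol:
  fixes A \<sigma> :: "'a::euclidean_space \<Rightarrow> complex"
  assumes A: "sqint A" and \<sigma>: "integrable lborel \<sigma>"
  shows "sqint (mol \<sigma> A)" and "l2n (mol \<sigma> A) \<le> (\<integral>x. cmod (\<sigma> x) \<partial>lborel) * l2n A"
proof -
  have [measurable]: "A \<in> borel_measurable borel" "\<sigma> \<in> borel_measurable borel"
    using A borel_measurable_integrable[OF \<sigma>] by (auto simp: sqint_def)
  let ?A = "\<lambda>x. cnj (A x)" and ?s = "\<lambda>x. cnj (\<sigma> x)"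
  have s: "integrable lborel ?s" using \<sigma> by simp
  have "mol ?s ?A w = cnj (mol \<sigma> A w)" for w
    unfolding mol_def by (simp flip: complex_cnj_mult)
  then have eq: "(\<lambda>w. mol \<sigma> A w * mol ?s ?A w) = (\<lambda>w. complex_of_real ((cmod (mol \<sigma> A w))\<^sup>2))"
    by (simp only: complex_norm_square)
  have "integrable lborel (\<lambda>w. complex_of_real ((cmod (mol \<sigma> A w))\<^sup>2))"
    using molpair_correlation(1)[OF A sqint_cnj[OF A] \<sigma> s] unfolding eq .
  then have "integrable lborel (\<lambda>w. (cmod (mol \<sigma> A w))\<^sup>2)" by (simp only: complex_of_real_integrable_eq)
  then show "sqint (mol \<sigma> A)" by (simp add: sqint_def)
  have "molpair \<sigma> ?s A ?A = complex_of_real ((l2n (mol \<sigma> A))\<^sup>2)"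
    unfolding molpair_def eq integral_complex_of_real l2n_square ..
  then have "(l2n (mol \<sigma> A))\<^sup>2 \<le> ((\<integral>x. cmod (\<sigma> x) \<partial>lborel) * l2n A)\<^sup>2"
    using molpair_bound[OF A sqint_cnj[OF A] \<sigma> s] by (simp add: norm_mult power2_eq_square mult_ac)
  then show "l2n (mol \<sigma> A) \<le> (\<integral>x. cmod (\<sigma> x) \<partial>lborel) * l2n A"
    by (rule power2_le_imp_le) (simp add: integral_nonneg_AE)
qed

text \<open>Reflecting both arguments leaves the even functions alone and reverses the sign in
  \<open>T\<close>; exchanging the two arguments restores it. This is the exact symmetry by which
  the Laplacians cancel before any limit is taken.\<close>

lemma molpair_swap_even:
  fixes A B \<sigma> \<tau> :: "'a::euclidean_space \<Rightarrow> complex"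
  assumes A: "sqint A" and B: "sqint B" and \<sigma>: "integrable lborel \<sigma>" and \<tau>: "integrable lborel \<tau>"
    and even: "\<And>x. \<sigma> (- x) = \<sigma> x" "\<And>x. \<tau> (- x) = \<tau> x"
  shows "molpair \<sigma> \<tau> A B = molpair \<tau> \<sigma> A B"
proof -
  define T where "T h = (\<integral>x. A x * B (h + x) \<partial>lborel)" for h
  have [measurable]: "(\<lambda>z. \<sigma> (fst z) * \<tau> (snd z) * T (snd z - fst z)) \<in> borel_measurable borel"
    using borel_measurable_integrable[OF molpair_correlation(2)[OF A B \<sigma> \<tau>]] by (simp add: T_def)
  have "molpair \<sigma> \<tau> A B = (\<integral>z. \<sigma> (fst z) * \<tau> (snd z) * T (snd z - fst z) \<partial>lborel)"
    using molpair_correlation(3)[OF A B \<sigma> \<tau>] by (simp add: T_def)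
  also have "\<dots> = (\<integral>z. \<sigma> (fst (- z)) * \<tau> (snd (- z)) * T (snd (- z) - fst (- z)) \<partial>lborel)"
    using integral_reflect[of "\<lambda>z. \<sigma> (fst z) * \<tau> (snd z) * T (snd z - fst z)" 0] by simp
  also have "\<dots> = (\<integral>z. \<sigma> (fst z) * \<tau> (snd z) * T (fst z - snd z) \<partial>lborel)"
    by (simp add: even)
  also have "\<dots> = (\<integral>z. \<tau> (fst z) * \<sigma> (snd z) * T (snd z - fst z) \<partial>lborel)"
    using integral_swap_vars[of "\<lambda>z. \<tau> (fst z) * \<sigma> (snd z) * T (snd z - fst z)"]
      borel_measurable_integrable[OF molpair_correlation(2)[OF A B \<tau> \<sigma>]]
    by (simp add: T_def mult.commute)
  also have "\<dots> = molpair \<tau> \<sigma> A B"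
    using molpair_correlation(3)[OF A B \<tau> \<sigma>] by (simp add: T_def)
  finally show ?thesis .
qed

lemma mollifierD:
  assumes "mollifier \<eta>"
  shows "compact_smooth (\<eta> n)" "\<eta> n (- z) = \<eta> n z" "1 / real (Suc n) \<le> norm z \<Longrightarrow> \<eta> n z = 0"
    "(\<integral>z. \<eta> n z \<partial>lborel) = 1" "integrable lborel (\<eta> n)" "(\<integral>z. cmod (\<eta> n z) \<partial>lborel) = 1" "sqint (\<eta> n)"
proof -
  show "compact_smooth (\<eta> n)" "\<eta> n (- z) = \<eta> n z" "1 / real (Suc n) \<le> norm z \<Longrightarrow> \<eta> n z = 0"
    and int: "(\<integral>z. \<eta> n z \<partial>lborel) = 1"
    using assms by (auto simp: mollifier_def)
  then show "integrable lborel (\<eta> n)" "sqint (\<eta> n)"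
    using compact_smooth_integrable compact_smooth_sqint by auto
  have "\<eta> n = (\<lambda>z. complex_of_real (cmod (\<eta> n z)))" using assms by (auto simp: mollifier_def)
  then have "(\<integral>z. complex_of_real (cmod (\<eta> n z)) \<partial>lborel) = 1" using int by simp
  then show "(\<integral>z. cmod (\<eta> n z) \<partial>lborel) = 1"
    unfolding integral_complex_of_real of_real_eq_1_iff .
qed

text \<open>The two arguments of the mollifiers stay in a shrinking ball, so only continuity of the
  correlation \<open>T\<close> at 0 matters.\<close>

lemma molpair_tendsto:
  fixes A B :: "'a::euclidean_space \<Rightarrow> complex"
  assumes A: "sqint A" and B: "sqint B" and \<eta>: "mollifier \<eta>"
  shows "(\<lambda>n. molpair (\<eta> n) (\<eta> n) A B) \<longlonglongrightarrow> (\<integral>x. A x * B x \<partial>lborel)"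
proof (rule LIMSEQ_I)
  fix e :: real assume "e > 0"
  define T where "T h = (\<integral>x. A x * B (h + x) \<partial>lborel)" for h
  have T: "T = (\<lambda>h. \<integral>x. A x * B (h + x) \<partial>lborel)" by (simp add: fun_eq_iff T_def)
  have "(T \<longlongrightarrow> T 0) (at 0)" using correlation_continuous[OF A B] unfolding T by simp
  then obtain d where d: "d > 0" "\<And>h. h \<noteq> 0 \<Longrightarrow> norm h < d \<Longrightarrow> dist (T h) (T 0) < e / 2"
    using \<open>e > 0\<close> unfolding LIM_def by (metis dist_0_norm dist_commute half_gt_zero)
  have d': "cmod (T h - T 0) \<le> e / 2" if "norm h < d" for h
    using d(2)[of h] that \<open>e > 0\<close> by (cases "h = 0") (auto simp: dist_norm)
  \<comment> \<open>Two points in the support of \<open>\<eta> n\<close> differ by less than 2/(n +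
    1), which explains the 2.\<close>
  obtain N where N: "2 / d < real N" using reals_Archimedean2 by blast
  show "\<exists>N. \<forall>n\<ge>N. norm (molpair (\<eta> n) (\<eta> n) A B - (\<integral>x. A x * B x \<partial>lborel)) < e"
  proof (intro exI allI impI)
    fix n assume "N \<le> n"
    then have "2 / d < real (Suc n)" using N by simp
    then have small: "2 / real (Suc n) < d" using \<open>d > 0\<close> by (simp add: field_simps)
    note int = mollifierD(5)[OF \<eta>, of n]
    have i1: "integrable lborel (\<lambda>z. \<eta> n (fst z) * \<eta> n (snd z) * T (snd z - fst z))"
      and eq: "molpair (\<eta> n) (\<eta> n) A B = (\<integral>z. \<eta> n (fst z) * \<eta> n (snd z) * T (snd z - fst z) \<partial>lborel)"
      using molpair_correlation[OF A B int int] by (auto simp: T_def)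
    have i2: "integrable lborel (\<lambda>z. \<eta> n (fst z) * \<eta> n (snd z))"
      "(\<integral>z. \<eta> n (fst z) * \<eta> n (snd z) \<partial>lborel) = 1"
      using integrable_tensor[OF int int] mollifierD(4)[OF \<eta>] by auto
    have ri: "integrable lborel (\<lambda>z. cmod (\<eta> n (fst z) * \<eta> n (snd z)))" using i2 by simp
    have one: "(\<integral>z. cmod (\<eta> n (fst z) * \<eta> n (snd z)) \<partial>lborel) = 1"
    proof -
      have "\<eta> n (fst z) * \<eta> n (snd z) = complex_of_real (cmod (\<eta> n (fst z) * \<eta> n (snd z)))" for z
        using \<eta> unfolding mollifier_def by (metis norm_mult of_real_mult)
      then have "(\<integral>z. complex_of_real (cmod (\<eta> n (fst z) * \<eta> n (snd z))) \<partial>lborel) = 1" using i2(2) by simp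
      then show ?thesis unfolding integral_complex_of_real of_real_eq_1_iff .
    qed
    have "molpair (\<eta> n) (\<eta> n) A B - T 0 = (\<integral>z. \<eta> n (fst z) * \<eta> n (snd z) * T (snd z - fst z) \<partial>lborel) - (\<integral>z. \<eta> n (fst z) * \<eta> n (snd z) * T 0 \<partial>lborel)"
      using i2 by (simp add: eq)
    also have "\<dots> = (\<integral>z. \<eta> n (fst z) * \<eta> n (snd z) * (T (snd z - fst z) - T 0) \<partial>lborel)"
      using i1 i2 by (simp add: right_diff_distrib)
    also have "cmod \<dots> \<le> (\<integral>z. cmod (\<eta> n (fst z) * \<eta> n (snd z)) * (e / 2) \<partial>lborel)"
    proof (rule Bochner_Integration.integral_norm_bound_integral)
      show "integrable lborel (\<lambda>z. \<eta> n (fst z) * \<eta> n (snd z) * (T (snd z - fst z) - T 0))"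
        using i1 i2 by (simp add: right_diff_distrib)
      show "integrable lborel (\<lambda>z. cmod (\<eta> n (fst z) * \<eta> n (snd z)) * (e / 2))" using ri by simp
      fix z :: "'a \<times> 'a"
      show "cmod (\<eta> n (fst z) * \<eta> n (snd z) * (T (snd z - fst z) - T 0)) \<le> cmod (\<eta> n (fst z) * \<eta> n (snd z)) * (e / 2)"
      proof (cases "norm (fst z) < 1 / real (Suc n) \<and> norm (snd z) < 1 / real (Suc n)")
        case True
        then have "norm (snd z - fst z) < d"
          using norm_triangle_ineq4[of "snd z" "fst z"] small by simp
        from d'[OF this] show ?thesis unfolding norm_mult[of "_ * _"] by (intro mult_left_mono) auto
      next
        case False
        then have "\<eta> n (fst z) = 0 \<or> \<eta> n (snd z) = 0" using mollifierD(3)[OF \<eta>] by (meson not_less)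
        then show ?thesis using \<open>e > 0\<close> by auto
      qed
    qed
    also have "\<dots> = e / 2" using one by simp
    finally show "norm (molpair (\<eta> n) (\<eta> n) A B - (\<integral>x. A x * B x \<partial>lborel)) < e"
      using \<open>e > 0\<close> by (simp add: T_def)
  qed
qed

section \<open>A product rule for weak solutions\<close>

text \<open>Integration by parts through Fubini: the product of the two integrals is an integral
  over a square, which the diagonal cuts into two triangles, each of them an iterated
  integral.\<close>

lemma ac_product:
  fixes P R \<alpha> \<beta> :: "real \<Rightarrow> complex"
  assumes P: "set_integrable lborel {0..t} P" and R: "set_integrable lborel {0..t} R" and t: "0 \<le> t"
    and \<alpha>: "\<And>s. s \<in> {0..t} \<Longrightarrow> \<alpha> s = \<alpha> 0 + (LINT x:{0..s}|lborel. P x)"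
    and \<beta>: "\<And>s. s \<in> {0..t} \<Longrightarrow> \<beta> s = \<beta> 0 + (LINT x:{0..s}|lborel. R x)"
  shows "\<alpha> t * \<beta> t - \<alpha> 0 * \<beta> 0 = (LINT s:{0..t}|lborel. P s * \<beta> s + \<alpha> s * R s)"
proof -
  define p where "p s = indicator {0..t} s *\<^sub>R P s" for s
  define r where "r s = indicator {0..t} s *\<^sub>R R s" for s
  have p: "integrable lborel p" and r: "integrable lborel r"
    using P R unfolding p_def[abs_def] r_def[abs_def] set_integrable_def by auto
  have [measurable]: "p \<in> borel_measurable borel" "r \<in> borel_measurable borel"
    using borel_measurable_integrable[OF p] borel_measurable_integrable[OF r] by simp_all
  define I where "I f s = (\<integral>x. indicator {..s} x *\<^sub>R f x \<partial>lborel)" for f :: "real \<Rightarrow> complex" and s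
  have \<alpha>': "\<alpha> s = \<alpha> 0 + I p s" and \<beta>': "\<beta> s = \<beta> 0 + I r s" if "s \<in> {0..t}" for s
  proof -
    have "(LINT x:{0..s}|lborel. f x) = (\<integral>x. indicator {..s} x *\<^sub>R (indicator {0..t} x *\<^sub>R f x) \<partial>lborel)"
      for f :: "real \<Rightarrow> complex" unfolding set_lebesgue_integral_def
      by (intro Bochner_Integration.integral_cong refl) (use that in \<open>auto simp: indicator_def\<close>)
    then show "\<alpha> s = \<alpha> 0 + I p s" "\<beta> s = \<beta> 0 + I r s"
      using \<alpha>[OF that] \<beta>[OF that] unfolding I_def p_def r_def by (simp_all only:)
  qed
  have tt: "I p t = (\<integral>x. p x \<partial>lborel)" "I r t = (\<integral>x. r x \<partial>lborel)"
    unfolding I_def by (intro Bochner_Integration.integral_cong; auto simp: p_def r_def indicator_def)+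
  \<comment> \<open>\<open>?K1\<close> contains the diagonal and \<open>?K2\<close> omits it, so
    that they add up to \<open>?K\<close> at every point. The strict inequality in
    \<open>?K2\<close> changes the inner integral only by a null set.\<close>
  let ?K = "\<lambda>z. p (fst z) * r (snd z)"
  let ?K1 = "\<lambda>z. p (fst z) * (indicator {..fst z} (snd z) *\<^sub>R r (snd z))"
  let ?K2 = "\<lambda>z. (indicator {..<snd z} (fst z) *\<^sub>R p (fst z)) * r (snd z)"
  note K = integrable_tensor[OF p r]
  have m1: "?K1 \<in> borel_measurable lborel"
  proof -
    have "?K1 = (\<lambda>z. if snd z \<le> fst z then ?K z else 0)" by (auto simp: fun_eq_iff)
    then show ?thesis by simp
  qed
  have m2: "?K2 \<in> borel_measurable lborel"
  proof -
    have "?K2 = (\<lambda>z. if fst z < snd z then ?K z else 0)" by (auto simp: fun_eq_iff)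
    then show ?thesis by simp
  qed
  have K1: "integrable lborel ?K1"
    by (rule Bochner_Integration.integrable_bound[OF K(1) m1]) (auto intro!: AE_I2 simp: indicator_def)
  have K2: "integrable lborel ?K2"
    by (rule Bochner_Integration.integrable_bound[OF K(1) m2]) (auto intro!: AE_I2 simp: indicator_def)
  have e1: "(\<integral>z. ?K1 z \<partial>lborel) = (\<integral>s. p s * I r s \<partial>lborel)"
    by (subst integral_lborel_pair[OF K1]) (simp add: I_def del: mult_scaleR_right)
  have i1: "integrable lborel (\<lambda>s. p s * I r s)"
    using lborel_pair.integrable_fst'[of ?K1] K1 by (simp add: lborel_prod I_def del: mult_scaleR_right)
  have strict: "(\<integral>x. indicator {..<s} x *\<^sub>R p x \<partial>lborel) = I p s" for s
    unfolding I_def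
  proof (rule integral_cong_AE)
    show "AE x in lborel. indicator {..<s} x *\<^sub>R p x = indicator {..s} x *\<^sub>R p x"
      using AE_lborel_singleton[of s] by eventually_elim (auto simp: indicator_def)
  qed measurable
  have e2: "(\<integral>z. ?K2 z \<partial>lborel) = (\<integral>s. I p s * r s \<partial>lborel)"
    by (subst integral_lborel_pair_swap[OF K2]) (simp add: strict del: mult_scaleR_left)
  have i2: "integrable lborel (\<lambda>s. I p s * r s)"
    using lborel_pair.integrable_fst'[of "\<lambda>z. ?K2 (prod.swap z)"] integrable_swap_vars[THEN iffD2, OF K2]
    by (simp add: lborel_prod strict del: mult_scaleR_left)
  have "(\<integral>z. ?K1 z \<partial>lborel) + (\<integral>z. ?K2 z \<partial>lborel) = (\<integral>z. ?K1 z + ?K2 z \<partial>lborel)"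
    using K1 K2 by simp
  also have "\<dots> = (\<integral>z. ?K z \<partial>lborel)"
    by (intro Bochner_Integration.integral_cong refl) (auto simp: indicator_def)
  finally have sum: "(\<integral>s. p s * I r s \<partial>lborel) + (\<integral>s. I p s * r s \<partial>lborel) = I p t * I r t"
    using K(2) e1 e2 tt by simp
  have "indicator {0..t} s *\<^sub>R (P s * \<beta> s + \<alpha> s * R s)
      = p s * \<beta> 0 + \<alpha> 0 * r s + p s * I r s + I p s * r s" for s
    using \<alpha>'[of s] \<beta>'[of s] by (cases "s \<in> {0..t}") (auto simp: p_def r_def algebra_simps)
  then have "(LINT s:{0..t}|lborel. P s * \<beta> s + \<alpha> s * R s)
      = (\<integral>s. p s * \<beta> 0 + \<alpha> 0 * r s + p s * I r s + I p s * r s \<partial>lborel)"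
    by (simp add: set_lebesgue_integral_def)
  also have "\<dots> = I p t * \<beta> 0 + \<alpha> 0 * I r t + I p t * I r t"
    using p r i1 i2 sum by (simp add: tt)
  also have "\<dots> = \<alpha> t * \<beta> t - \<alpha> 0 * \<beta> 0"
    using \<alpha>'[of t] \<beta>'[of t] t by (simp add: algebra_simps)
  finally show ?thesis ..
qed

lemma mol_le:
  assumes A: "sqint A" and \<sigma>: "sqint \<sigma>"
  shows "cmod (mol \<sigma> A w) \<le> l2n A * l2n \<sigma>"
proof -
  have "sqint (\<lambda>z. \<sigma> (z - w))" "l2n (\<lambda>z. \<sigma> (z - w)) = l2n \<sigma>"
    using sqint_shift[OF \<sigma>, of "- w"] l2n_shift[OF sqint_measurable[OF \<sigma>], of "- w"] by simp_all
  then show ?thesis using cauchy_schwarz_l2n[OF A, of "\<lambda>z. \<sigma> (z - w)"] by (simp add: mol_def)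
qed

lemma l2n_path_measurable [measurable (raw)]:
  fixes A :: "real \<times> 'a::euclidean_space \<Rightarrow> complex"
  assumes [measurable]: "A \<in> borel_measurable borel"
  shows "(\<lambda>s. l2n (\<lambda>x. A (s, x))) \<in> borel_measurable borel"
  unfolding l2n_def by measurable

lemma mol_path_measurable:
  fixes A :: "real \<times> 'a::euclidean_space \<Rightarrow> complex"
  assumes [measurable]: "A \<in> borel_measurable borel" "\<sigma> \<in> borel_measurable borel"
  shows "(\<lambda>z. mol \<sigma> (\<lambda>x. A (fst z, x)) (snd z)) \<in> borel_measurable borel"
  unfolding mol_def by measurable

text \<open>\<zeta> stands for a multiple of the Laplacian of \<eta>, entering with opposite signs
  for A and B. For fixed w the mollified paths are absolutely continuous in time, so the ordinary
  product rule applies; integration over w then leaves the difference of two \<zeta> terms, which is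
  0 by evenness.\<close>

lemma mollified_product:
  fixes A B F G :: "real \<times> 'a::euclidean_space \<Rightarrow> complex" and \<eta> \<zeta> :: "'a \<Rightarrow> complex"
  assumes \<eta>: "integrable lborel \<eta>" "sqint \<eta>" "\<And>x. \<eta> (- x) = \<eta> x" "(\<integral>x. cmod (\<eta> x) \<partial>lborel) = 1"
    and \<zeta>: "integrable lborel \<zeta>" "sqint \<zeta>" "\<And>x. \<zeta> (- x) = \<zeta> x"
    and meas [measurable]: "A \<in> borel_measurable borel" "B \<in> borel_measurable borel"
      "F \<in> borel_measurable borel" "G \<in> borel_measurable borel"
    and sq: "\<And>s. sqint (\<lambda>x. A (s, x))" "\<And>s. sqint (\<lambda>x. B (s, x))"
      "\<And>s. sqint (\<lambda>x. F (s, x))" "\<And>s. sqint (\<lambda>x. G (s, x))"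
    and bd: "\<And>s. l2n (\<lambda>x. A (s, x)) \<le> CA" "\<And>s. l2n (\<lambda>x. B (s, x)) \<le> CB"
    and int: "integrable lborel (\<lambda>s. l2n (\<lambda>x. F (s, x)))" "integrable lborel (\<lambda>s. l2n (\<lambda>x. G (s, x)))"
    and eqA: "\<And>w t. t \<in> {0..T} \<Longrightarrow> \<i> * (mol \<eta> (\<lambda>x. A (t, x)) w - mol \<eta> (\<lambda>x. A (0, x)) w)
      = (LINT s:{0..t}|lborel. mol \<eta> (\<lambda>x. F (s, x)) w - mol \<zeta> (\<lambda>x. A (s, x)) w)"
    and eqB: "\<And>w t. t \<in> {0..T} \<Longrightarrow> \<i> * (mol \<eta> (\<lambda>x. B (t, x)) w - mol \<eta> (\<lambda>x. B (0, x)) w)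
      = (LINT s:{0..t}|lborel. mol \<eta> (\<lambda>x. G (s, x)) w + mol \<zeta> (\<lambda>x. B (s, x)) w)"
    and t: "t \<in> {0..T}"
  shows "\<i> * (molpair \<eta> \<eta> (\<lambda>x. A (t, x)) (\<lambda>x. B (t, x)) - molpair \<eta> \<eta> (\<lambda>x. A (0, x)) (\<lambda>x. B (0, x)))
    = (LINT s:{0..t}|lborel. molpair \<eta> \<eta> (\<lambda>x. F (s, x)) (\<lambda>x. B (s, x)) + molpair \<eta> \<eta> (\<lambda>x. A (s, x)) (\<lambda>x. G (s, x)))"
proof -
  have [measurable]: "\<eta> \<in> borel_measurable borel" "\<zeta> \<in> borel_measurable borel"
    using \<eta>(2) \<zeta>(2) by (auto simp: sqint_def)
  define a where "a s w = mol \<eta> (\<lambda>x. A (s, x)) w" for s w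
  define b where "b s w = mol \<eta> (\<lambda>x. B (s, x)) w" for s w
  define P where "P s w = mol \<eta> (\<lambda>x. F (s, x)) w - mol \<zeta> (\<lambda>x. A (s, x)) w" for s w
  define R where "R s w = mol \<eta> (\<lambda>x. G (s, x)) w + mol \<zeta> (\<lambda>x. B (s, x)) w" for s w
  have meas2 [measurable]: "(\<lambda>z. a (fst z) (snd z)) \<in> borel_measurable borel"
    "(\<lambda>z. b (fst z) (snd z)) \<in> borel_measurable borel"
    "(\<lambda>z. P (fst z) (snd z)) \<in> borel_measurable borel"
    "(\<lambda>z. R (fst z) (snd z)) \<in> borel_measurable borel"
    unfolding a_def b_def P_def R_def
    by (intro borel_measurable_diff borel_measurable_add mol_path_measurable; measurable)+
  have secw: "(\<lambda>s. f s w) \<in> borel_measurable borel"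
    if "(\<lambda>z. f (fst z) (snd z)) \<in> borel_measurable borel" for f :: "real \<Rightarrow> 'a \<Rightarrow> complex" and w
    using borel_measurable_section(2)[OF that, of w] by simp
  have CA: "0 \<le> CA" and CB: "0 \<le> CB" using bd order_trans[OF l2n_nonneg] by blast+
  have fin: "set_integrable lborel {0..t} (\<lambda>s. c)" for c :: real
    using t by (auto simp: set_integrable_def intro!: integrable_real_indicator)
  have si: "set_integrable lborel {0..t} f"
    if "f \<in> borel_measurable borel" "\<And>s. cmod (f s) \<le> g s" "set_integrable lborel {0..t} g" for f :: "real \<Rightarrow> complex" and g
    unfolding set_integrable_def
  proof (rule Bochner_Integration.integrable_bound)
    show "integrable lborel (\<lambda>s. indicator {0..t} s *\<^sub>R g s)" using that(3) by (simp add: set_integrable_def)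
    show "(\<lambda>s. indicator {0..t} s *\<^sub>R f s) \<in> borel_measurable lborel" using that(1) by measurable
    show "AE s in lborel. norm (indicator {0..t} s *\<^sub>R f s) \<le> norm (indicator {0..t} s *\<^sub>R g s)"
      using that(2) by (intro AE_I2) (auto simp: indicator_def intro: order_trans[OF _ abs_ge_self])
  qed
  have gi: "set_integrable lborel {0..t} (\<lambda>s. l2n (\<lambda>x. F (s, x)) * c + d)"
    "set_integrable lborel {0..t} (\<lambda>s. l2n (\<lambda>x. G (s, x)) * c + d)" for c d :: real
  proof -
    have "set_integrable lborel {0..t} (\<lambda>s. l2n (\<lambda>x. F (s, x)))" "set_integrable lborel {0..t} (\<lambda>s. l2n (\<lambda>x. G (s, x)))"
      unfolding set_integrable_def by (intro integrable_mult_indicator int; simp)+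
    then show "set_integrable lborel {0..t} (\<lambda>s. l2n (\<lambda>x. F (s, x)) * c + d)"
      "set_integrable lborel {0..t} (\<lambda>s. l2n (\<lambda>x. G (s, x)) * c + d)"
      by (intro set_integral_add(1) fin set_integrable_mult_left; simp)+
  qed
  have iP: "set_integrable lborel {0..t} (\<lambda>s. P s w)" for w
  proof (rule si[OF secw[OF meas2(3)]])
    show "cmod (P s w) \<le> l2n (\<lambda>x. F (s, x)) * l2n \<eta> + CA * l2n \<zeta>" for s
      unfolding P_def by (intro order_trans[OF norm_triangle_ineq4] add_mono mol_le sq \<eta>
          order_trans[OF mol_le] \<zeta> mult_right_mono bd l2n_nonneg)
  qed (rule gi)
  have iR: "set_integrable lborel {0..t} (\<lambda>s. R s w)" for w
  proof (rule si[OF secw[OF meas2(4)]])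
    show "cmod (R s w) \<le> l2n (\<lambda>x. G (s, x)) * l2n \<eta> + CB * l2n \<zeta>" for s
      unfolding R_def by (intro order_trans[OF norm_triangle_ineq] add_mono mol_le sq \<eta>
          order_trans[OF mol_le] \<zeta> mult_right_mono bd l2n_nonneg)
  qed (rule gi)
  \<comment> \<open>The weak equations carry the factor i on the time derivative, so the densities
    for \<open>ac_product\<close> are -i P and -i R.\<close>
  have pw: "\<i> * (a t w * b t w - a 0 w * b 0 w) = (LINT s:{0..t}|lborel. P s w * b s w + a s w * R s w)" for w
  proof -
    have "a t w * b t w - a 0 w * b 0 w
        = (LINT s:{0..t}|lborel. (- \<i> * P s w) * b s w + a s w * (- \<i> * R s w))"
    proof (rule ac_product)
      show "set_integrable lborel {0..t} (\<lambda>s. - \<i> * P s w)" "set_integrable lborel {0..t} (\<lambda>s. - \<i> * R s w)"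
        using iP iR by (intro set_integrable_mult_right; blast)+
      show "0 \<le> t" using t by simp
      fix s assume "s \<in> {0..t}"
      then have s: "s \<in> {0..T}" using t by auto
      have "- \<i> * (\<i> * (a s w - a 0 w)) = (LINT x:{0..s}|lborel. - \<i> * P x w)"
        unfolding a_def P_def eqA[OF s] by (rule set_integral_mult_right[symmetric])
      then show "a s w = a 0 w + (LINT x:{0..s}|lborel. - \<i> * P x w)" by (simp add: algebra_simps)
      have "- \<i> * (\<i> * (b s w - b 0 w)) = (LINT x:{0..s}|lborel. - \<i> * R x w)"
        unfolding b_def R_def eqB[OF s] by (rule set_integral_mult_right[symmetric])
      then show "b s w = b 0 w + (LINT x:{0..s}|lborel. - \<i> * R x w)" by (simp add: algebra_simps)
    qed
    also have "\<dots> = (LINT s:{0..t}|lborel. - \<i> * (P s w * b s w + a s w * R s w))"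
      by (simp add: algebra_simps)
    also have "\<dots> = - \<i> * (LINT s:{0..t}|lborel. P s w * b s w + a s w * R s w)"
      by (rule set_integral_mult_right)
    finally show ?thesis by simp
  qed
  have sq2: "sqint (a s)" "sqint (b s)" "sqint (P s)" "sqint (R s)" for s
    unfolding a_def[abs_def] b_def[abs_def] P_def[abs_def] R_def[abs_def]
    by (intro sqint_diff sqint_add sqint_mol[unfolded eta_contract_eq] sq \<eta> \<zeta>)+
  have na: "l2n (a s) \<le> CA" "l2n (b s) \<le> CB" for s
    using sqint_mol(2)[OF sq(1) \<eta>(1), of s] sqint_mol(2)[OF sq(2) \<eta>(1), of s] bd[of s] \<eta>(4)
    unfolding a_def[abs_def] b_def[abs_def] by simp_all
  define Z where "Z = (\<integral>x. cmod (\<zeta> x) \<partial>lborel)"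
  have Z: "0 \<le> Z" unfolding Z_def by (rule integral_nonneg_AE) simp
  have nP: "l2n (P s) \<le> l2n (\<lambda>x. F (s, x)) + Z * CA" for s
  proof -
    have "l2n (P s) \<le> l2n (mol \<eta> (\<lambda>x. F (s, x))) + l2n (mol \<zeta> (\<lambda>x. A (s, x)))"
      unfolding P_def[abs_def] by (intro l2n_triangle_diff sqint_mol sq \<eta> \<zeta>)
    also have "\<dots> \<le> l2n (\<lambda>x. F (s, x)) + Z * l2n (\<lambda>x. A (s, x))"
      using sqint_mol(2)[OF sq(3) \<eta>(1), of s] sqint_mol(2)[OF sq(1) \<zeta>(1), of s] \<eta>(4) by (simp add: Z_def)
    also have "\<dots> \<le> l2n (\<lambda>x. F (s, x)) + Z * CA" using bd Z by (simp add: mult_left_mono)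
    finally show ?thesis .
  qed
  have nR: "l2n (R s) \<le> l2n (\<lambda>x. G (s, x)) + Z * CB" for s
  proof -
    have "l2n (R s) \<le> l2n (mol \<eta> (\<lambda>x. G (s, x))) + l2n (mol \<zeta> (\<lambda>x. B (s, x)))"
      unfolding R_def[abs_def] by (intro l2n_triangle sqint_mol sq \<eta> \<zeta>)
    also have "\<dots> \<le> l2n (\<lambda>x. G (s, x)) + Z * l2n (\<lambda>x. B (s, x))"
      using sqint_mol(2)[OF sq(4) \<eta>(1), of s] sqint_mol(2)[OF sq(2) \<zeta>(1), of s] \<eta>(4) by (simp add: Z_def)
    also have "\<dots> \<le> l2n (\<lambda>x. G (s, x)) + Z * CB" using bd Z by (simp add: mult_left_mono)
    finally show ?thesis .
  qed
  \<comment> \<open>Joint integrability in time and space is what allows the time integral of the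
    product rule to be exchanged with the integral over the centres w.\<close>
  define J where "J z = indicator {0..t} (fst z) *\<^sub>R (P (fst z) (snd z) * b (fst z) (snd z) + a (fst z) (snd z) * R (fst z) (snd z))" for z
  have "integrable (lborel \<Otimes>\<^sub>M lborel) J"
  proof (rule lborel_pair.Fubini_integrable)
    show mJ: "J \<in> borel_measurable (lborel \<Otimes>\<^sub>M lborel)"
    proof -
      have "(\<lambda>z::real \<times> 'a. indicator {0..t} (fst z) :: real) \<in> borel_measurable borel"
        by (rule measurable_compose[of fst borel borel]) auto
      then have "J \<in> borel_measurable borel" unfolding J_def[abs_def] using meas2
        by (intro borel_measurable_scaleR borel_measurable_add borel_measurable_times)
      then show ?thesis by (simp add: lborel_prod)
    qed
    have pb: "integrable lborel (\<lambda>w. P s w * b s w)" "integrable lborel (\<lambda>w. a s w * R s w)" for s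
      using sq2 by (auto intro: sqint_mult_integrable)
    show "AE s in lborel. integrable lborel (\<lambda>w. J (s, w))"
      unfolding J_def using pb by (intro AE_I2) auto
    show "integrable lborel (\<lambda>s. \<integral>w. norm (J (s, w)) \<partial>lborel)"
    proof (rule Bochner_Integration.integrable_bound)
      show "integrable lborel (\<lambda>s. indicator {0..t} s *\<^sub>R ((l2n (\<lambda>x. F (s, x)) * CB + Z * CA * CB) + (l2n (\<lambda>x. G (s, x)) * CA + Z * CB * CA)))"
        using set_integral_add(1)[OF gi(1)[of CB "Z * CA * CB"] gi(2)[of CA "Z * CB * CA"]] by (simp add: set_integrable_def)
      show "(\<lambda>s. \<integral>w. norm (J (s, w)) \<partial>lborel) \<in> borel_measurable lborel"
        using mJ by measurable
      show "AE s in lborel. norm (\<integral>w. norm (J (s, w)) \<partial>lborel)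
        \<le> norm (indicator {0..t} s *\<^sub>R ((l2n (\<lambda>x. F (s, x)) * CB + Z * CA * CB) + (l2n (\<lambda>x. G (s, x)) * CA + Z * CB * CA)))"
      proof (rule AE_I2)
        fix s
        have "(\<integral>w. norm (P s w * b s w + a s w * R s w) \<partial>lborel)
            \<le> (\<integral>w. norm (P s w * b s w) + norm (a s w * R s w) \<partial>lborel)"
          using pb[of s] by (intro integral_mono) (auto intro: norm_triangle_ineq)
        also have "\<dots> = (\<integral>w. norm (P s w * b s w) \<partial>lborel) + (\<integral>w. norm (a s w * R s w) \<partial>lborel)"
          by (rule Bochner_Integration.integral_add) (intro integrable_norm pb)+
        also have "\<dots> \<le> l2n (P s) * l2n (b s) + l2n (a s) * l2n (R s)"
          by (intro add_mono cauchy_schwarz_norm sq2)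
        also have "\<dots> \<le> (l2n (\<lambda>x. F (s, x)) + Z * CA) * CB + CA * (l2n (\<lambda>x. G (s, x)) + Z * CB)"
          by (intro add_mono mult_mono nP nR na) (use CA CB Z in auto)
        finally have "(\<integral>w. norm (P s w * b s w + a s w * R s w) \<partial>lborel)
            \<le> (l2n (\<lambda>x. F (s, x)) * CB + Z * CA * CB) + (l2n (\<lambda>x. G (s, x)) * CA + Z * CB * CA)"
          by (simp add: algebra_simps)
        moreover have "0 \<le> (\<integral>w. norm (P s w * b s w + a s w * R s w) \<partial>lborel)" by (rule integral_nonneg_AE) simp
        ultimately show "norm (\<integral>w. norm (J (s, w)) \<partial>lborel)
          \<le> norm (indicator {0..t} s *\<^sub>R ((l2n (\<lambda>x. F (s, x)) * CB + Z * CA * CB) + (l2n (\<lambda>x. G (s, x)) * CA + Z * CB * CA)))"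
          by (cases "s \<in> {0..t}") (simp_all add: J_def)
      qed
    qed
  qed
  then have J: "integrable lborel J" by (simp add: lborel_prod)
  have inner: "(\<integral>w. J (s, w) \<partial>lborel) = indicator {0..t} s *\<^sub>R (molpair \<eta> \<eta> (\<lambda>x. F (s, x)) (\<lambda>x. B (s, x)) + molpair \<eta> \<eta> (\<lambda>x. A (s, x)) (\<lambda>x. G (s, x)))" for s
  proof -
    note i = molpair_correlation(1)
    have "(\<integral>w. P s w * b s w \<partial>lborel) = molpair \<eta> \<eta> (\<lambda>x. F (s, x)) (\<lambda>x. B (s, x)) - molpair \<zeta> \<eta> (\<lambda>x. A (s, x)) (\<lambda>x. B (s, x))"
      unfolding P_def b_def molpair_def left_diff_distrib
      by (rule Bochner_Integration.integral_diff; intro i sq \<eta> \<zeta>)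
    moreover have "(\<integral>w. a s w * R s w \<partial>lborel) = molpair \<eta> \<eta> (\<lambda>x. A (s, x)) (\<lambda>x. G (s, x)) + molpair \<eta> \<zeta> (\<lambda>x. A (s, x)) (\<lambda>x. B (s, x))"
      unfolding R_def a_def molpair_def distrib_left
      by (rule Bochner_Integration.integral_add; intro i sq \<eta> \<zeta>)
    \<comment> \<open>The cancellation: the \<zeta> term moved from A and the one moved from B
      coincide and enter with opposite signs.\<close>
    moreover have "molpair \<eta> \<zeta> (\<lambda>x. A (s, x)) (\<lambda>x. B (s, x)) = molpair \<zeta> \<eta> (\<lambda>x. A (s, x)) (\<lambda>x. B (s, x))"
      by (intro molpair_swap_even sq \<eta> \<zeta>)
    moreover have "(\<integral>w. P s w * b s w + a s w * R s w \<partial>lborel) = (\<integral>w. P s w * b s w \<partial>lborel) + (\<integral>w. a s w * R s w \<partial>lborel)"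
      by (rule Bochner_Integration.integral_add) (intro sqint_mult_integrable sq2)+
    ultimately show ?thesis unfolding J_def by simp
  qed
  have "\<i> * (molpair \<eta> \<eta> (\<lambda>x. A (t, x)) (\<lambda>x. B (t, x)) - molpair \<eta> \<eta> (\<lambda>x. A (0, x)) (\<lambda>x. B (0, x)))
      = \<i> * (\<integral>w. a t w * b t w - a 0 w * b 0 w \<partial>lborel)"
    unfolding molpair_def a_def b_def
    by (subst Bochner_Integration.integral_diff) (intro molpair_correlation(1) sq \<eta> refl)+
  also have "\<dots> = (\<integral>w. \<i> * (a t w * b t w - a 0 w * b 0 w) \<partial>lborel)" by simp
  also have "\<dots> = (\<integral>w. \<integral>s. J (s, w) \<partial>lborel \<partial>lborel)"
    unfolding pw by (simp add: J_def set_lebesgue_integral_def)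
  also have "\<dots> = (\<integral>s. \<integral>w. J (s, w) \<partial>lborel \<partial>lborel)"
    using integral_lborel_pair[OF J] integral_lborel_pair_swap[OF J] by simp
  also have "\<dots> = (LINT s:{0..t}|lborel. molpair \<eta> \<eta> (\<lambda>x. F (s, x)) (\<lambda>x. B (s, x)) + molpair \<eta> \<eta> (\<lambda>x. A (s, x)) (\<lambda>x. G (s, x)))"
    unfolding inner set_lebesgue_integral_def ..
  finally show ?thesis .
qed

text \<open>\<zeta> has already cancelled in \<open>mollified_product\<close>, so the limit concerns
  only pairings with \<open>\<eta> n\<close>; these are dominated uniformly in n because the
  mollifiers have L^1 norm 1.\<close>

lemma weak_product_rule:
  fixes A B F G :: "real \<times> 'a::euclidean_space \<Rightarrow> complex" and \<eta> \<zeta> :: "nat \<Rightarrow> 'a \<Rightarrow> complex"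
  assumes \<eta>: "mollifier \<eta>"
    and \<zeta>: "\<And>n. integrable lborel (\<zeta> n)" "\<And>n. sqint (\<zeta> n)" "\<And>n x. \<zeta> n (- x) = \<zeta> n x"
    and meas [measurable]: "A \<in> borel_measurable borel" "B \<in> borel_measurable borel"
      "F \<in> borel_measurable borel" "G \<in> borel_measurable borel"
    and sq: "\<And>s. sqint (\<lambda>x. A (s, x))" "\<And>s. sqint (\<lambda>x. B (s, x))"
      "\<And>s. sqint (\<lambda>x. F (s, x))" "\<And>s. sqint (\<lambda>x. G (s, x))"
    and bd: "\<And>s. l2n (\<lambda>x. A (s, x)) \<le> CA" "\<And>s. l2n (\<lambda>x. B (s, x)) \<le> CB"
    and int: "integrable lborel (\<lambda>s. l2n (\<lambda>x. F (s, x)))" "integrable lborel (\<lambda>s. l2n (\<lambda>x. G (s, x)))"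
    and eqA: "\<And>n w t. t \<in> {0..T} \<Longrightarrow> \<i> * (mol (\<eta> n) (\<lambda>x. A (t, x)) w - mol (\<eta> n) (\<lambda>x. A (0, x)) w)
      = (LINT s:{0..t}|lborel. mol (\<eta> n) (\<lambda>x. F (s, x)) w - mol (\<zeta> n) (\<lambda>x. A (s, x)) w)"
    and eqB: "\<And>n w t. t \<in> {0..T} \<Longrightarrow> \<i> * (mol (\<eta> n) (\<lambda>x. B (t, x)) w - mol (\<eta> n) (\<lambda>x. B (0, x)) w)
      = (LINT s:{0..t}|lborel. mol (\<eta> n) (\<lambda>x. G (s, x)) w + mol (\<zeta> n) (\<lambda>x. B (s, x)) w)"
    and t: "t \<in> {0..T}"
  shows "\<i> * ((\<integral>x. A (t, x) * B (t, x) \<partial>lborel) - (\<integral>x. A (0, x) * B (0, x) \<partial>lborel))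
    = (LINT s:{0..t}|lborel. (\<integral>x. F (s, x) * B (s, x) \<partial>lborel) + (\<integral>x. A (s, x) * G (s, x) \<partial>lborel))"
proof (rule LIMSEQ_unique)
  let ?M = "\<lambda>n U V. molpair (\<eta> n) (\<eta> n) U V"
  show "(\<lambda>n. \<i> * (?M n (\<lambda>x. A (t, x)) (\<lambda>x. B (t, x)) - ?M n (\<lambda>x. A (0, x)) (\<lambda>x. B (0, x))))
    \<longlonglongrightarrow> \<i> * ((\<integral>x. A (t, x) * B (t, x) \<partial>lborel) - (\<integral>x. A (0, x) * B (0, x) \<partial>lborel))"
    by (intro tendsto_intros molpair_tendsto sq \<eta>)
  have eq: "\<i> * (?M n (\<lambda>x. A (t, x)) (\<lambda>x. B (t, x)) - ?M n (\<lambda>x. A (0, x)) (\<lambda>x. B (0, x)))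
    = (LINT s:{0..t}|lborel. ?M n (\<lambda>x. F (s, x)) (\<lambda>x. B (s, x)) + ?M n (\<lambda>x. A (s, x)) (\<lambda>x. G (s, x)))" for n
    by (rule mollified_product[OF mollifierD(5)[OF \<eta>] mollifierD(7)[OF \<eta>] mollifierD(2)[OF \<eta>] mollifierD(6)[OF \<eta>]
          \<zeta> meas sq bd int eqA eqB t])
  have [measurable]: "\<eta> n \<in> borel_measurable borel" for n
    using mollifierD(7)[OF \<eta>] by (rule sqint_measurable)
  have mm: "(\<lambda>s. ?M n (\<lambda>x. U (s, x)) (\<lambda>x. V (s, x))) \<in> borel_measurable borel"
    if [measurable]: "U \<in> borel_measurable borel" "V \<in> borel_measurable borel" for n and U V :: "real \<times> 'a \<Rightarrow> complex"
    unfolding molpair_def mol_def by measurable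
  have mb: "cmod (?M n U V) \<le> l2n U * l2n V" if "sqint U" "sqint V" for n U V
    using molpair_bound[OF that mollifierD(5)[OF \<eta>] mollifierD(5)[OF \<eta>]] mollifierD(6)[OF \<eta>] by simp
  show "(\<lambda>n. \<i> * (?M n (\<lambda>x. A (t, x)) (\<lambda>x. B (t, x)) - ?M n (\<lambda>x. A (0, x)) (\<lambda>x. B (0, x))))
    \<longlonglongrightarrow> (LINT s:{0..t}|lborel. (\<integral>x. F (s, x) * B (s, x) \<partial>lborel) + (\<integral>x. A (s, x) * G (s, x) \<partial>lborel))"
    unfolding eq set_lebesgue_integral_def
  proof (rule integral_dominated_convergence[where w = "\<lambda>s. l2n (\<lambda>x. F (s, x)) * CB + CA * l2n (\<lambda>x. G (s, x))"])
    show "integrable lborel (\<lambda>s. l2n (\<lambda>x. F (s, x)) * CB + CA * l2n (\<lambda>x. G (s, x)))"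
      using int by simp
    show "AE s in lborel. (\<lambda>n. indicator {0..t} s *\<^sub>R (?M n (\<lambda>x. F (s, x)) (\<lambda>x. B (s, x)) + ?M n (\<lambda>x. A (s, x)) (\<lambda>x. G (s, x))))
      \<longlonglongrightarrow> indicator {0..t} s *\<^sub>R ((\<integral>x. F (s, x) * B (s, x) \<partial>lborel) + (\<integral>x. A (s, x) * G (s, x) \<partial>lborel))"
      by (intro AE_I2 tendsto_intros molpair_tendsto sq \<eta>)
    show "AE s in lborel. norm (indicator {0..t} s *\<^sub>R (?M n (\<lambda>x. F (s, x)) (\<lambda>x. B (s, x)) + ?M n (\<lambda>x. A (s, x)) (\<lambda>x. G (s, x))))
      \<le> l2n (\<lambda>x. F (s, x)) * CB + CA * l2n (\<lambda>x. G (s, x))" for n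
    proof (rule AE_I2)
      fix s
      have "norm (indicator {0..t} s *\<^sub>R (?M n (\<lambda>x. F (s, x)) (\<lambda>x. B (s, x)) + ?M n (\<lambda>x. A (s, x)) (\<lambda>x. G (s, x))))
        \<le> norm (?M n (\<lambda>x. F (s, x)) (\<lambda>x. B (s, x)) + ?M n (\<lambda>x. A (s, x)) (\<lambda>x. G (s, x)))"
        by (simp add: indicator_def)
      also have "\<dots> \<le> l2n (\<lambda>x. F (s, x)) * l2n (\<lambda>x. B (s, x)) + l2n (\<lambda>x. A (s, x)) * l2n (\<lambda>x. G (s, x))"
        by (intro order_trans[OF norm_triangle_ineq] add_mono mb sq)
      also have "\<dots> \<le> l2n (\<lambda>x. F (s, x)) * CB + CA * l2n (\<lambda>x. G (s, x))"
        by (intro add_mono mult_left_mono mult_right_mono bd l2n_nonneg)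
      finally show "norm (indicator {0..t} s *\<^sub>R (?M n (\<lambda>x. F (s, x)) (\<lambda>x. B (s, x)) + ?M n (\<lambda>x. A (s, x)) (\<lambda>x. G (s, x))))
        \<le> l2n (\<lambda>x. F (s, x)) * CB + CA * l2n (\<lambda>x. G (s, x))" .
    qed
    show "(\<lambda>s. indicator {0..t} s *\<^sub>R (?M n (\<lambda>x. F (s, x)) (\<lambda>x. B (s, x)) + ?M n (\<lambda>x. A (s, x)) (\<lambda>x. G (s, x)))) \<in> borel_measurable lborel" for n
      using mm[OF meas(3) meas(2), of n] mm[OF meas(1) meas(4), of n] by measurable
    show "(\<lambda>s. indicator {0..t} s *\<^sub>R ((\<integral>x. F (s, x) * B (s, x) \<partial>lborel) + (\<integral>x. A (s, x) * G (s, x) \<partial>lborel))) \<in> borel_measurable lborel"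
      by measurable
  qed
qed

section \<open>Weak solutions in the kernel variables\<close>

text \<open>A path is a function of time and space; time is extended by zero outside the interval.\<close>

definition L1_path :: "(real \<times> 'a::euclidean_space \<Rightarrow> complex) \<Rightarrow> bool" where
  "L1_path Q \<longleftrightarrow> Q \<in> borel_measurable borel \<and> (\<forall>s. sqint (\<lambda>z. Q (s, z))) \<and> integrable lborel (\<lambda>s. l2n (\<lambda>z. Q (s, z)))"

lemma L1_pathD:
  assumes "L1_path Q"
  shows "Q \<in> borel_measurable borel" "sqint (\<lambda>z. Q (s, z))" "integrable lborel (\<lambda>s. l2n (\<lambda>z. Q (s, z)))"
  using assms by (auto simp: L1_path_def)

lemma L1_path_bound:
  fixes Q :: "real \<times> 'a::euclidean_space \<Rightarrow> complex"
  assumes m: "Q \<in> borel_measurable borel" and s: "\<And>s. sqint (\<lambda>z. Q (s, z))"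
    and i: "integrable lborel g" and le: "\<And>s. l2n (\<lambda>z. Q (s, z)) \<le> g s"
  shows "L1_path Q"
  unfolding L1_path_def
proof (intro conjI allI m s)
  show "integrable lborel (\<lambda>s. l2n (\<lambda>z. Q (s, z)))"
  proof (rule Bochner_Integration.integrable_bound[OF i])
    show "(\<lambda>s. l2n (\<lambda>z. Q (s, z))) \<in> borel_measurable lborel"
      using l2n_path_measurable[OF m] by simp
    show "AE s in lborel. norm (l2n (\<lambda>z. Q (s, z))) \<le> norm (g s)"
    proof (rule AE_I2)
      fix s show "norm (l2n (\<lambda>z. Q (s, z))) \<le> norm (g s)"
        using le[of s] by simp
    qed
  qed
qed

lemma L1_path_add:
  assumes P: "L1_path P" and Q: "L1_path Q"
  shows "L1_path (\<lambda>z. P z + Q z)"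
proof (rule L1_path_bound)
  show "(\<lambda>z. P z + Q z) \<in> borel_measurable borel"
    using L1_pathD(1)[OF P] L1_pathD(1)[OF Q] by measurable
  show "integrable lborel (\<lambda>s. l2n (\<lambda>z. P (s, z)) + l2n (\<lambda>z. Q (s, z)))"
    using L1_pathD(3)[OF P] L1_pathD(3)[OF Q] by simp
qed (intro sqint_add l2n_triangle L1_pathD(2) P Q)+

lemma L1_path_cmult:
  assumes P: "L1_path P"
  shows "L1_path (\<lambda>z. c * P z)"
proof (rule L1_path_bound)
  show "(\<lambda>z. c * P z) \<in> borel_measurable borel"
    using L1_pathD(1)[OF P] by measurable
  show "integrable lborel (\<lambda>s. cmod c * l2n (\<lambda>z. P (s, z)))"
    using L1_pathD(3)[OF P] by simp
qed (auto intro: sqint_cmult L1_pathD(2)[OF P] simp: l2n_cmult)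

lemma L1_path_diff:
  assumes P: "L1_path P" and Q: "L1_path Q"
  shows "L1_path (\<lambda>z. P z - Q z)"
  using L1_path_add[OF P L1_path_cmult[OF Q, of "- 1"]] by simp

lemma L1_path_cnj:
  assumes P: "L1_path P"
  shows "L1_path (\<lambda>z. cnj (P z))"
proof (rule L1_path_bound)
  show "(\<lambda>z. cnj (P z)) \<in> borel_measurable borel" using L1_pathD(1)[OF P] by measurable
qed (use L1_pathD[OF P] sqint_cnj in auto)

lemma L1_path_swap:
  fixes P :: "real \<times> ((real^3) \<times> (real^3)) \<Rightarrow> complex"
  assumes P: "L1_path P"
  shows "L1_path (\<lambda>(s, z). P (s, prod.swap z))"
proof (rule L1_path_bound)
  have [measurable]: "P \<in> borel_measurable borel" by (rule L1_pathD(1)[OF P])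
  have "(\<lambda>y. P (fst y, prod.swap (snd y))) \<in> borel_measurable borel" by measurable
  then show "(\<lambda>(s, z). P (s, prod.swap z)) \<in> borel_measurable borel" by (simp add: case_prod_beta')
  show "integrable lborel (\<lambda>s. l2n (\<lambda>z. P (s, z)))" by (rule L1_pathD(3)[OF P])
  fix s
  show "sqint (\<lambda>z. case (s, z) of (s, z) \<Rightarrow> P (s, prod.swap z))"
    using sqint_swap[OF L1_pathD(2)[OF P, of s]] by simp
  show "l2n (\<lambda>z. case (s, z) of (s, z) \<Rightarrow> P (s, prod.swap z)) \<le> l2n (\<lambda>z. P (s, z))"
    using l2n_swap[OF sqint_measurable[OF L1_pathD(2)[OF P, of s]]] by simp
qed

lemma L1_path_kcomp:
  fixes P Q :: "real \<times> ((real^3) \<times> (real^3)) \<Rightarrow> complex"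
  assumes P: "L1_path P" and Q: "L1_path Q"
    and bd: "(\<forall>s. l2n (\<lambda>z. Q (s, z)) \<le> C) \<or> (\<forall>s. l2n (\<lambda>z. P (s, z)) \<le> C)"
  shows "L1_path (\<lambda>(s, z). ((\<lambda>z. P (s, z)) \<odot> (\<lambda>z. Q (s, z))) z)"
proof (rule L1_path_bound)
  have [measurable]: "P \<in> borel_measurable borel" "Q \<in> borel_measurable borel"
    using L1_pathD(1)[OF P] L1_pathD(1)[OF Q] by auto
  have "(\<lambda>y. \<integral>w. P (fst y, (fst (snd y), w)) * Q (fst y, (w, snd (snd y))) \<partial>lborel) \<in> borel_measurable borel"
    by measurable
  then show "(\<lambda>(s, z). ((\<lambda>z. P (s, z)) \<odot> (\<lambda>z. Q (s, z))) z) \<in> borel_measurable borel"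
    by (simp add: kcomp_def case_prod_beta')
  \<comment> \<open>One dominating function for both alternatives of \<open>bd\<close>: the norm of
    the bounded factor is replaced by |C|, and the other summand is a harmless surplus.\<close>
  show "integrable lborel (\<lambda>s. \<bar>C\<bar> * (l2n (\<lambda>z. P (s, z)) + l2n (\<lambda>z. Q (s, z))))"
    using L1_pathD(3)[OF P] L1_pathD(3)[OF Q] by simp
  fix s
  show "sqint (\<lambda>z. case (s, z) of (s, z) \<Rightarrow> ((\<lambda>z. P (s, z)) \<odot> (\<lambda>z. Q (s, z))) z)"
    using sqint_kcomp[OF L1_pathD(2)[OF P] L1_pathD(2)[OF Q], of s s] by simp
  have "l2n ((\<lambda>z. P (s, z)) \<odot> (\<lambda>z. Q (s, z))) \<le> l2n (\<lambda>z. P (s, z)) * l2n (\<lambda>z. Q (s, z))"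
    by (rule l2n_kcomp[OF L1_pathD(2)[OF P] L1_pathD(2)[OF Q]])
  also have "\<dots> \<le> \<bar>C\<bar> * (l2n (\<lambda>z. P (s, z)) + l2n (\<lambda>z. Q (s, z)))"
    using bd
  proof
    assume "\<forall>s. l2n (\<lambda>z. Q (s, z)) \<le> C"
    then have "l2n (\<lambda>z. Q (s, z)) \<le> \<bar>C\<bar>" using abs_ge_self order_trans by blast
    then have "l2n (\<lambda>z. P (s, z)) * l2n (\<lambda>z. Q (s, z)) \<le> l2n (\<lambda>z. P (s, z)) * \<bar>C\<bar>"
      by (intro mult_left_mono) auto
    then show ?thesis by (simp add: algebra_simps add_increasing2)
  next
    assume "\<forall>s. l2n (\<lambda>z. P (s, z)) \<le> C"
    then have "l2n (\<lambda>z. P (s, z)) \<le> \<bar>C\<bar>" using abs_ge_self order_trans by blast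
    then have "l2n (\<lambda>z. P (s, z)) * l2n (\<lambda>z. Q (s, z)) \<le> \<bar>C\<bar> * l2n (\<lambda>z. Q (s, z))"
      by (intro mult_right_mono) auto
    then show ?thesis by (simp add: algebra_simps add_increasing)
  qed
  finally show "l2n (\<lambda>z. case (s, z) of (s, z) \<Rightarrow> ((\<lambda>z. P (s, z)) \<odot> (\<lambda>z. Q (s, z))) z)
      \<le> \<bar>C\<bar> * (l2n (\<lambda>z. P (s, z)) + l2n (\<lambda>z. Q (s, z)))" by simp
qed

text \<open>The kernel as a bilinear form on functions of one variable, that is, its pairing with a
  test function of product form. Products are enough because a mollifier on the product space may be
  chosen as a product.\<close>

definition bpair :: "kernel \<Rightarrow> (real^3 \<Rightarrow> complex) \<Rightarrow> (real^3 \<Rightarrow> complex) \<Rightarrow> complex" where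
  "bpair a f g = (\<integral>z. f (fst z) * a z * g (snd z) \<partial>lborel)"

lemma bpair_eq_pairing: "bpair a f g = pairing a (\<lambda>(x, y). f x * g y)"
  by (simp add: bpair_def pairing_def case_prod_beta' mult_ac)

lemma bpair_le:
  assumes "sqint a" "sqint f" "sqint g"
  shows "cmod (bpair a f g) \<le> l2n a * (l2n f * l2n g)"
proof -
  have "cmod (bpair a f g) \<le> l2n a * l2n (\<lambda>(x, y). f x * g y)"
    unfolding bpair_eq_pairing pairing_def by (rule cauchy_schwarz_l2n[OF assms(1) sqint_tensor(1)[OF assms(2,3)]])
  also have "\<dots> \<le> l2n a * (l2n f * l2n g)"
    by (intro mult_left_mono sqint_tensor(2) assms l2n_nonneg)
  finally show ?thesis .
qed

lemma bpair_add:
  assumes "sqint a" "sqint b" "sqint f" "sqint g"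
  shows "bpair (\<lambda>z. a z + b z) f g = bpair a f g + bpair b f g"
    "bpair (\<lambda>z. a z - b z) f g = bpair a f g - bpair b f g"
  using assms by (simp_all add: bpair_def ring_distribs bilinear_integral_swap)

lemma bpair_cmult: "bpair (\<lambda>z. c * a z) f g = c * bpair a f g"
  by (simp add: bpair_def mult_ac flip: integral_mult_right_zero)

lemma bpair_cong_AE:
  assumes "sqint a" "sqint b" "sqint f" "sqint g" "AE z in lborel. a z = b z"
  shows "bpair a f g = bpair b f g"
  unfolding bpair_eq_pairing pairing_def
  by (rule integral_mult_cong_AE[OF assms(1,2) sqint_tensor(1) sqint_tensor(1)]) (use assms in auto)

lemma bpair_swap:
  assumes a: "sqint a" "sqint f" "sqint g"
  shows "bpair (\<lambda>z. a (prod.swap z)) f g = bpair a g f"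
proof -
  have "(\<lambda>z. g (fst z) * a z * f (snd z)) \<in> borel_measurable borel"
    using borel_measurable_integrable[OF bilinear_integral_swap(1)[OF a(3,2,1)]] by simp
  from integral_swap_vars[OF this] show ?thesis by (simp add: bpair_def mult_ac)
qed

lemma bpair_path_integrable:
  assumes Q: "L1_path Q" and f: "sqint f" and g: "sqint g"
  shows "integrable lborel (\<lambda>s. bpair (\<lambda>z. Q (s, z)) f g)" "set_integrable lborel {0..t::real} (\<lambda>s. bpair (\<lambda>z. Q (s, z)) f g)"
proof -
  have [measurable]: "Q \<in> borel_measurable borel" "f \<in> borel_measurable borel" "g \<in> borel_measurable borel"
    using L1_pathD(1)[OF Q] f g by (auto simp: sqint_def)
  show "integrable lborel (\<lambda>s. bpair (\<lambda>z. Q (s, z)) f g)"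
  proof (rule Bochner_Integration.integrable_bound)
    show "integrable lborel (\<lambda>s. l2n (\<lambda>z. Q (s, z)) * (l2n f * l2n g))"
      using L1_pathD(3)[OF Q] by simp
    show "(\<lambda>s. bpair (\<lambda>z. Q (s, z)) f g) \<in> borel_measurable lborel"
      unfolding bpair_def by measurable
    show "AE s in lborel. norm (bpair (\<lambda>z. Q (s, z)) f g) \<le> norm (l2n (\<lambda>z. Q (s, z)) * (l2n f * l2n g))"
      using bpair_le[OF L1_pathD(2)[OF Q] f g] by (intro AE_I2) simp
  qed
  then show "set_integrable lborel {0..t} (\<lambda>s. bpair (\<lambda>z. Q (s, z)) f g)"
    unfolding set_integrable_def by (intro integrable_mult_indicator) auto
qed

text \<open>The weak form of i a_t + c Lap_x a + d Lap_y a = F. Keeping c and d as parameters treats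
  u, p, their conjugates and transposes, and the compositions of such paths all at once.\<close>

definition wform :: "real \<Rightarrow> real \<Rightarrow> real \<Rightarrow> (real \<times> ((real^3) \<times> (real^3)) \<Rightarrow> complex) \<Rightarrow> (real \<times> ((real^3) \<times> (real^3)) \<Rightarrow> complex) \<Rightarrow> bool" where
  "wform T c d A F \<longleftrightarrow> L1_path A \<and> L1_path F \<and>
    (\<forall>f g t. compact_smooth f \<longrightarrow> compact_smooth g \<longrightarrow> t \<in> {0..T} \<longrightarrow>
      \<i> * (bpair (\<lambda>z. A (t, z)) f g - bpair (\<lambda>z. A (0, z)) f g)
      = (LINT s:{0..t}|lborel. bpair (\<lambda>z. F (s, z)) f g
          - (of_real c * bpair (\<lambda>z. A (s, z)) (laplacian f) g + of_real d * bpair (\<lambda>z. A (s, z)) f (laplacian g))))"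

text \<open>A norm bound uniform in time is demanded of the factors of a product. The product itself
  is recorded only as \<open>wform\<close>, which suffices for comparing sources.\<close>

definition wsol :: "real \<Rightarrow> real \<Rightarrow> real \<Rightarrow> (real \<times> ((real^3) \<times> (real^3)) \<Rightarrow> complex) \<Rightarrow> (real \<times> ((real^3) \<times> (real^3)) \<Rightarrow> complex) \<Rightarrow> bool" where
  "wsol T c d A F \<longleftrightarrow> wform T c d A F \<and> (\<exists>C. \<forall>s. l2n (\<lambda>z. A (s, z)) \<le> C)"

text \<open>\<open>L1_L2\<close> controls slices only at almost every time, whereas the product rule
  wants every slice in L^2. The path is set to 0 at times of infinite norm, a measurable set because
  the norm is a measurable function of time.\<close>

lemma L1_L2_regularise:
  assumes "L1_L2 T S"
  shows "\<exists>H. L1_path H \<and> (AE s in lborel. s \<in> {0..T} \<longrightarrow> sqint (S s) \<and> (\<forall>z. H (s, z) = S s z))"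
proof -
  define K where "K y = indicator ({0..T} \<times> UNIV) y *\<^sub>R S (fst y) (snd y)" for y :: "real \<times> ((real^3) \<times> (real^3))"
  have [measurable]: "K \<in> borel_measurable borel"
    using assms unfolding L1_L2_def kernel_path_def set_borel_measurable_def K_def[abs_def]
    by (simp add: case_prod_beta')
  define N where "N s = (\<integral>\<^sup>+z. ennreal ((cmod (K (s, z)))\<^sup>2) \<partial>lborel)" for s
  have [measurable]: "N \<in> borel_measurable borel" unfolding N_def[abs_def] by measurable
  define H where "H y = (if N (fst y) < \<infinity> then K y else 0)" for y
  have mH: "H \<in> borel_measurable borel" unfolding H_def[abs_def] by measurable
  have sH: "sqint (\<lambda>z. H (s, z))" for s
  proof (cases "N s < \<infinity>")
    case True
    then have "sqint (\<lambda>z. K (s, z))"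
      unfolding sqint_iff_nn N_def by (intro conjI borel_measurable_section) auto
    then show ?thesis using True by (simp add: H_def)
  qed (simp add: H_def)
  have in_T: "sqint (S s) \<and> (\<forall>z. H (s, z) = S s z)" if "s \<in> {0..T}" "L2_kernel (S s)" for s
  proof -
    have K: "K (s, z) = S s z" for z using that by (simp add: K_def)
    have "N s < \<infinity>" using that(2) unfolding L2_kernel_iff_sqint sqint_iff_nn N_def K by simp
    then show ?thesis using that K by (simp add: H_def L2_kernel_iff_sqint)
  qed
  have ae: "AE s in lborel. s \<in> {0..T} \<longrightarrow> L2_kernel (S s)" using assms by (simp add: L1_L2_def)
  have "integrable lborel (\<lambda>s. indicator {0..T} s *\<^sub>R L2_norm (S s))"
    using assms by (simp add: L1_L2_def set_integrable_def)
  then have "integrable lborel (\<lambda>s. l2n (\<lambda>z. H (s, z)))"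
  proof (rule integrable_cong_AE_imp)
    show "(\<lambda>s. l2n (\<lambda>z. H (s, z))) \<in> borel_measurable lborel"
      using l2n_path_measurable[OF mH] by simp
    show "AE s in lborel. indicator {0..T} s *\<^sub>R L2_norm (S s) = l2n (\<lambda>z. H (s, z))"
      using ae
    proof eventually_elim
      case (elim s)
      show ?case
      proof (cases "s \<in> {0..T}")
        case True
        then have "(\<lambda>z. H (s, z)) = S s" using in_T[OF True] elim by (simp add: fun_eq_iff)
        then show ?thesis using True by (simp add: L2_norm_eq_l2n)
      next
        case False
        then have "H (s, z) = 0" for z by (auto simp: H_def K_def)
        then show ?thesis using False by simp
      qed
    qed
  qed
  moreover have "AE s in lborel. s \<in> {0..T} \<longrightarrow> sqint (S s) \<and> (\<forall>z. H (s, z) = S s z)"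
    using ae by eventually_elim (use in_T in blast)
  ultimately show ?thesis using mH sH unfolding L1_path_def by blast
qed

text \<open>Inside the interval no value is changed, at no time: the final estimate concerns the
  values at the two end points and not a class modulo null sets of times.\<close>

lemma Linf_L2_regularise:
  assumes "Linf_L2 T a"
  shows "\<exists>A. L1_path A \<and> (\<exists>C. \<forall>s. l2n (\<lambda>z. A (s, z)) \<le> C) \<and> (\<forall>s\<in>{0..T}. \<forall>z. A (s, z) = a s z)"
proof -
  define A where "A y = indicator ({0..T} \<times> UNIV) y *\<^sub>R a (fst y) (snd y)" for y :: "real \<times> ((real^3) \<times> (real^3))"
  have mA: "A \<in> borel_measurable borel"
    using assms unfolding Linf_L2_def kernel_path_def set_borel_measurable_def A_def[abs_def]
    by (simp add: case_prod_beta')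
  have A: "(\<lambda>z. A (s, z)) = (if s \<in> {0..T} then a s else (\<lambda>_. 0))" for s
    by (auto simp: A_def fun_eq_iff)
  obtain C where C: "\<And>t. t \<in> {0..T} \<Longrightarrow> L2_norm (a t) \<le> C" using assms unfolding Linf_L2_def by blast
  have sA: "sqint (\<lambda>z. A (s, z))" for s
    unfolding A using assms by (auto simp: Linf_L2_def L2_kernel_iff_sqint)
  have le: "l2n (\<lambda>z. A (s, z)) \<le> indicator {0..T} s * \<bar>C\<bar>" for s
    unfolding A using C[of s] by (auto simp: L2_norm_eq_l2n)
  have "integrable lborel (\<lambda>s. indicator {0..T} s * \<bar>C\<bar>)"
    by (cases "0 \<le> T") (auto intro!: integrable_real_indicator)
  then have "L1_path A" by (rule L1_path_bound[OF mA sA _ le])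
  moreover have "\<forall>s. l2n (\<lambda>z. A (s, z)) \<le> \<bar>C\<bar>"
  proof
    fix s show "l2n (\<lambda>z. A (s, z)) \<le> \<bar>C\<bar>"
      by (rule order_trans[OF le]) (simp add: indicator_def)
  qed
  moreover have "\<forall>s\<in>{0..T}. \<forall>z. A (s, z) = a s z" by (simp add: A_def)
  ultimately show ?thesis by blast
qed

lemma pairing_path_measurable:
  assumes B: "kernel_path T B" and [measurable]: "\<psi> \<in> borel_measurable borel" and t: "t \<le> T"
  shows "(\<lambda>s. indicator {0..t} s *\<^sub>R pairing (B s) \<psi>) \<in> borel_measurable lborel"
proof -
  define K where "K y = indicator ({0..T} \<times> UNIV) y *\<^sub>R B (fst y) (snd y)" for y :: "real \<times> ((real^3) \<times> (real^3))"
  have [measurable]: "K \<in> borel_measurable borel"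
    using B unfolding kernel_path_def set_borel_measurable_def K_def[abs_def]
    by (simp add: case_prod_beta')
  have eq: "indicator {0..t} s *\<^sub>R pairing (B s) \<psi> = indicator {0..t} s *\<^sub>R (\<integral>z. K (s, z) * \<psi> z \<partial>lborel)" for s
    using t by (cases "s \<in> {0..t}") (auto simp: pairing_def K_def)
  show ?thesis unfolding eq by measurable
qed

text \<open>The part of g without derivatives moves to the right, giving the source S - B. On the
  left only Laplacians with constant coefficients remain, as the product rule requires.\<close>

lemma weak_evolution_wsol:
  assumes we: "weak_evolution T (\<lambda>\<psi> z. of_real c * lap_x \<psi> z + of_real d * lap_y \<psi> z) a B S" and T: "0 \<le> T"
  obtains A F where "wsol T c d A F" "\<And>s z. s \<in> {0..T} \<Longrightarrow> A (s, z) = a s z"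
    "AE s in lborel. s \<in> {0..T} \<longrightarrow> sqint (B s) \<and> sqint (S s) \<and> (\<forall>z. F (s, z) = S s z - B s z)"
proof -
  have w: "Linf_L2 T a" "L1_L2 T B" "L1_L2 T S" using we unfolding weak_evolution_def by blast+
  obtain A where A0: "L1_path A \<and> (\<exists>C. \<forall>s. l2n (\<lambda>z. A (s, z)) \<le> C) \<and> (\<forall>s\<in>{0..T}. \<forall>z. A (s, z) = a s z)"
    using Linf_L2_regularise[OF w(1)] by blast
  then obtain C where "\<forall>s. l2n (\<lambda>z. A (s, z)) \<le> C" by blast
  with A0 have A: "L1_path A" "\<And>s. l2n (\<lambda>z. A (s, z)) \<le> C" "\<And>s z. s \<in> {0..T} \<Longrightarrow> A (s, z) = a s z" by blast+
  obtain B' where B': "L1_path B'" "AE s in lborel. s \<in> {0..T} \<longrightarrow> sqint (B s) \<and> (\<forall>z. B' (s, z) = B s z)"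
    using L1_L2_regularise[OF w(2)] by blast
  obtain S' where S': "L1_path S'" "AE s in lborel. s \<in> {0..T} \<longrightarrow> sqint (S s) \<and> (\<forall>z. S' (s, z) = S s z)"
    using L1_L2_regularise[OF w(3)] by blast
  have W: "wsol T c d A (\<lambda>y. S' y - B' y)"
    unfolding wsol_def wform_def
  proof (intro conjI allI impI A L1_path_diff S' B')
    show "\<exists>C. \<forall>s. l2n (\<lambda>z. A (s, z)) \<le> C" using A(2) by blast
    fix f g :: "real^3 \<Rightarrow> complex" and t
    assume f: "compact_smooth f" and g: "compact_smooth g" and t: "t \<in> {0..T}"
    have sq: "sqint f" "sqint g" "sqint (laplacian f)" "sqint (laplacian g)"
      using f g by (auto intro: compact_smooth_sqint laplacian_integrable)
    let ?\<psi> = "\<lambda>(x, y). f x * g y"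
    let ?D = "\<lambda>z. of_real c * lap_x ?\<psi> z + of_real d * lap_y ?\<psi> z"
    have Aeq: "(\<lambda>z. A (s, z)) = a s" if "s \<in> {0..T}" for s using A(3)[OF that] by (simp add: fun_eq_iff)
    have D: "pairing (a s) ?D = of_real c * bpair (\<lambda>z. A (s, z)) (laplacian f) g + of_real d * bpair (\<lambda>z. A (s, z)) f (laplacian g)"
      if s: "s \<in> {0..T}" for s
    proof -
      have sa: "sqint (a s)" using L1_pathD(2)[OF A(1), of s] Aeq[OF s] by simp
      have "a s z * ?D z = of_real c * (laplacian f (fst z) * a s z * g (snd z)) + of_real d * (f (fst z) * a s z * laplacian g (snd z))" for z
        unfolding lap_tensor[OF f g] by (simp add: case_prod_beta algebra_simps)
      then show ?thesis
        unfolding pairing_def bpair_def Aeq[OF s]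
        using bilinear_integral_swap(1)[OF sq(3,2) sa] bilinear_integral_swap(1)[OF sq(1,4) sa] by simp
    qed
    have main: "\<i> * (pairing (a t) ?\<psi> - pairing (a 0) ?\<psi>)
          + (LINT s:{0..t}|lborel. pairing (a s) ?D + pairing (B s) ?\<psi>)
        = (LINT s:{0..t}|lborel. pairing (S s) ?\<psi>)"
      by (rule we[unfolded weak_evolution_def, THEN conjunct2, THEN conjunct2, THEN conjunct2,
            THEN spec, THEN mp, OF test_fun_tensor[OF f g], THEN bspec, OF t])
    have mpsi: "?\<psi> \<in> borel_measurable borel" using sqint_tensor(1)[OF sq(1,2)] by (rule sqint_measurable)
    let ?X = "\<lambda>s. of_real c * bpair (\<lambda>z. A (s, z)) (laplacian f) g + of_real d * bpair (\<lambda>z. A (s, z)) f (laplacian g)"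
    have i: "set_integrable lborel {0..t} ?X"
      "set_integrable lborel {0..t} (\<lambda>s. bpair (\<lambda>z. B' (s, z)) f g)" "set_integrable lborel {0..t} (\<lambda>s. bpair (\<lambda>z. S' (s, z)) f g)"
      by (intro set_integral_add(1) set_integrable_mult_right bpair_path_integrable A B' S' sq)+
    have tT: "t \<le> T" using t by simp
    have Weq: "AE s in lborel. indicator {0..t} s *\<^sub>R pairing (W s) ?\<psi> = indicator {0..t} s *\<^sub>R bpair (\<lambda>z. W' (s, z)) f g"
      if "AE s in lborel. s \<in> {0..T} \<longrightarrow> sqint (W s) \<and> (\<forall>z. W' (s, z) = W s z)" for W W'
      using that
    proof eventually_elim
      case (elim s)
      show ?case
      proof (cases "s \<in> {0..t}")
        case True
        with elim tT have "(\<lambda>z. W' (s, z)) = W s" by (auto simp: fun_eq_iff)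
        then show ?thesis by (simp add: bpair_eq_pairing)
      qed simp
    qed
    have e1: "(LINT s:{0..t}|lborel. pairing (a s) ?D + pairing (B s) ?\<psi>)
      = (LINT s:{0..t}|lborel. ?X s + bpair (\<lambda>z. B' (s, z)) f g)"
      unfolding set_lebesgue_integral_def
    proof (rule integral_cong_AE)
      have eqX: "indicator {0..t} s *\<^sub>R (pairing (a s) ?D + pairing (B s) ?\<psi>)
          = indicator {0..t} s *\<^sub>R ?X s + indicator {0..t} s *\<^sub>R pairing (B s) ?\<psi>" for s
        using D[of s] tT by (cases "s \<in> {0..t}") auto
      show "(\<lambda>s. indicator {0..t} s *\<^sub>R (pairing (a s) ?D + pairing (B s) ?\<psi>)) \<in> borel_measurable lborel"
        unfolding eqX using i(1) pairing_path_measurable[OF _ mpsi tT, of B] w(2)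
        by (intro borel_measurable_add) (auto simp: set_integrable_def L1_L2_def)
      show "(\<lambda>s. indicator {0..t} s *\<^sub>R (?X s + bpair (\<lambda>z. B' (s, z)) f g)) \<in> borel_measurable lborel"
        using set_integral_add(1)[OF i(1,2)] unfolding set_integrable_def by (rule borel_measurable_integrable)
      show "AE s in lborel. indicator {0..t} s *\<^sub>R (pairing (a s) ?D + pairing (B s) ?\<psi>)
        = indicator {0..t} s *\<^sub>R (?X s + bpair (\<lambda>z. B' (s, z)) f g)"
        using Weq[OF B'(2)] unfolding eqX by eventually_elim (simp add: scaleR_add_right)
    qed
    have e2: "(LINT s:{0..t}|lborel. pairing (S s) ?\<psi>) = (LINT s:{0..t}|lborel. bpair (\<lambda>z. S' (s, z)) f g)"
      unfolding set_lebesgue_integral_def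
    proof (rule integral_cong_AE[OF _ _ Weq[OF S'(2)]])
      show "(\<lambda>s. indicator {0..t} s *\<^sub>R pairing (S s) ?\<psi>) \<in> borel_measurable lborel"
        using pairing_path_measurable[OF _ mpsi tT, of S] w(3) by (simp add: L1_L2_def)
      show "(\<lambda>s. indicator {0..t} s *\<^sub>R bpair (\<lambda>z. S' (s, z)) f g) \<in> borel_measurable lborel"
        using i(3) unfolding set_integrable_def by (rule borel_measurable_integrable)
    qed
    have "bpair (\<lambda>z. S' (s, z) - B' (s, z)) f g = bpair (\<lambda>z. S' (s, z)) f g - bpair (\<lambda>z. B' (s, z)) f g" for s
      by (intro bpair_add L1_pathD(2) S' B' sq)
    then have D': "(LINT s:{0..t}|lborel. bpair (\<lambda>z. S' (s, z) - B' (s, z)) f g - ?X s)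
      = (LINT s:{0..t}|lborel. bpair (\<lambda>z. S' (s, z)) f g) - (LINT s:{0..t}|lborel. ?X s + bpair (\<lambda>z. B' (s, z)) f g)"
      using set_integral_diff(2)[OF set_integral_diff(1)[OF i(3,2)] i(1)] set_integral_diff(2)[OF i(3,2)] set_integral_add(2)[OF i(1,2)]
      by simp
    have "0 \<in> {0..T}" using T by simp
    then have bp: "bpair (\<lambda>z. A (t, z)) f g = pairing (a t) ?\<psi>" "bpair (\<lambda>z. A (0, z)) f g = pairing (a 0) ?\<psi>"
      unfolding bpair_eq_pairing Aeq[OF t] by (simp_all add: Aeq)
    show "\<i> * (bpair (\<lambda>z. A (t, z)) f g - bpair (\<lambda>z. A (0, z)) f g)
      = (LINT s:{0..t}|lborel. bpair (\<lambda>z. S' (s, z) - B' (s, z)) f g - ?X s)"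
      using main unfolding e1 e2 D' bp by (simp only: eq_diff_eq)
  qed
  have ae: "AE s in lborel. s \<in> {0..T} \<longrightarrow> sqint (B s) \<and> sqint (S s) \<and> (\<forall>z. S' (s, z) - B' (s, z) = S s z - B s z)"
    using B'(2) S'(2) by eventually_elim auto
  show thesis by (rule that[OF W A(3) ae])
qed

section \<open>Products of weak solutions\<close>

lemma wsolD:
  assumes "wsol T c d A F"
  shows "L1_path A" "L1_path F" "\<exists>C. \<forall>s. l2n (\<lambda>z. A (s, z)) \<le> C"
    "compact_smooth f \<Longrightarrow> compact_smooth g \<Longrightarrow> t \<in> {0..T} \<Longrightarrow>
      \<i> * (bpair (\<lambda>z. A (t, z)) f g - bpair (\<lambda>z. A (0, z)) f g)
      = (LINT s:{0..t}|lborel. bpair (\<lambda>z. F (s, z)) f g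
          - (of_real c * bpair (\<lambda>z. A (s, z)) (laplacian f) g + of_real d * bpair (\<lambda>z. A (s, z)) f (laplacian g)))"
  using assms unfolding wsol_def wform_def by blast+

lemma compact_smooth_cnj:
  assumes "compact_smooth f"
  shows "compact_smooth (\<lambda>x. cnj (f x))" "laplacian (\<lambda>x. cnj (f x)) x = cnj (laplacian f x)"
proof -
  show "compact_smooth (\<lambda>x. cnj (f x))"
    using assms Ck_on_linear[OF bounded_linear_cnj] by (auto simp: compact_smooth_def smooth_on_def)
  obtain f1 f2 where f: "\<And>b x s. ((\<lambda>r. f (x + r *\<^sub>R b)) has_vector_derivative f1 b (x + s *\<^sub>R b)) (at s)"
    "\<And>b x s. ((\<lambda>r. f1 b (x + r *\<^sub>R b)) has_vector_derivative f2 b (x + s *\<^sub>R b)) (at s)"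
    using smooth_second_derivatives[of f] assms unfolding compact_smooth_def by metis
  have "laplacian (\<lambda>x. cnj (f x)) x = (\<Sum>b\<in>Basis. cnj (f2 b x))"
    by (rule laplacian_eqI[where ?f1.0 = "\<lambda>b x. cnj (f1 b x)"]) (intro has_vector_derivative_cnj f)+
  then show "laplacian (\<lambda>x. cnj (f x)) x = cnj (laplacian f x)"
    by (simp add: laplacian_eqI[OF f])
qed

lemma bpair_cnj: "bpair (\<lambda>z. cnj (a z)) f g = cnj (bpair a (\<lambda>x. cnj (f x)) (\<lambda>x. cnj (g x)))"
  unfolding bpair_def Bochner_Integration.integral_cnj[symmetric] by simp

lemma set_integral_neg_cnj:
  "(LINT s:X|M. - cnj (h s)) = - cnj (LINT s:X|M. h s)"
proof -
  have "(\<lambda>s. indicator X s *\<^sub>R - cnj (h s)) = (\<lambda>s. - cnj (indicator X s *\<^sub>R h s))"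
    by (simp add: fun_eq_iff)
  then show ?thesis
    unfolding set_lebesgue_integral_def
    by (simp only: Bochner_Integration.integral_minus Bochner_Integration.integral_cnj)
qed

text \<open>Conjugation turns i into -i; after multiplication by -1 the time derivative is as
  before, while the signs of both Laplacians and of the source are reversed.\<close>

lemma wsol_cnj:
  assumes w: "wsol T c d A F"
  shows "wsol T (- c) (- d) (\<lambda>y. cnj (A y)) (\<lambda>y. - cnj (F y))"
  unfolding wsol_def wform_def
proof (intro conjI allI impI L1_path_cnj wsolD(1)[OF w])
  show "L1_path (\<lambda>y. - cnj (F y))"
    using L1_path_cmult[OF L1_path_cnj[OF wsolD(2)[OF w]], of "- 1"] by simp
  show "\<exists>C. \<forall>s. l2n (\<lambda>z. cnj (A (s, z))) \<le> C" using wsolD(3)[OF w] by simp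
  fix f g :: "real^3 \<Rightarrow> complex" and t
  assume f: "compact_smooth f" and g: "compact_smooth g" and t: "t \<in> {0..T}"
  let ?f = "\<lambda>x. cnj (f x)" and ?g = "\<lambda>x. cnj (g x)"
  have lap: "laplacian ?f = (\<lambda>x. cnj (laplacian f x))" "laplacian ?g = (\<lambda>x. cnj (laplacian g x))"
    using compact_smooth_cnj(2)[OF f] compact_smooth_cnj(2)[OF g] by auto
  have neg: "bpair (\<lambda>z. - cnj (F (s, z))) f g = - bpair (\<lambda>z. cnj (F (s, z))) f g" for s
    using bpair_cmult[of "- 1"] by simp
  let ?H = "\<lambda>s. bpair (\<lambda>z. F (s, z)) ?f ?g - (of_real c * bpair (\<lambda>z. A (s, z)) (laplacian ?f) ?g + of_real d * bpair (\<lambda>z. A (s, z)) ?f (laplacian ?g))"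
  have "\<i> * (bpair (\<lambda>z. cnj (A (t, z))) f g - bpair (\<lambda>z. cnj (A (0, z))) f g)
      = - cnj (\<i> * (bpair (\<lambda>z. A (t, z)) ?f ?g - bpair (\<lambda>z. A (0, z)) ?f ?g))"
    by (simp add: bpair_cnj)
  also have "\<dots> = - cnj (LINT s:{0..t}|lborel. ?H s)"
    using wsolD(4)[OF w compact_smooth_cnj(1)[OF f] compact_smooth_cnj(1)[OF g] t] by simp
  also have "\<dots> = (LINT s:{0..t}|lborel. - cnj (?H s))"
    by (rule set_integral_neg_cnj[symmetric])
  also have "\<dots> = (LINT s:{0..t}|lborel. bpair (\<lambda>z. - cnj (F (s, z))) f g
          - (of_real (- c) * bpair (\<lambda>z. cnj (A (s, z))) (laplacian f) g + of_real (- d) * bpair (\<lambda>z. cnj (A (s, z))) f (laplacian g)))"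
    by (simp add: neg bpair_cnj lap algebra_simps)
  finally show "\<i> * (bpair (\<lambda>z. cnj (A (t, z))) f g - bpair (\<lambda>z. cnj (A (0, z))) f g)
      = (LINT s:{0..t}|lborel. bpair (\<lambda>z. - cnj (F (s, z))) f g
          - (of_real (- c) * bpair (\<lambda>z. cnj (A (s, z))) (laplacian f) g + of_real (- d) * bpair (\<lambda>z. cnj (A (s, z))) f (laplacian g)))" .
qed

text \<open>Testing a kernel in its first variable leaves a function of the second;
  \<open>ract\<close> below is the mirror image. In a composition this isolates the contracted
  variable.\<close>

definition lact :: "('a::euclidean_space \<Rightarrow> complex) \<Rightarrow> ('a \<times> 'b::euclidean_space \<Rightarrow> complex) \<Rightarrow> 'b \<Rightarrow> complex" where
  "lact f a y = (\<integral>x. f x * a (x, y) \<partial>lborel)"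

lemma lact_bound:
  assumes f: "sqint f" and a: "sqint a"
  shows "sqint (lact f a)" "l2n (lact f a) \<le> l2n f * l2n a"
proof -
  have [measurable]: "f \<in> borel_measurable borel" "a \<in> borel_measurable borel"
    using assms by (auto simp: sqint_def)
  have m: "lact f a \<in> borel_measurable borel" unfolding lact_def[abs_def] by measurable
  define \<beta> where "\<beta> y = (\<integral>\<^sup>+x. ennreal ((cmod (a (x, y)))\<^sup>2) \<partial>lborel)" for y
  have [measurable]: "\<beta> \<in> borel_measurable borel" unfolding \<beta>_def by measurable
  have "ennreal ((cmod (lact f a y))\<^sup>2) \<le> ennreal ((l2n f)\<^sup>2) * \<beta> y" for y
  proof -
    have "ennreal (cmod (lact f a y)) \<le> (\<integral>\<^sup>+x. ennreal (cmod (f x) * cmod (a (x, y))) \<partial>lborel)"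
      using norm_integral_le_nn[of lborel "\<lambda>x. f x * a (x, y)"] by (simp add: lact_def norm_mult)
    then have "ennreal (cmod (lact f a y)) ^ 2 \<le> (\<integral>\<^sup>+x. ennreal (cmod (f x) * cmod (a (x, y))) \<partial>lborel) ^ 2"
      by (rule power_mono) simp
    also have "\<dots> \<le> ennreal ((l2n f)\<^sup>2) * \<beta> y"
      unfolding \<beta>_def nn_l2n[OF f, symmetric] by (rule nn_cauchy_schwarz) measurable
    finally show ?thesis by (simp add: ennreal_power)
  qed
  then have "(\<integral>\<^sup>+y. ennreal ((cmod (lact f a y))\<^sup>2) \<partial>lborel) \<le> (\<integral>\<^sup>+y. ennreal ((l2n f)\<^sup>2) * \<beta> y \<partial>lborel)"
    by (intro nn_integral_mono)
  also have "\<dots> = ennreal ((l2n f)\<^sup>2) * (\<integral>\<^sup>+y. \<beta> y \<partial>lborel)"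
    by (simp add: nn_integral_cmult)
  also have "(\<integral>\<^sup>+y. \<beta> y \<partial>lborel) = ennreal ((l2n a)\<^sup>2)"
    unfolding \<beta>_def nn_l2n[OF a, symmetric] by (rule nn_integral_lborel_pair_swap[symmetric]) measurable
  finally have "(\<integral>\<^sup>+y. ennreal ((cmod (lact f a y))\<^sup>2) \<partial>lborel) \<le> ennreal ((l2n f * l2n a)\<^sup>2)"
    by (simp add: ennreal_mult power_mult_distrib)
  from l2n_le_of_nn[OF this _ m] show "sqint (lact f a)" "l2n (lact f a) \<le> l2n f * l2n a" by auto
qed

definition ract :: "('a::euclidean_space \<times> 'b::euclidean_space \<Rightarrow> complex) \<Rightarrow> ('b \<Rightarrow> complex) \<Rightarrow> 'a \<Rightarrow> complex" where
  "ract a g x = (\<integral>y. a (x, y) * g y \<partial>lborel)"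

lemma ract_lact: "ract a g = lact g (\<lambda>z. a (prod.swap z))"
  by (simp add: ract_def lact_def fun_eq_iff mult.commute)

lemma ract_bound:
  assumes g: "sqint g" and a: "sqint a"
  shows "sqint (ract a g)" "l2n (ract a g) \<le> l2n g * l2n a"
  using lact_bound[OF g sqint_swap[OF a]] l2n_swap[OF sqint_measurable[OF a]] by (simp_all add: ract_lact)

lemma bpair_lact_ract:
  assumes "sqint f" "sqint a" "sqint g"
  shows "(\<integral>y. lact f a y * g y \<partial>lborel) = bpair a f g" "(\<integral>x. f x * ract a g x \<partial>lborel) = bpair a f g"
  using bilinear_integral_swap(2,3)[OF assms(1,3,2)] by (simp_all add: bpair_def lact_def ract_def)

text \<open>A composition tested from both sides is a pairing of two functions of the contracted
  variable, so a product rule for functions on the three-dimensional space covers products of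
  kernels.\<close>

lemma bpair_kcomp:
  assumes f: "sqint f" and a: "sqint a" and b: "sqint b" and g: "sqint g"
  shows "bpair (a \<odot> b) f g = (\<integral>z. lact f a z * ract b g z \<partial>lborel)"
proof -
  have m [measurable]: "a \<in> borel_measurable borel" "b \<in> borel_measurable borel" "f \<in> borel_measurable borel" "g \<in> borel_measurable borel"
    using assms by (auto simp: sqint_def)
  have [measurable]: "ract b g \<in> borel_measurable borel" "a \<odot> b \<in> borel_measurable borel" "ract (a \<odot> b) g \<in> borel_measurable borel"
    "ract a (ract b g) \<in> borel_measurable borel"
    using ract_bound(1)[OF g b] ract_bound(1)[OF g sqint_kcomp[OF a b]] ract_bound(1)[OF ract_bound(1)[OF g b] a]
    by (auto simp: sqint_def)
  have "AE x in lborel. ract (a \<odot> b) g x = ract a (ract b g) x"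
    using AE_sqint_section[OF a]
  proof eventually_elim
    case (elim x)
    show ?case unfolding ract_def kcomp_def
      using bilinear_integral_swap(2,3)[OF elim g b] by simp
  qed
  then have "(\<integral>x. f x * ract (a \<odot> b) g x \<partial>lborel) = (\<integral>x. f x * ract a (ract b g) x \<partial>lborel)"
    by (intro integral_cong_AE) (measurable, auto)
  then show ?thesis
    using bpair_lact_ract(2)[OF f sqint_kcomp[OF a b] g] bpair_lact_ract[OF f a ract_bound(1)[OF g b]] by simp
qed

text \<open>Mollifying in the contracted variable amounts to testing the kernel with a product of f
  and a translated mollifier, which the weak equation admits.\<close>

lemma mol_lact:
  assumes "sqint f" "sqint a" "sqint \<sigma>"
  shows "mol \<sigma> (lact f a) w = bpair a f (\<lambda>z. \<sigma> (z - w))"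
    and "mol \<sigma> (ract a f) w = bpair a (\<lambda>z. \<sigma> (z - w)) f"
proof -
  have s: "sqint (\<lambda>z. \<sigma> (z - w))" using sqint_shift[OF assms(3), of "- w"] by simp
  show "mol \<sigma> (lact f a) w = bpair a f (\<lambda>z. \<sigma> (z - w))"
    unfolding mol_def using bpair_lact_ract(1)[OF assms(1,2) s] .
  show "mol \<sigma> (ract a f) w = bpair a (\<lambda>z. \<sigma> (z - w)) f"
    unfolding mol_def using bpair_lact_ract(2)[OF s assms(2,1)] by (simp add: mult.commute)
qed

lemma L1_path_lact:
  assumes f: "sqint f" and P: "L1_path P"
  shows "L1_path (\<lambda>(s, y). lact f (\<lambda>z. P (s, z)) y)" "L1_path (\<lambda>(s, y). ract (\<lambda>z. P (s, z)) f y)"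
proof -
  have [measurable]: "P \<in> borel_measurable borel" "f \<in> borel_measurable borel"
    using L1_pathD(1)[OF P] f by (auto simp: sqint_def)
  have i: "integrable lborel (\<lambda>s. l2n f * l2n (\<lambda>z. P (s, z)))" using L1_pathD(3)[OF P] by simp
  show "L1_path (\<lambda>(s, y). lact f (\<lambda>z. P (s, z)) y)"
  proof (rule L1_path_bound[OF _ _ i])
    have "(\<lambda>v. \<integral>x. f x * P (fst v, (x, snd v)) \<partial>lborel) \<in> borel_measurable borel" by measurable
    then show "(\<lambda>(s, y). lact f (\<lambda>z. P (s, z)) y) \<in> borel_measurable borel"
      by (simp add: lact_def case_prod_beta')
  qed (use lact_bound[OF f L1_pathD(2)[OF P]] in simp_all)
  show "L1_path (\<lambda>(s, y). ract (\<lambda>z. P (s, z)) f y)"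
  proof (rule L1_path_bound[OF _ _ i])
    have "(\<lambda>v. \<integral>y. P (fst v, (snd v, y)) * f y \<partial>lborel) \<in> borel_measurable borel" by measurable
    then show "(\<lambda>(s, y). ract (\<lambda>z. P (s, z)) f y) \<in> borel_measurable borel"
      by (simp add: ract_def case_prod_beta')
  qed (use ract_bound[OF f L1_pathD(2)[OF P]] in simp_all)
qed

lemma mol_add_cmult:
  assumes "sqint A" "sqint B" "sqint \<sigma>"
  shows "mol \<sigma> (\<lambda>x. A x - c * B x) w = mol \<sigma> A w - c * mol \<sigma> B w"
proof -
  have s: "sqint (\<lambda>z. \<sigma> (z - w))" using sqint_shift[OF assms(3), of "- w"] by simp
  have "mol \<sigma> (\<lambda>x. A x - c * B x) w = (\<integral>z. A z * \<sigma> (z - w) - c * (B z * \<sigma> (z - w)) \<partial>lborel)"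
    unfolding mol_def by (simp add: algebra_simps)
  also have "\<dots> = mol \<sigma> A w - c * mol \<sigma> B w"
    unfolding mol_def using sqint_mult_integrable[OF assms(1) s] sqint_mult_integrable[OF assms(2) s] by simp
  finally show ?thesis .
qed

lemma mol_cmult_left: "mol (\<lambda>x. c * \<sigma> x) A w = c * mol \<sigma> A w"
  unfolding mol_def by (simp add: mult.left_commute)

text \<open>The coefficient at the second variable of A is opposite to that at the first variable of
  B, so the Laplacians in the contracted variable cancel in \<open>weak_product_rule\<close>. Those
  in the outer variables survive and act on f and g.\<close>

lemma wsol_product:
  assumes a: "wsol T c d A F" and b: "wsol T (- d) e B G"
    and f: "compact_smooth f" and g: "compact_smooth g" and t: "t \<in> {0..T}"
  defines "AB \<equiv> \<lambda>s. (\<lambda>z. A (s, z)) \<odot> (\<lambda>z. B (s, z))"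
  shows "\<i> * (bpair (AB t) f g - bpair (AB 0) f g)
    = (LINT s:{0..t}|lborel. bpair ((\<lambda>z. F (s, z)) \<odot> (\<lambda>z. B (s, z))) f g + bpair ((\<lambda>z. A (s, z)) \<odot> (\<lambda>z. G (s, z))) f g
        - (of_real c * bpair (AB s) (laplacian f) g + of_real e * bpair (AB s) f (laplacian g)))"
proof -
  obtain \<eta> :: "nat \<Rightarrow> real^3 \<Rightarrow> complex" where \<eta>: "mollifier \<eta>" using mollifier_exists by blast
  have sq: "sqint f" "sqint g" "sqint (laplacian f)" "sqint (laplacian g)"
    using f g by (auto intro: compact_smooth_sqint laplacian_integrable)
  note LA = wsolD(1)[OF a] and LF = wsolD(2)[OF a] and LB = wsolD(1)[OF b] and LG = wsolD(2)[OF b]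
  note sA = L1_pathD(2)[OF LA] and sF = L1_pathD(2)[OF LF] and sB = L1_pathD(2)[OF LB] and sG = L1_pathD(2)[OF LG]
  obtain CA where CA: "\<And>s. l2n (\<lambda>z. A (s, z)) \<le> CA" using wsolD(3)[OF a] by blast
  obtain CB where CB: "\<And>s. l2n (\<lambda>z. B (s, z)) \<le> CB" using wsolD(3)[OF b] by blast
  define A' where "A' = (\<lambda>(s, y). lact f (\<lambda>z. A (s, z)) y)"
  define B' where "B' = (\<lambda>(s, y). ract (\<lambda>z. B (s, z)) g y)"
  \<comment> \<open>The outer Laplacian falls on the fixed test function and produces no derivative
    of a mollifier, so it can be counted as part of the source.\<close>
  define F' where "F' y = (\<lambda>(s, y). lact f (\<lambda>z. F (s, z)) y) y - of_real c * (\<lambda>(s, y). lact (laplacian f) (\<lambda>z. A (s, z)) y) y" for y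
  define G' where "G' y = (\<lambda>(s, y). ract (\<lambda>z. G (s, z)) g y) y - of_real e * (\<lambda>(s, y). ract (\<lambda>z. B (s, z)) (laplacian g) y) y" for y
  have LA': "L1_path A'" and LB': "L1_path B'" unfolding A'_def B'_def by (intro L1_path_lact sq LA LB)+
  have LF': "L1_path F'" and LG': "L1_path G'"
    unfolding F'_def[abs_def] G'_def[abs_def] by (intro L1_path_diff L1_path_cmult L1_path_lact sq LA LB LF LG)+
  have eA: "(\<lambda>x. A' (s, x)) = lact f (\<lambda>z. A (s, z))" and eB: "(\<lambda>x. B' (s, x)) = ract (\<lambda>z. B (s, z)) g"
    and eF: "(\<lambda>x. F' (s, x)) = (\<lambda>x. lact f (\<lambda>z. F (s, z)) x - of_real c * lact (laplacian f) (\<lambda>z. A (s, z)) x)"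
    and eG: "(\<lambda>x. G' (s, x)) = (\<lambda>x. ract (\<lambda>z. G (s, z)) g x - of_real e * ract (\<lambda>z. B (s, z)) (laplacian g) x)" for s
    by (simp_all add: A'_def B'_def F'_def G'_def)
  note csn = mollifierD(1)[OF \<eta>]
  have csw: "compact_smooth (\<lambda>z. \<eta> n (z - w))" for n w by (rule compact_smooth_shift[OF csn])
  \<comment> \<open>Only the Laplacian in the contracted variable reaches the mollifier. The
    coefficient -d of B produces the opposite sign in its equation.\<close>
  define \<zeta> where "\<zeta> n z = of_real d * laplacian (\<eta> n) z" for n and z :: "real^3"
  have lapw: "laplacian (\<lambda>z. \<eta> n (z - w)) = (\<lambda>z. laplacian (\<eta> n) (z - w))" for n w
    by (simp add: fun_eq_iff laplacian_shift)
  have sl: "sqint (laplacian (\<eta> n))" for n by (rule laplacian_integrable(2)[OF csn])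
  have sn: "sqint (\<eta> n)" for n by (rule mollifierD(7)[OF \<eta>])
  have mz: "mol (\<zeta> n) X w = of_real d * mol (laplacian (\<eta> n)) X w" for n X w
    unfolding \<zeta>_def[abs_def] by (rule mol_cmult_left)
  have main: "\<i> * ((\<integral>x. A' (t, x) * B' (t, x) \<partial>lborel) - (\<integral>x. A' (0, x) * B' (0, x) \<partial>lborel))
    = (LINT s:{0..t}|lborel. (\<integral>x. F' (s, x) * B' (s, x) \<partial>lborel) + (\<integral>x. A' (s, x) * G' (s, x) \<partial>lborel))"
  proof (rule weak_product_rule[OF \<eta>, where \<zeta> = \<zeta> and CA = "l2n f * CA" and CB = "l2n g * CB" and T = T])
    show "integrable lborel (\<zeta> n)" "sqint (\<zeta> n)" for n
      unfolding \<zeta>_def[abs_def] using laplacian_integrable[OF csn, of n] by (auto intro: sqint_cmult)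
    show "\<zeta> n (- x) = \<zeta> n x" for n x
      unfolding \<zeta>_def using laplacian_even[of "\<eta> n" x] mollifierD(2)[OF \<eta>] csn[of n] by (simp add: compact_smooth_def)
    show "A' \<in> borel_measurable borel" "B' \<in> borel_measurable borel" "F' \<in> borel_measurable borel" "G' \<in> borel_measurable borel"
      by (rule L1_pathD(1), fact)+
    show "sqint (\<lambda>x. A' (s, x))" "sqint (\<lambda>x. B' (s, x))" "sqint (\<lambda>x. F' (s, x))" "sqint (\<lambda>x. G' (s, x))" for s
      by (rule L1_pathD(2), fact)+
    show "integrable lborel (\<lambda>s. l2n (\<lambda>x. F' (s, x)))" "integrable lborel (\<lambda>s. l2n (\<lambda>x. G' (s, x)))"
      by (rule L1_pathD(3), fact)+
    show "l2n (\<lambda>x. A' (s, x)) \<le> l2n f * CA" for s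
      unfolding eA by (rule order_trans[OF lact_bound(2)[OF sq(1) sA]]) (intro mult_left_mono CA l2n_nonneg)
    show "l2n (\<lambda>x. B' (s, x)) \<le> l2n g * CB" for s
      unfolding eB by (rule order_trans[OF ract_bound(2)[OF sq(2) sB]]) (intro mult_left_mono CB l2n_nonneg)
    show "t \<in> {0..T}" by fact
    fix n w r assume r: "r \<in> {0..T}"
    show "\<i> * (mol (\<eta> n) (\<lambda>x. A' (r, x)) w - mol (\<eta> n) (\<lambda>x. A' (0, x)) w)
      = (LINT s:{0..r}|lborel. mol (\<eta> n) (\<lambda>x. F' (s, x)) w - mol (\<zeta> n) (\<lambda>x. A' (s, x)) w)"
      unfolding eA eF mz mol_add_cmult[OF lact_bound(1)[OF sq(1) sF] lact_bound(1)[OF sq(3) sA] sn]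
        mol_lact(1)[OF sq(1) sA sn] mol_lact(1)[OF sq(1) sF sn] mol_lact(1)[OF sq(3) sA sn] mol_lact(1)[OF sq(1) sA sl]
      using wsolD(4)[OF a f csw r, of n w] unfolding lapw by (simp add: algebra_simps)
    show "\<i> * (mol (\<eta> n) (\<lambda>x. B' (r, x)) w - mol (\<eta> n) (\<lambda>x. B' (0, x)) w)
      = (LINT s:{0..r}|lborel. mol (\<eta> n) (\<lambda>x. G' (s, x)) w + mol (\<zeta> n) (\<lambda>x. B' (s, x)) w)"
      unfolding eB eG mz mol_add_cmult[OF ract_bound(1)[OF sq(2) sG] ract_bound(1)[OF sq(4) sB] sn]
        mol_lact(2)[OF sq(2) sB sn] mol_lact(2)[OF sq(2) sG sn] mol_lact(2)[OF sq(4) sB sn] mol_lact(2)[OF sq(2) sB sl]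
      using wsolD(4)[OF b csw g r, of n w] unfolding lapw by (simp add: algebra_simps)
  qed
  have p1: "(\<integral>x. A' (s, x) * B' (s, x) \<partial>lborel) = bpair (AB s) f g" for s
    unfolding AB_def bpair_kcomp[OF sq(1) sA sB sq(2)] by (simp only: eA[of s, THEN fun_cong] eB[of s, THEN fun_cong])
  have p2: "(\<integral>x. F' (s, x) * B' (s, x) \<partial>lborel) = bpair ((\<lambda>z. F (s, z)) \<odot> (\<lambda>z. B (s, z))) f g - of_real c * bpair (AB s) (laplacian f) g" for s
  proof -
    have i: "integrable lborel (\<lambda>x. lact f (\<lambda>z. F (s, z)) x * ract (\<lambda>z. B (s, z)) g x)"
      "integrable lborel (\<lambda>x. lact (laplacian f) (\<lambda>z. A (s, z)) x * ract (\<lambda>z. B (s, z)) g x)"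
      by (intro sqint_mult_integrable lact_bound ract_bound sq sA sF sB)+
    have "F' (s, x) * B' (s, x) = lact f (\<lambda>z. F (s, z)) x * ract (\<lambda>z. B (s, z)) g x
        - of_real c * (lact (laplacian f) (\<lambda>z. A (s, z)) x * ract (\<lambda>z. B (s, z)) g x)" for x
      by (simp add: F'_def B'_def algebra_simps)
    then show ?thesis
      unfolding AB_def bpair_kcomp[OF sq(1) sF sB sq(2)] bpair_kcomp[OF sq(3) sA sB sq(2)] using i by simp
  qed
  have p3: "(\<integral>x. A' (s, x) * G' (s, x) \<partial>lborel) = bpair ((\<lambda>z. A (s, z)) \<odot> (\<lambda>z. G (s, z))) f g - of_real e * bpair (AB s) f (laplacian g)" for s
  proof -
    have i: "integrable lborel (\<lambda>x. lact f (\<lambda>z. A (s, z)) x * ract (\<lambda>z. G (s, z)) g x)"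
      "integrable lborel (\<lambda>x. lact f (\<lambda>z. A (s, z)) x * ract (\<lambda>z. B (s, z)) (laplacian g) x)"
      by (intro sqint_mult_integrable lact_bound ract_bound sq sA sG sB)+
    have "A' (s, x) * G' (s, x) = lact f (\<lambda>z. A (s, z)) x * ract (\<lambda>z. G (s, z)) g x
        - of_real e * (lact f (\<lambda>z. A (s, z)) x * ract (\<lambda>z. B (s, z)) (laplacian g) x)" for x
      by (simp add: A'_def G'_def algebra_simps)
    then show ?thesis
      unfolding AB_def bpair_kcomp[OF sq(1) sA sG sq(2)] bpair_kcomp[OF sq(1) sA sB sq(4)] using i by simp
  qed
  show ?thesis using main unfolding p1 p2 p3 by (simp add: algebra_simps)
qed

lemma mollifier_tensor:
  assumes \<eta>: "mollifier (\<eta> :: nat \<Rightarrow> real^3 \<Rightarrow> complex)"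
  shows "mollifier (\<lambda>n z. \<eta> (2 * n + 1) (fst z) * \<eta> (2 * n + 1) (snd z))"
  unfolding mollifier_def
proof (intro allI conjI impI)
  fix n and z :: "(real^3) \<times> (real^3)"
  let ?e = "\<eta> (2 * n + 1)"
  note cs = mollifierD(1)[OF \<eta>, of "2 * n + 1"]
  have supp: "?e (fst z) * ?e (snd z) = 0" if "1 / real (Suc n) \<le> norm z" for z :: "(real^3) \<times> (real^3)"
  proof -
    \<comment> \<open>The index 2n + 1 gives each factor half the radius 1/(n + 1); a point of at
      least the full radius then has a component outside the support of its factor.\<close>
    have half: "1 / real (Suc n) = 2 * (1 / real (Suc (2 * n + 1)))" by (simp add: field_simps)
    have "norm z \<le> norm (fst z) + norm (snd z)" using norm_Pair_le[of "fst z" "snd z"] by simp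
    then have "1 / real (Suc (2 * n + 1)) \<le> norm (fst z) \<or> 1 / real (Suc (2 * n + 1)) \<le> norm (snd z)"
      using that unfolding half by linarith
    then show ?thesis using mollifierD(3)[OF \<eta>] by auto
  qed
  show "?e (fst z) * ?e (snd z) = 0" if "1 / real (Suc n) \<le> norm z" by (rule supp[OF that])
  have "Ck_on k UNIV (\<lambda>z :: (real^3) \<times> (real^3). ?e (fst z) * ?e (snd z))" for k
    using cs Ck_on_compose_affine[OF bounded_linear_fst, of k ?e 0]
      Ck_on_compose_affine[OF bounded_linear_snd, of k ?e 0]
    by (intro Ck_on_mult) (auto simp: compact_smooth_def smooth_on_def)
  then show "compact_smooth (\<lambda>z :: (real^3) \<times> (real^3). ?e (fst z) * ?e (snd z))"
    unfolding compact_smooth_def smooth_on_def using supp less_imp_le by blast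
  show "?e (fst (- z)) * ?e (snd (- z)) = ?e (fst z) * ?e (snd z)"
    using mollifierD(2)[OF \<eta>] by simp
  show "?e (fst z) * ?e (snd z) = complex_of_real (cmod (?e (fst z) * ?e (snd z)))"
  proof -
    have r: "?e x = complex_of_real (cmod (?e x))" for x using \<eta> unfolding mollifier_def by blast
    show ?thesis unfolding norm_mult of_real_mult r[symmetric] ..
  qed
  show "(\<integral>z. ?e (fst z) * ?e (snd z) \<partial>(lborel :: ((real^3) \<times> (real^3)) measure)) = 1"
    using integrable_tensor(2)[OF mollifierD(5)[OF \<eta>] mollifierD(5)[OF \<eta>]] mollifierD(4)[OF \<eta>] by simp
qed

lemma mol_tensor:
  "mol (\<lambda>z. f (fst z) * g (snd z)) a w = bpair a (\<lambda>x. f (x - fst w)) (\<lambda>y. g (y - snd w))"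
  by (simp add: mol_def bpair_def mult_ac)

text \<open>Half-lines \<open>{..a}\<close> are stable under intersection and generate the Borel
  sets, so by Dynkin's argument the integral vanishes over every Borel set, and with it the density
  almost everywhere.\<close>

lemma AE_zero_of_initial_integrals:
  fixes h :: "real \<Rightarrow> complex"
  assumes h: "integrable lborel h" and T: "0 \<le> T"
    and zero: "\<And>t. t \<in> {0..T} \<Longrightarrow> (LINT s:{0..t}|lborel. h s) = 0"
  shows "AE s in lborel. s \<in> {0..T} \<longrightarrow> h s = 0"
proof -
  \<comment> \<open>Cutting off outside the interval turns integrals over half-lines into the
    integrals that are assumed to vanish.\<close>
  define g where "g s = indicator {0..T} s *\<^sub>R h s" for s
  have g: "integrable lborel g"
    unfolding g_def[abs_def] by (intro integrable_mult_indicator h) simp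
  have sg: "set_integrable lborel A g" if "A \<in> sets borel" for A
    unfolding set_integrable_def by (intro integrable_mult_indicator g) (use that in simp)
  have cut: "(LINT s:{..a}|lborel. g s) = 0" for a
  proof -
    have "indicator {..a} s *\<^sub>R g s = indicator {0..min a T} s *\<^sub>R h s" for s
      by (auto simp: g_def indicator_def)
    then have eq: "(LINT s:{..a}|lborel. g s) = (LINT s:{0..min a T}|lborel. h s)"
      by (simp add: set_lebesgue_integral_def)
    show ?thesis
    proof (cases "0 \<le> a")
      case True
      then show ?thesis using zero[of "min a T"] T unfolding eq by simp
    next
      case False
      then have "{0..min a T} = {}" by auto
      then show ?thesis unfolding eq by (simp add: set_lebesgue_integral_def)
    qed
  qed
  have UNIV0: "(LINT s:UNIV|lborel. g s) = 0"
  proof -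
    have "indicator UNIV s *\<^sub>R g s = indicator {..T} s *\<^sub>R g s" for s
      by (auto simp: g_def indicator_def)
    then show ?thesis using cut[of T] by (simp add: set_lebesgue_integral_def)
  qed
  have all: "(LINT s:A|lborel. g s) = 0" if "A \<in> sets borel" for A
  proof -
    have "Int_stable (range (\<lambda>a::real. {..a}))" by (auto simp: Int_stable_def)
    moreover have "range (\<lambda>a::real. {..a}) \<subseteq> Pow UNIV" by simp
    moreover have "A \<in> sigma_sets UNIV (range (\<lambda>a::real. {..a}))"
      using that unfolding borel_eq_atMost by simp
    ultimately show ?thesis
    proof (induction A rule: sigma_sets_induct_disjoint)
      case (basic A)
      then show ?case using cut by auto
    next
      case empty
      show ?case by (simp add: set_lebesgue_integral_def)
    next
      case (compl A)
      then have A: "A \<in> sets borel" unfolding borel_eq_atMost by simp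
      have "(LINT s:UNIV|lborel. g s) = (LINT s:A \<union> (UNIV - A)|lborel. g s)" by simp
      also have "\<dots> = (LINT s:A|lborel. g s) + (LINT s:UNIV - A|lborel. g s)"
        by (rule set_integral_Un) (use A sg in auto)
      finally show ?case using UNIV0 compl by simp
    next
      case (union A)
      then have A: "A i \<in> sets borel" for i unfolding borel_eq_atMost by auto
      have "(LINT s:(\<Union>i. A i)|lborel. g s) = (\<Sum>i. (LINT s:(A i)|lborel. g s))"
        by (rule lebesgue_integral_countable_add) (use A sg union in \<open>auto simp: disjoint_family_on_def\<close>)
      then show ?case using union by simp
    qed
  qed
  have "AE s in lborel. g s = 0"
    by (rule sigma_finite_measure.density_zero[OF sigma_finite_lborel g]) (use all in simp)
  then show ?thesis by eventually_elim (auto simp: g_def indicator_def)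
qed

text \<open>For each mollifier translate the pairing vanishes outside a null set of times that
  depends on the translate. Fubini in time and centre, and countability of the index n, give almost
  every time a mollification that vanishes at almost every centre, for all n.\<close>

lemma L1_path_zero:
  fixes Z :: "real \<times> ((real^3) \<times> (real^3)) \<Rightarrow> complex"
  assumes Z: "L1_path Z" and T: "0 \<le> T"
    and zero: "\<And>f g t. compact_smooth f \<Longrightarrow> compact_smooth g \<Longrightarrow> t \<in> {0..T} \<Longrightarrow>
      (LINT s:{0..t}|lborel. bpair (\<lambda>z. Z (s, z)) f g) = 0"
  shows "AE s in lborel. s \<in> {0..T} \<longrightarrow> (AE z in lborel. Z (s, z) = 0)"
proof -
  have [measurable]: "Z \<in> borel_measurable borel" by (rule L1_pathD(1)[OF Z])
  note sZ = L1_pathD(2)[OF Z]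
  obtain \<eta> :: "nat \<Rightarrow> real^3 \<Rightarrow> complex" where \<eta>: "mollifier \<eta>" using mollifier_exists by blast
  define e where "e n z = \<eta> (2 * n + 1) (fst z) * \<eta> (2 * n + 1) (snd z)" for n z
  have e: "mollifier e" using mollifier_tensor[OF \<eta>] unfolding e_def[abs_def] .
  have [measurable]: "e n \<in> borel_measurable borel" for n
    using mollifierD(7)[OF e] by (rule sqint_measurable)
  have mm: "(\<lambda>y. mol (e n) (\<lambda>x. Z (fst y, x)) (snd y)) \<in> borel_measurable borel" for n
    by (rule mol_path_measurable) measurable
  have pt: "AE s in lborel. s \<in> {0..T} \<longrightarrow> mol (e n) (\<lambda>x. Z (s, x)) y = 0" for n y
  proof -
    have cs: "compact_smooth (\<lambda>x. \<eta> (2 * n + 1) (x - w))" for w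
      by (rule compact_smooth_shift[OF mollifierD(1)[OF \<eta>]])
    show ?thesis unfolding e_def[abs_def] mol_tensor
      by (rule AE_zero_of_initial_integrals[OF bpair_path_integrable(1)[OF Z] T])
        (intro compact_smooth_sqint cs zero; assumption)+
  qed
  have "AE s in lborel. AE y in lborel. s \<in> {0..T} \<longrightarrow> mol (e n) (\<lambda>x. Z (s, x)) y = 0" for n
  proof -
    let ?P = "\<lambda>q :: ((real^3) \<times> (real^3)) \<times> real. snd q \<in> {0..T} \<longrightarrow> mol (e n) (\<lambda>x. Z (snd q, x)) (fst q) = 0"
    have [measurable]: "(\<lambda>q :: ((real^3) \<times> (real^3)) \<times> real. mol (e n) (\<lambda>x. Z (snd q, x)) (fst q)) \<in> borel_measurable borel"
      using measurable_compose[OF fst_snd_swap_borel(3) mm[of n]] by simp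
    have "Measurable.pred borel ?P" by measurable
    moreover have "AE y in lborel. AE s in lborel. ?P (y, s)" using pt by simp
    ultimately have "AE q in lborel. ?P q" by (rule AE_lborel_prodI)
    from AE_lborel_prodD2[OF this] show ?thesis by simp
  qed
  then have "AE s in lborel. \<forall>n. AE y in lborel. s \<in> {0..T} \<longrightarrow> mol (e n) (\<lambda>x. Z (s, x)) y = 0"
    by (intro AE_all_countable[THEN iffD2] allI)
  then show ?thesis
  proof (eventually_elim, intro impI)
    fix s assume *: "\<forall>n. AE y in lborel. s \<in> {0..T} \<longrightarrow> mol (e n) (\<lambda>x. Z (s, x)) y = 0" and s: "s \<in> {0..T}"
    \<comment> \<open>The pairing of the mollified slice with its mollified conjugate tends to the
      squared norm of the slice, and it is identically 0.\<close>
    let ?A = "\<lambda>x. Z (s, x)" and ?B = "\<lambda>x. cnj (Z (s, x))"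
    have "molpair (e n) (e n) ?A ?B = 0" for n
    proof -
      have "AE y in lborel. mol (e n) ?A y = 0" using * s by simp
      then have "AE y in lborel. mol (e n) ?A y * mol (e n) ?B y = 0" by eventually_elim simp
      then show ?thesis unfolding molpair_def by (rule integral_eq_zero_AE)
    qed
    then have "(\<lambda>n. 0) \<longlonglongrightarrow> (\<integral>x. ?A x * ?B x \<partial>lborel)"
      using molpair_tendsto[OF sZ sqint_cnj[OF sZ] e, of s s] by (simp only:)
    from LIMSEQ_unique[OF this tendsto_const] have "(\<integral>x. ?A x * ?B x \<partial>lborel) = 0" .
    then have "(l2n ?A)\<^sup>2 = 0" unfolding integral_self_cnj[symmetric] by simp
    then show "AE z in lborel. Z (s, z) = 0" using l2n_eq_0_iff[OF sZ, of s] by simp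
  qed
qed

text \<open>The product rule for the path and its conjugate with both variables contracted.
  Conjugation reverses the signs of both Laplacians, so both cancel and only the source
  contributes.\<close>

lemma wsol_energy:
  assumes w: "wsol T c d A F" and t: "t \<in> {0..T}"
  shows "(l2n (\<lambda>z. A (t, z)))\<^sup>2 - (l2n (\<lambda>z. A (0, z)))\<^sup>2
    = (LINT s:{0..t}|lborel. 2 * Im (\<integral>z. F (s, z) * cnj (A (s, z)) \<partial>lborel))"
proof -
  note w' = wsol_cnj[OF w]
  obtain \<eta> :: "nat \<Rightarrow> real^3 \<Rightarrow> complex" where \<eta>: "mollifier \<eta>" using mollifier_exists by blast
  define h where "h n = \<eta> (2 * n + 1)" for n
  define e where "e n z = h n (fst z) * h n (snd z)" for n z
  have e: "mollifier e" using mollifier_tensor[OF \<eta>] unfolding e_def[abs_def] h_def .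
  have csh: "compact_smooth (h n)" for n unfolding h_def by (rule mollifierD(1)[OF \<eta>])
  have csw: "compact_smooth (\<lambda>z. h n (z - w))" for n w by (rule compact_smooth_shift[OF csh])
  have lapw: "laplacian (\<lambda>z. h n (z - w)) = (\<lambda>z. laplacian (h n) (z - w))" for n w
    by (simp add: fun_eq_iff laplacian_shift)
  have hev: "h n (- z) = h n z" for n z unfolding h_def by (rule mollifierD(2)[OF \<eta>])
  have lev: "laplacian (h n) (- z) = laplacian (h n) z" for n z
    using laplacian_even[of "h n" z] hev csh[of n] by (simp add: compact_smooth_def)
  \<comment> \<open>The operator c Lap_x + d Lap_y applied to the mollifier \<open>e n\<close>. That
    mollifier is a product because \<open>wform\<close> is tested on products only.\<close>
  define \<zeta> where "\<zeta> n z = of_real c * (laplacian (h n) (fst z) * h n (snd z)) + of_real d * (h n (fst z) * laplacian (h n) (snd z))"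
    for n and z :: "(real^3) \<times> (real^3)"
  have ih: "integrable lborel (h n)" "integrable lborel (laplacian (h n))" and sh: "sqint (h n)" "sqint (laplacian (h n))" for n
    using compact_smooth_integrable[OF csh] compact_smooth_sqint[OF csh] laplacian_integrable[OF csh] by auto
  have shw: "sqint (\<lambda>z. h n (z - w))" "sqint (\<lambda>z. laplacian (h n) (z - w))" for n w
    using sqint_shift[OF sh(1)[of n], of "- w"] sqint_shift[OF sh(2)[of n], of "- w"] by simp_all
  have molz: "mol (\<zeta> n) X y = of_real c * bpair X (laplacian (\<lambda>z. h n (z - fst y))) (\<lambda>z. h n (z - snd y))
      + of_real d * bpair X (\<lambda>z. h n (z - fst y)) (laplacian (\<lambda>z. h n (z - snd y)))" if X: "sqint X" for n X y
  proof -
    note i = bilinear_integral_swap(1)[OF shw(2) shw(1) X, of n "fst y" n "snd y"]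
      bilinear_integral_swap(1)[OF shw(1) shw(2) X, of n "fst y" n "snd y"]
    have "X z * \<zeta> n (z - y) = of_real c * (laplacian (h n) (fst z - fst y) * X z * h n (snd z - snd y))
      + of_real d * (h n (fst z - fst y) * X z * laplacian (h n) (snd z - snd y))" for z
      by (simp add: \<zeta>_def algebra_simps)
    then show ?thesis unfolding mol_def bpair_def lapw using i by simp
  qed
  have mole: "mol (e n) X y = bpair X (\<lambda>z. h n (z - fst y)) (\<lambda>z. h n (z - snd y))" for n X y
    unfolding e_def[abs_def] by (rule mol_tensor)
  obtain C where C: "\<And>s. l2n (\<lambda>z. A (s, z)) \<le> C" using wsolD(3)[OF w] by blast
  note sA = L1_pathD(2)[OF wsolD(1)[OF w]] and sF = L1_pathD(2)[OF wsolD(2)[OF w]]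
    and sA' = L1_pathD(2)[OF wsolD(1)[OF w']] and sF' = L1_pathD(2)[OF wsolD(2)[OF w']]
  define X where "X s = (\<integral>z. F (s, z) * cnj (A (s, z)) \<partial>lborel)" for s
  have main: "\<i> * ((\<integral>x. A (t, x) * cnj (A (t, x)) \<partial>lborel) - (\<integral>x. A (0, x) * cnj (A (0, x)) \<partial>lborel))
    = (LINT s:{0..t}|lborel. (\<integral>x. F (s, x) * cnj (A (s, x)) \<partial>lborel) + (\<integral>x. A (s, x) * - cnj (F (s, x)) \<partial>lborel))"
  proof (rule weak_product_rule[OF e, where \<zeta> = \<zeta> and CA = C and CB = C and T = T
        and B = "\<lambda>y. cnj (A y)" and G = "\<lambda>y. - cnj (F y)" and F = F and A = A])
    show "integrable lborel (\<zeta> n)" "sqint (\<zeta> n)" for n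
    proof -
      show "integrable lborel (\<zeta> n)" unfolding \<zeta>_def[abs_def]
        using integrable_tensor(1)[OF ih(2)[of n] ih(1)[of n]] integrable_tensor(1)[OF ih(1)[of n] ih(2)[of n]] by simp
      show "sqint (\<zeta> n)" unfolding \<zeta>_def[abs_def]
        using sqint_tensor(1)[OF sh(2)[of n] sh(1)[of n]] sqint_tensor(1)[OF sh(1)[of n] sh(2)[of n]]
        by (intro sqint_add sqint_cmult) (simp_all add: case_prod_beta')
    qed
    show "\<zeta> n (- x) = \<zeta> n x" for n x by (simp add: \<zeta>_def hev lev)
    show "A \<in> borel_measurable borel" "(\<lambda>y. cnj (A y)) \<in> borel_measurable borel"
      "F \<in> borel_measurable borel" "(\<lambda>y. - cnj (F y)) \<in> borel_measurable borel"
      by (intro L1_pathD(1) wsolD(1)[OF w] wsolD(1)[OF w'] wsolD(2)[OF w] wsolD(2)[OF w'])+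
    show "sqint (\<lambda>x. A (s, x))" "sqint (\<lambda>x. cnj (A (s, x)))" "sqint (\<lambda>x. F (s, x))" "sqint (\<lambda>x. - cnj (F (s, x)))" for s
      by (rule sA sA' sF sF')+
    show "l2n (\<lambda>x. A (s, x)) \<le> C" "l2n (\<lambda>x. cnj (A (s, x))) \<le> C" for s using C by simp_all
    show "integrable lborel (\<lambda>s. l2n (\<lambda>x. F (s, x)))" "integrable lborel (\<lambda>s. l2n (\<lambda>x. - cnj (F (s, x))))"
      using L1_pathD(3)[OF wsolD(2)[OF w]] by simp_all
    show "t \<in> {0..T}" by fact
    fix n y r assume r: "r \<in> {0..T}"
    show "\<i> * (mol (e n) (\<lambda>x. A (r, x)) y - mol (e n) (\<lambda>x. A (0, x)) y)
      = (LINT s:{0..r}|lborel. mol (e n) (\<lambda>x. F (s, x)) y - mol (\<zeta> n) (\<lambda>x. A (s, x)) y)"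
      unfolding mole molz[OF sA] by (rule wsolD(4)[OF w csw csw r])
    show "\<i> * (mol (e n) (\<lambda>x. cnj (A (r, x))) y - mol (e n) (\<lambda>x. cnj (A (0, x))) y)
      = (LINT s:{0..r}|lborel. mol (e n) (\<lambda>x. - cnj (F (s, x))) y + mol (\<zeta> n) (\<lambda>x. cnj (A (s, x))) y)"
      unfolding mole molz[OF sA'] using wsolD(4)[OF w' csw csw r, of n "fst y" n "snd y"] by (simp add: algebra_simps)
  qed
  have sq: "(\<integral>x. A (s, x) * cnj (A (s, x)) \<partial>lborel) = complex_of_real ((l2n (\<lambda>z. A (s, z)))\<^sup>2)" for s
  proof -
    have "(\<lambda>z. A (s, z) * cnj (A (s, z))) = (\<lambda>z. complex_of_real ((cmod (A (s, z)))\<^sup>2))"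
      by (simp add: fun_eq_iff complex_norm_square[symmetric])
    then show ?thesis by (simp only: integral_complex_of_real l2n_square)
  qed
  have "(\<integral>x. A (s, x) * - cnj (F (s, x)) \<partial>lborel) = - cnj (X s)" for s
    unfolding X_def Bochner_Integration.integral_cnj[symmetric] by (simp add: mult.commute)
  then have "(\<integral>x. F (s, x) * cnj (A (s, x)) \<partial>lborel) + (\<integral>x. A (s, x) * - cnj (F (s, x)) \<partial>lborel)
      = \<i> * complex_of_real (2 * Im (X s))" for s
    using complex_diff_cnj[of "X s"] by (simp add: X_def mult_ac)
  then have "\<i> * complex_of_real ((l2n (\<lambda>z. A (t, z)))\<^sup>2 - (l2n (\<lambda>z. A (0, z)))\<^sup>2)
    = (LINT s:{0..t}|lborel. \<i> * complex_of_real (2 * Im (X s)))"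
    using main unfolding sq by simp
  also have "\<dots> = \<i> * (LINT s:{0..t}|lborel. complex_of_real (2 * Im (X s)))"
    by (rule set_integral_mult_right)
  also have "(LINT s:{0..t}|lborel. complex_of_real (2 * Im (X s))) = complex_of_real (LINT s:{0..t}|lborel. 2 * Im (X s))"
    unfolding set_lebesgue_integral_def integral_complex_of_real[symmetric] by (simp add: scaleR_conv_of_real)
  finally have "complex_of_real ((l2n (\<lambda>z. A (t, z)))\<^sup>2 - (l2n (\<lambda>z. A (0, z)))\<^sup>2)
      = complex_of_real (LINT s:{0..t}|lborel. 2 * Im (X s))"
    by (rule mult_left_cancel[THEN iffD1, OF complex_i_not_zero])
  then show ?thesis unfolding of_real_eq_iff X_def .
qed

section \<open>The algebraic identities\<close>

abbreviation adj :: "hs \<Rightarrow> hs" where "adj a \<equiv> cj (tp a)"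

lemma adj_mult: "adj (a * b) = adj b * adj a"
  by (simp add: tp_mult cj_mult)

lemma adj_adj [simp]: "adj (adj a) = a"
  by (simp add: tp_cj)

lemma tr2_adj: "tr2 (adj a) (adj b) = cnj (tr2 a b)"
  by (simp add: tr2_cj tr2_tp)

lemma tr2_cyc: "tr2 (a * b) c = tr2 b (c * a)"
  by (metis tr2_assoc tr2_commute)

lemma tr2_diff: "tr2 (a - b) c = tr2 a c - tr2 b c" "tr2 c (a - b) = tr2 c a - tr2 c b"
  by (rule tr2_diff_left, rule tr2_diff_right)

text \<open>Here c = 1 + \<open>P\<close> and its inverse 1 + \<open>R\<close> are expanded for want
  of a unit. The idea is to test the identity for W c^-1 + c^-1 W against c^2 - 1: cyclicity turns
  both W terms into tr (W (c - c^-1)), the very quantity that the equation for \<open>S\<close>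
  leaves unknown.\<close>

lemma Im_trace_source:
  fixes U P S W M R :: hs
  assumes U: "tp U = U" and P: "adj P = P" and sq: "P + P + P * P = U * cj U"
    and r1: "P + R + P * R = 0" and r2: "P + R + R * P = 0"
    and S: "tp S = S" and W: "adj W = - W" and M: "tp M = M"
    and eq: "S - (M + P * M) = (W + U * cj M) * (U + R * U)"
    and star: "S * cj U - U * cj S = W + W + W * P + P * W"
  shows "Im (tr2 S (cj U)) = Im (tr2 M (cj U + cj U * P))"
proof -
  define a where "a = cj U"
  define X where "X = M * a"
  define Y where "Y = U * cj M"
  \<comment> \<open>\<open>N\<close> is c - c^-1, which equals c^-1 (c^2 - 1) = c^-1 u (kconj u);
    this is the content of \<open>N1\<close>.\<close>
  define N where "N = P - R"
  have PR: "P * R = R * P" using r1 r2 by (metis add_left_cancel)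
  \<comment> \<open>The adjoint of \<open>R\<close> is a left inverse for \<open>P\<close> in the
    same sense in which \<open>R\<close> is a right inverse, and a left and a right inverse
    coincide.\<close>
  have R: "adj R = R"
  proof -
    have "cj 0 = 0" "tp 0 = 0" using cj_diff[of 0 0] tp_diff[of 0 0] by simp_all
    then have "adj (P + R + P * R) = 0" using r1 by simp
    then have a1: "P + adj R + adj R * P = 0" by (simp add: tp_add cj_add adj_mult P)
    have "P * R - adj R * P = (P + adj R + adj R * P) * R - adj R * (P + R + P * R)"
      by (simp add: algebra_simps)
    then have a2: "P * R - adj R * P = 0" by (simp only: a1 r1) simp
    have "adj R - R = (P + adj R + adj R * P) - (P + R + P * R) + (P * R - adj R * P)"
      by (simp add: algebra_simps)
    then have "adj R - R = 0" by (simp only: a1 r1 a2) simp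
    then show ?thesis by simp
  qed
  have RP: "R * P = - P - R" using r2 by (simp add: algebra_simps eq_neg_iff_add_eq_0)
  have PR': "P * R = - P - R" using RP PR by simp
  have RPP: "R * (P * P) = - (P * P) + P + R"
    by (simp add: mult.assoc[symmetric] RP algebra_simps)
  have N1: "(U + R * U) * a = N"
  proof -
    have "(U + R * U) * a = U * a + R * (U * a)" by (simp add: algebra_simps)
    also have "\<dots> = (P + P + P * P) + R * (P + P + P * P)" by (simp add: a_def sq)
    also have "\<dots> = N" by (simp add: distrib_left RP RPP N_def)
    finally show ?thesis .
  qed
  have Sa: "S = M + P * M + (W + Y) * (U + R * U)"
    using eq by (simp add: Y_def diff_eq_eq add.commute)
  have SaN: "S * a = X + P * X + (W + Y) * N"
  proof -
    define B where "B = (W + Y) * (U + R * U)"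
    have B: "B * a = (W + Y) * N" by (simp only: B_def mult.assoc N1)
    have "S * a = (M + P * M + B) * a" using Sa by (simp add: B_def)
    also have "\<dots> = X + P * X + B * a" by (simp add: distrib_right mult.assoc X_def)
    finally show ?thesis by (simp only: B)
  qed
  have adjN: "adj N = N" by (simp add: N_def tp_diff cj_diff P R)
  have adjX: "adj X = Y" by (simp add: X_def Y_def a_def tp_mult cj_mult tp_cj U M)
  have adjY: "adj Y = X" using adjX by (metis adj_adj)
  have "U * cj S = adj (S * a)" by (simp add: a_def tp_mult cj_mult tp_cj U S)
  also have "\<dots> = Y + Y * P + N * (- W + X)"
    by (simp add: SaN tp_add cj_add adj_mult adjX adjY adjN P W)
  finally have UcS: "U * cj S = Y + Y * P + N * (- W + X)" .
  have "X + P * X + (W + Y) * N - (Y + Y * P + N * (- W + X)) = W + W + W * P + P * W"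
    using star SaN UcS by (simp add: a_def)
  \<comment> \<open>The identity for W c^-1 + c^-1 W with c^-1 written as 1 + \<open>R\<close>; the
    terms with c cancel against \<open>star\<close>.\<close>
  then have E: "W + W + W * R + R * W = X + R * X - Y - Y * R"
    unfolding N_def by (simp add: algebra_simps)
  \<comment> \<open>\<open>Q\<close> is c (c - c^-1) = c^2 - 1. It commutes with c^-1, and c^-1
    takes it back to \<open>N\<close>.\<close>
  define Q where "Q = N + P * N"
  have QR: "Q * R = R * Q"
  proof -
    have "N * R = R * N" by (simp add: N_def algebra_simps PR)
    then show ?thesis unfolding Q_def
      by (simp add: distrib_left distrib_right mult.assoc) (simp add: mult.assoc[symmetric] PR)
  qed
  have QN: "Q + R * Q = N"
  proof -
    have "Q + R * Q = N + (P + R + R * P) * N" unfolding Q_def by (simp add: algebra_simps)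
    then show ?thesis by (simp add: r2)
  qed
  have "tr2 (W + W + W * R + R * W) Q = 2 * tr2 W N"
  proof -
    have "tr2 (W * R) Q = tr2 W (R * Q)" by (rule tr2_assoc)
    moreover have "tr2 (R * W) Q = tr2 W (R * Q)" by (simp add: tr2_cyc QR)
    ultimately have "tr2 (W + W + W * R + R * W) Q = 2 * tr2 W (Q + R * Q)"
      by (simp add: tr2_add_left tr2_add_right)
    then show ?thesis by (simp add: QN)
  qed
  moreover have "tr2 (X + R * X - Y - Y * R) Q = tr2 X N - tr2 Y N"
  proof -
    have "tr2 (R * X) Q = tr2 X (R * Q)" by (simp add: tr2_cyc QR)
    moreover have "tr2 (Y * R) Q = tr2 Y (R * Q)" by (rule tr2_assoc)
    ultimately have "tr2 (X + R * X - Y - Y * R) Q = tr2 X (Q + R * Q) - tr2 Y (Q + R * Q)"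
      by (simp add: tr2_add_left tr2_add_right tr2_diff)
    then show ?thesis by (simp add: QN)
  qed
  ultimately have WN: "2 * tr2 W N = tr2 X N - tr2 Y N" using E by simp
  have "tr2 Y N = cnj (tr2 X N)" using tr2_adj[of X N] by (simp add: adjX adjN)
  \<comment> \<open>By \<open>WN\<close> the sum is tr (X N) + tr (Y N), a number plus its complex
    conjugate, because \<open>Y\<close> is the adjoint of \<open>X\<close> and \<open>N\<close> is
    self-adjoint.\<close>
  then have "Im (2 * tr2 W N + 2 * tr2 Y N) = 0" by (simp add: WN)
  then have im0: "Im (tr2 W N + tr2 Y N) = 0" by simp
  have "tr2 ((W + Y) * (U + R * U)) a = tr2 W N + tr2 Y N"
    by (simp only: tr2_assoc N1 tr2_add_left)
  moreover have "tr2 (P * M) a = tr2 M (a * P)" by (rule tr2_cyc)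
  ultimately have "tr2 S a = tr2 M (a + a * P) + (tr2 W N + tr2 Y N)"
    by (subst Sa) (simp only: tr2_add_left tr2_add_right)
  then show ?thesis using im0 by (simp add: a_def)
qed

text \<open>The squared norm of (kconj u) c is tr ((kconj u) c^2 u). Inserting c^2 = 1 + u (kconj u)
  gives exactly the squared norm of u plus that of (kconj u) u, and only the latter is
  estimated.\<close>

lemma norm_sh_ch_le:
  fixes U P :: hs
  assumes U: "tp U = U" and P: "adj P = P" and sq: "P + P + P * P = U * cj U"
  shows "norm (cj U + cj U * P) \<le> sqrt ((norm U)\<^sup>2 + ((norm U)\<^sup>2)\<^sup>2)"
proof (rule real_le_rsqrt)
  define a where "a = cj U"
  have adj1: "adj (a + a * P) = U + P * U" by (simp add: a_def tp_add cj_add adj_mult P tp_cj U)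
  have adj2: "adj (a * U) = a * U" by (simp add: a_def adj_mult tp_cj U)
  have "tr2 (a + a * P) (U + P * U) = tr2 a (U + (P + P + P * P) * U)"
    by (simp add: tr2_add_left tr2_add_right tr2_assoc distrib_left distrib_right mult.assoc)
  also have "\<dots> = tr2 a U + tr2 (a * U) (a * U)"
    by (simp add: sq a_def tr2_add_right tr2_assoc mult.assoc)
  also have "\<dots> = tr2 a (adj a) + tr2 (a * U) (adj (a * U))"
    by (simp only: adj2) (simp add: a_def tp_cj U)
  finally have "complex_of_real ((norm (a + a * P))\<^sup>2) = complex_of_real ((norm a)\<^sup>2 + (norm (a * U))\<^sup>2)"
    unfolding adj1[symmetric] tr2_self_adjoint by simp
  then have e: "(norm (a + a * P))\<^sup>2 = (norm a)\<^sup>2 + (norm (a * U))\<^sup>2" by (simp only: of_real_eq_iff)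
  have "norm (a * U) \<le> (norm U)\<^sup>2" using norm_mult_ineq[of a U] by (simp add: a_def power2_eq_square)
  then have "(norm (a * U))\<^sup>2 \<le> ((norm U)\<^sup>2)\<^sup>2" by (rule power_mono) simp
  then show "(norm (cj U + cj U * P))\<^sup>2 \<le> (norm U)\<^sup>2 + ((norm U)\<^sup>2)\<^sup>2"
    using e by (simp add: a_def)
qed

text \<open>The parts of \<open>g\<close> cancel: \<open>G\<close> and \<open>H\<close> come from the multiplication operator, \<open>E\<close> is the exchange operator.\<close>

lemma source_commutator_identity:
  fixes U P S W E G H F K :: hs
  assumes U: "tp U = U" and sq: "P + P + P * P = U * cj U" and E: "adj E = E"
    and F: "F = S - (G + E * U + U * tp E)" and K: "K = W - (H + E * P - P * E)"
    and GH: "G * cj U - U * cj G = H + H + H * P + P * H"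
    and FK: "F * cj U - U * cj F = K + K + K * P + P * K"
  shows "S * cj U - U * cj S = W + W + W * P + P * W"
proof -
  have tE: "tp E = cj E" using E by (metis cj_cj)
  \<comment> \<open>For self-adjoint \<open>E\<close> the exchange terms form the commutator of
    \<open>E\<close> with u (kconj u). On the other side [E, p] gives 2 [E, p] + [E, p] p + p [E, p]
    = [E, 2p + p^2], the same commutator.\<close>
  have "F * cj U - U * cj F = (S * cj U - U * cj S) - (G * cj U - U * cj G) - (E * (U * cj U) - (U * cj U) * E)"
    unfolding F tE by (simp add: cj_add cj_diff cj_mult algebra_simps)
  also have "\<dots> = (S * cj U - U * cj S) - (H + H + H * P + P * H) - (E * (P + P + P * P) - (P + P + P * P) * E)"
    by (simp only: GH sq)
  finally have "(S * cj U - U * cj S) - (H + H + H * P + P * H) - (E * (P + P + P * P) - (P + P + P * P) * E) = K + K + K * P + P * K"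
    using FK by simp
  then show ?thesis unfolding K by (simp add: algebra_simps)
qed

text \<open>Both traces equal their own conjugates: taking adjoints reverses the factors, and
  cyclicity with self-adjointness of \<open>E\<close> brings the product back. Thus the exchange
  operator does not change the norm of u.\<close>

lemma hs_im_zero:
  fixes U E :: hs
  assumes U: "tp U = U" and E: "adj E = E"
  shows "Im (tr2 (E * U) (cj U)) = 0" "Im (tr2 (U * tp E) (cj U)) = 0"
proof -
  have tE: "tp E = cj E" using E by (metis cj_cj)
  have adjU: "adj U = cj U" "adj (cj U) = U" by (simp_all add: U tp_cj)
  have "cnj (tr2 (E * U) (cj U)) = tr2 (cj U * E) U"
    unfolding tr2_adj[symmetric] adj_mult adjU E ..
  also have "\<dots> = tr2 (E * U) (cj U)" by (metis tr2_assoc tr2_commute)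
  finally show "Im (tr2 (E * U) (cj U)) = 0" by (simp add: complex_eq_iff)
  have adjE: "adj (cj E) = cj E" by (simp add: tp_cj tE)
  have "cnj (tr2 (U * tp E) (cj U)) = tr2 (cj E * cj U) U"
    unfolding tr2_adj[symmetric] tE adj_mult adjU adjE ..
  also have "\<dots> = tr2 (U * tp E) (cj U)" unfolding tE by (metis tr2_assoc tr2_commute)
  finally show "Im (tr2 (U * tp E) (cj U)) = 0" by (simp add: complex_eq_iff)
qed

section \<open>The multiplication operator\<close>

text \<open>Multiplication by V need not be bounded and has no class in the algebra, so the
  cancellation is done under the integral: the value of V at the contracted variable drops out,
  leaving V x - V y times u (kconj u) on the left and times 2p + p^2 on the right.\<close>

lemma potential_cancel:
  fixes V :: "real^3 \<Rightarrow> real" and u p :: kernel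
  defines "G \<equiv> \<lambda>(x, y). complex_of_real (V x + V y) * u (x, y)"
    and "H \<equiv> \<lambda>(x, y). complex_of_real (V x - V y) * p (x, y)"
  assumes u: "sqint u" and p: "sqint p" and G: "sqint G" and H: "sqint H"
    and sq: "hs_of p + hs_of p + hs_of p * hs_of p = hs_of u * cj (hs_of u)"
  shows "hs_of G * cj (hs_of u) - hs_of u * cj (hs_of G)
    = hs_of H + hs_of H + hs_of H * hs_of p + hs_of p * hs_of H"
proof -
  note cu = sqint_kconj[OF u] and cG = sqint_kconj[OF G]
  let ?L = "\<lambda>z. (G \<odot> kconj u) z - (u \<odot> kconj G) z"
  let ?R = "\<lambda>z. H z + H z + (H \<odot> p) z + (p \<odot> H) z"
  have sL: "sqint ?L" and sR: "sqint ?R"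
    by (intro sqint_add sqint_diff sqint_kcomp u p G H cu cG)+
  have "hs_of (\<lambda>z. p z + p z + (p \<odot> p) z) = hs_of (u \<odot> kconj u)"
    by (simp only: hs_of_add sqint_add sqint_kcomp hs_of_kcomp hs_of_kconj cu u p sq)
  then have sq': "AE z in lborel. p z + p z + (p \<odot> p) z = (u \<odot> kconj u) z"
    by (rule hs_of_eq_iff[THEN iffD1, rotated 2]) (intro sqint_add sqint_kcomp u p cu)+
  have "AE z in lborel. ?L z = ?R z"
  proof (rule AE_kernelI)
    show "?L \<in> borel_measurable borel" "?R \<in> borel_measurable borel"
      using sL sR by (auto simp only: sqint_def)
    show "AE x in lborel. AE y in lborel. ?L (x, y) = ?R (x, y)"
      using AE_lborel_prodD[OF sq'] AE_kcomp_integrable[OF G cu] AE_kcomp_integrable[OF u cG]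
        AE_kcomp_integrable[OF u cu] AE_kcomp_integrable[OF H p] AE_kcomp_integrable[OF p H] AE_kcomp_integrable[OF p p]
    proof eventually_elim
      case (elim x)
      then show ?case
      proof eventually_elim
        case (elim y)
        have "?L (x, y) = (\<integral>z. G (x, z) * kconj u (z, y) - u (x, z) * kconj G (z, y) \<partial>lborel)"
          using elim(2,3) by (simp add: kcomp_def)
        also have "\<dots> = (\<integral>z. complex_of_real (V x - V y) * (u (x, z) * kconj u (z, y)) \<partial>lborel)"
          by (intro Bochner_Integration.integral_cong refl) (simp add: G_def kconj_def algebra_simps)
        also have "\<dots> = complex_of_real (V x - V y) * (u \<odot> kconj u) (x, y)"
          by (simp only: integral_mult_right_zero kcomp_def prod.case)
        finally have L: "?L (x, y) = complex_of_real (V x - V y) * (u \<odot> kconj u) (x, y)" .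
        have "(H \<odot> p) (x, y) + (p \<odot> H) (x, y) = (\<integral>z. H (x, z) * p (z, y) + p (x, z) * H (z, y) \<partial>lborel)"
          using elim(5,6) by (simp add: kcomp_def)
        also have "\<dots> = (\<integral>z. complex_of_real (V x - V y) * (p (x, z) * p (z, y)) \<partial>lborel)"
          by (intro Bochner_Integration.integral_cong refl) (simp add: H_def algebra_simps)
        also have "\<dots> = complex_of_real (V x - V y) * (p \<odot> p) (x, y)"
          by (simp only: integral_mult_right_zero kcomp_def prod.case)
        finally have "?R (x, y) = complex_of_real (V x - V y) * (p (x, y) + p (x, y) + (p \<odot> p) (x, y))"
          by (simp add: H_def distrib_left add.assoc)
        then show ?case using L elim(1) by simp
      qed
    qed
  qed
  then have "hs_of ?L = hs_of ?R" using sL sR by (simp add: hs_of_eq_iff)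
  moreover have "hs_of ?L = hs_of G * cj (hs_of u) - hs_of u * cj (hs_of G)"
    by (simp only: hs_of_diff sqint_kcomp hs_of_kcomp hs_of_kconj u G cu cG)
  moreover have "hs_of ?R = hs_of H + hs_of H + hs_of H * hs_of p + hs_of p * hs_of H"
    by (simp only: hs_of_add sqint_add sqint_kcomp hs_of_kcomp H p)
  ultimately show ?thesis by simp
qed

lemma tr2_cj_tp_hs_of:
  assumes "sqint a" "sqint b"
  shows "tr2 (hs_of a) (adj (hs_of b)) = (\<integral>z. a z * cnj (b z) \<partial>lborel)"
proof -
  have "tr2 (hs_of a) (adj (hs_of b)) = ktrace2 a (kconj (ktranspose b))"
    using assms by (simp add: hs_of_ktranspose[symmetric] hs_of_kconj[symmetric] tr2_hs_of sqint_ktranspose sqint_kconj)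
  then show ?thesis by (simp add: ktrace2_def kconj_def ktranspose_swap)
qed

section \<open>Uniqueness of the source term\<close>

lemma wsol_wform: "wsol T c d A F \<Longrightarrow> wform T c d A F"
  unfolding wsol_def by blast

lemma wformD:
  assumes "wform T c d A F"
  shows "L1_path A" "L1_path F"
    "compact_smooth f \<Longrightarrow> compact_smooth g \<Longrightarrow> t \<in> {0..T} \<Longrightarrow>
      \<i> * (bpair (\<lambda>z. A (t, z)) f g - bpair (\<lambda>z. A (0, z)) f g)
      = (LINT s:{0..t}|lborel. bpair (\<lambda>z. F (s, z)) f g
          - (of_real c * bpair (\<lambda>z. A (s, z)) (laplacian f) g + of_real d * bpair (\<lambda>z. A (s, z)) f (laplacian g)))"
  using assms unfolding wform_def by blast+

lemma bpair_lap_integrable: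
  assumes A: "L1_path A" and f: "compact_smooth f" and g: "compact_smooth g"
  shows "set_integrable lborel {0..t} (\<lambda>s. of_real c * bpair (\<lambda>z. A (s, z)) (laplacian f) g + of_real d * bpair (\<lambda>z. A (s, z)) f (laplacian g))"
  by (intro set_integral_add(1) set_integrable_mult_right bpair_path_integrable A
      compact_smooth_sqint laplacian_integrable f g)

lemma wform_add:
  assumes a: "wform T c d A F" and b: "wform T c d B G"
  shows "wform T c d (\<lambda>y. A y + B y) (\<lambda>y. F y + G y)"
  unfolding wform_def
proof (intro conjI allI impI L1_path_add wformD(1,2)[OF a] wformD(1,2)[OF b])
  fix f g :: "real^3 \<Rightarrow> complex" and t
  assume f: "compact_smooth f" and g: "compact_smooth g" and t: "t \<in> {0..T}"
  have sq: "sqint f" "sqint g" "sqint (laplacian f)" "sqint (laplacian g)"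
    using f g by (auto intro: compact_smooth_sqint laplacian_integrable)
  note L = wformD(1,2)[OF a] wformD(1,2)[OF b]
  have add: "bpair (\<lambda>z. A (s, z) + B (s, z)) h k = bpair (\<lambda>z. A (s, z)) h k + bpair (\<lambda>z. B (s, z)) h k"
    "bpair (\<lambda>z. F (s, z) + G (s, z)) h k = bpair (\<lambda>z. F (s, z)) h k + bpair (\<lambda>z. G (s, z)) h k"
    if "sqint h" "sqint k" for s h k
    by (intro bpair_add(1) L1_pathD(2) L that)+
  let ?H = "\<lambda>A F s. bpair (\<lambda>z. F (s, z)) f g
          - (of_real c * bpair (\<lambda>z. A (s, z)) (laplacian f) g + of_real d * bpair (\<lambda>z. A (s, z)) f (laplacian g))"
  have i: "set_integrable lborel {0..t} (?H A F)" "set_integrable lborel {0..t} (?H B G)"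
    by (intro set_integral_diff(1) bpair_lap_integrable bpair_path_integrable L f g sq)+
  have "(LINT s:{0..t}|lborel. ?H A F s + ?H B G s) = (LINT s:{0..t}|lborel. ?H A F s) + (LINT s:{0..t}|lborel. ?H B G s)"
    by (rule set_integral_add(2)[OF i])
  also have "\<dots> = \<i> * (bpair (\<lambda>z. A (t, z)) f g - bpair (\<lambda>z. A (0, z)) f g) + \<i> * (bpair (\<lambda>z. B (t, z)) f g - bpair (\<lambda>z. B (0, z)) f g)"
    using wformD(3)[OF a f g t] wformD(3)[OF b f g t] by simp
  finally show "\<i> * (bpair (\<lambda>z. A (t, z) + B (t, z)) f g - bpair (\<lambda>z. A (0, z) + B (0, z)) f g)
      = (LINT s:{0..t}|lborel. bpair (\<lambda>z. F (s, z) + G (s, z)) f g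
          - (of_real c * bpair (\<lambda>z. A (s, z) + B (s, z)) (laplacian f) g + of_real d * bpair (\<lambda>z. A (s, z) + B (s, z)) f (laplacian g)))"
    by (simp add: add sq algebra_simps)
qed

lemma wform_swap:
  assumes a: "wform T c d A F"
  shows "wform T d c (\<lambda>(s, z). A (s, prod.swap z)) (\<lambda>(s, z). F (s, prod.swap z))"
  unfolding wform_def
proof (intro conjI allI impI L1_path_swap wformD(1,2)[OF a])
  fix f g :: "real^3 \<Rightarrow> complex" and t
  assume f: "compact_smooth f" and g: "compact_smooth g" and t: "t \<in> {0..T}"
  have sq: "sqint f" "sqint g" "sqint (laplacian f)" "sqint (laplacian g)"
    using f g by (auto intro: compact_smooth_sqint laplacian_integrable)
  have sw: "bpair (\<lambda>z. A (s, prod.swap z)) h k = bpair (\<lambda>z. A (s, z)) k h"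
    "bpair (\<lambda>z. F (s, prod.swap z)) h k = bpair (\<lambda>z. F (s, z)) k h"
    if "sqint h" "sqint k" for s h k
    by (intro bpair_swap[of "\<lambda>z. A (s, z)"] bpair_swap[of "\<lambda>z. F (s, z)"] L1_pathD(2) wformD(1,2)[OF a] that)+
  show "\<i> * (bpair (\<lambda>z. case (t, z) of (s, z) \<Rightarrow> A (s, prod.swap z)) f g - bpair (\<lambda>z. case (0, z) of (s, z) \<Rightarrow> A (s, prod.swap z)) f g)
      = (LINT s:{0..t}|lborel. bpair (\<lambda>z. case (s, z) of (s, z) \<Rightarrow> F (s, prod.swap z)) f g
          - (of_real d * bpair (\<lambda>z. case (s, z) of (s, z) \<Rightarrow> A (s, prod.swap z)) (laplacian f) g
             + of_real c * bpair (\<lambda>z. case (s, z) of (s, z) \<Rightarrow> A (s, prod.swap z)) f (laplacian g)))"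
    unfolding prod.case sw[OF sq(1,2)] sw[OF sq(3,2)] sw[OF sq(1,4)]
    using wformD(3)[OF a g f t] by (simp only: add.commute)
qed

lemma wform_product:
  assumes a: "wsol T c d A F" and b: "wsol T (- d) e B G"
  shows "wform T c e (\<lambda>(s, z). ((\<lambda>z. A (s, z)) \<odot> (\<lambda>z. B (s, z))) z)
    (\<lambda>y. (\<lambda>(s, z). ((\<lambda>z. F (s, z)) \<odot> (\<lambda>z. B (s, z))) z) y + (\<lambda>(s, z). ((\<lambda>z. A (s, z)) \<odot> (\<lambda>z. G (s, z))) z) y)"
  unfolding wform_def
proof (intro conjI allI impI)
  note L = wsolD(1,2)[OF a] wsolD(1,2)[OF b]
  obtain CA where CA: "\<forall>s. l2n (\<lambda>z. A (s, z)) \<le> CA" using wsolD(3)[OF a] by blast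
  obtain CB where CB: "\<forall>s. l2n (\<lambda>z. B (s, z)) \<le> CB" using wsolD(3)[OF b] by blast
  show "L1_path (\<lambda>(s, z). ((\<lambda>z. A (s, z)) \<odot> (\<lambda>z. B (s, z))) z)"
    by (rule L1_path_kcomp[OF L(1,3) disjI1[OF CB]])
  show "L1_path (\<lambda>y. (\<lambda>(s, z). ((\<lambda>z. F (s, z)) \<odot> (\<lambda>z. B (s, z))) z) y + (\<lambda>(s, z). ((\<lambda>z. A (s, z)) \<odot> (\<lambda>z. G (s, z))) z) y)"
    by (intro L1_path_add L1_path_kcomp[OF L(2,3) disjI1[OF CB]] L1_path_kcomp[OF L(1,4) disjI2[OF CA]])
  fix f g :: "real^3 \<Rightarrow> complex" and t
  assume f: "compact_smooth f" and g: "compact_smooth g" and t: "t \<in> {0..T}"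
  have add: "bpair (\<lambda>z. ((\<lambda>z. F (s, z)) \<odot> (\<lambda>z. B (s, z))) z + ((\<lambda>z. A (s, z)) \<odot> (\<lambda>z. G (s, z))) z) f g
      = bpair ((\<lambda>z. F (s, z)) \<odot> (\<lambda>z. B (s, z))) f g + bpair ((\<lambda>z. A (s, z)) \<odot> (\<lambda>z. G (s, z))) f g" for s
    by (intro bpair_add(1) sqint_kcomp L1_pathD(2) L compact_smooth_sqint f g)
  show "\<i> * (bpair (\<lambda>z. case (t, z) of (s, z) \<Rightarrow> ((\<lambda>z. A (s, z)) \<odot> (\<lambda>z. B (s, z))) z) f g
        - bpair (\<lambda>z. case (0, z) of (s, z) \<Rightarrow> ((\<lambda>z. A (s, z)) \<odot> (\<lambda>z. B (s, z))) z) f g)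
      = (LINT s:{0..t}|lborel. bpair (\<lambda>z. (case (s, z) of (s, z) \<Rightarrow> ((\<lambda>z. F (s, z)) \<odot> (\<lambda>z. B (s, z))) z) + (case (s, z) of (s, z) \<Rightarrow> ((\<lambda>z. A (s, z)) \<odot> (\<lambda>z. G (s, z))) z)) f g
          - (of_real c * bpair (\<lambda>z. case (s, z) of (s, z) \<Rightarrow> ((\<lambda>z. A (s, z)) \<odot> (\<lambda>z. B (s, z))) z) (laplacian f) g
             + of_real e * bpair (\<lambda>z. case (s, z) of (s, z) \<Rightarrow> ((\<lambda>z. A (s, z)) \<odot> (\<lambda>z. B (s, z))) z) f (laplacian g)))"
    unfolding prod.case add using wsol_product[OF a b f g t] .
qed

text \<open>This replaces differentiation of an identity between paths: equal paths make the time
  and Laplacian terms equal against every product test function, and \<open>L1_path_zero\<close>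
  then identifies the sources.\<close>

lemma wform_unique:
  assumes a: "wform T c d A F" and b: "wform T c d B G" and T: "0 \<le> T"
    and eq: "\<And>s. s \<in> {0..T} \<Longrightarrow> AE z in lborel. A (s, z) = B (s, z)"
  shows "AE s in lborel. s \<in> {0..T} \<longrightarrow> (AE z in lborel. F (s, z) = G (s, z))"
proof -
  note L = wformD(1,2)[OF a] wformD(1,2)[OF b]
  have "AE s in lborel. s \<in> {0..T} \<longrightarrow> (AE z in lborel. F (s, z) - G (s, z) = 0)"
  proof (rule L1_path_zero[OF L1_path_diff[OF L(2,4)] T])
    fix f g :: "real^3 \<Rightarrow> complex" and t
    assume f: "compact_smooth f" and g: "compact_smooth g" and t: "t \<in> {0..T}"
    have sq: "sqint f" "sqint g" "sqint (laplacian f)" "sqint (laplacian g)"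
      using f g by (auto intro: compact_smooth_sqint laplacian_integrable)
    have AB: "bpair (\<lambda>z. A (s, z)) h k = bpair (\<lambda>z. B (s, z)) h k" if "s \<in> {0..T}" "sqint h" "sqint k" for s h k
      by (intro bpair_cong_AE L1_pathD(2) L that eq)
    let ?H = "\<lambda>A F s. bpair (\<lambda>z. F (s, z)) f g
          - (of_real c * bpair (\<lambda>z. A (s, z)) (laplacian f) g + of_real d * bpair (\<lambda>z. A (s, z)) f (laplacian g))"
    have i: "set_integrable lborel {0..t} (?H A F)" "set_integrable lborel {0..t} (?H B G)"
      by (intro set_integral_diff(1) bpair_lap_integrable bpair_path_integrable L f g sq)+
    have diff: "bpair (\<lambda>z. F (s, z) - G (s, z)) f g = bpair (\<lambda>z. F (s, z)) f g - bpair (\<lambda>z. G (s, z)) f g" for s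
      by (intro bpair_add(2) L1_pathD(2) L sq)
    have "(LINT s:{0..t}|lborel. bpair (\<lambda>z. F (s, z) - G (s, z)) f g) = (LINT s:{0..t}|lborel. ?H A F s - ?H B G s)"
    proof (rule set_lebesgue_integral_cong)
      show "\<forall>s. s \<in> {0..t} \<longrightarrow> bpair (\<lambda>z. F (s, z) - G (s, z)) f g = ?H A F s - ?H B G s"
      proof (intro allI impI)
        fix s assume "s \<in> {0..t}"
        then have s: "s \<in> {0..T}" using t by auto
        show "bpair (\<lambda>z. F (s, z) - G (s, z)) f g = ?H A F s - ?H B G s"
          unfolding diff AB[OF s sq(3,2)] AB[OF s sq(1,4)] by simp
      qed
    qed simp
    also have "\<dots> = (LINT s:{0..t}|lborel. ?H A F s) - (LINT s:{0..t}|lborel. ?H B G s)"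
      by (rule set_integral_diff(2)[OF i])
    also have "\<dots> = \<i> * (bpair (\<lambda>z. A (t, z)) f g - bpair (\<lambda>z. A (0, z)) f g) - \<i> * (bpair (\<lambda>z. B (t, z)) f g - bpair (\<lambda>z. B (0, z)) f g)"
      using wformD(3)[OF a f g t] wformD(3)[OF b f g t] by simp
    also have "\<dots> = 0" using AB[OF t sq(1,2)] AB[of 0, OF _ sq(1,2)] T by simp
    finally show "(LINT s:{0..t}|lborel. bpair (\<lambda>z. F (s, z) - G (s, z)) f g) = 0" .
  qed
  then show ?thesis by simp
qed

section \<open>A Gronwall inequality\<close>

text \<open>The interval is divided into equal steps shorter than r, along which the inequalities
  are chained. Comparison over short times is all that uniform continuity provides later.\<close>

lemma local_antitone_imp_le:
  fixes f :: "real \<Rightarrow> real"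
  assumes T: "0 \<le> T" and r: "0 < r"
    and le: "\<And>s t. 0 \<le> s \<Longrightarrow> s \<le> t \<Longrightarrow> t \<le> T \<Longrightarrow> t - s < r \<Longrightarrow> f t \<le> f s"
  shows "f T \<le> f 0"
proof -
  obtain N :: nat where N: "T / r < real N" using reals_Archimedean2 by blast
  moreover have "0 \<le> T / r" using T r by simp
  ultimately have N0: "0 < real N" by linarith
  define d where "d = T / real N"
  have d: "d < r" "0 \<le> d" "real N * d = T" using N N0 r T by (simp_all add: d_def field_simps)
  have "f (real k * d) \<le> f 0" if "k \<le> N" for k
    using that
  proof (induction k)
    case (Suc k)
    have "real (Suc k) * d \<le> T"
      using mult_right_mono[of "real (Suc k)" "real N" d] Suc.prems d by simp
    moreover have diff: "real (Suc k) * d - real k * d = d" by (simp add: algebra_simps)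
    moreover have "0 \<le> real k * d" using d by simp
    ultimately have "f (real (Suc k) * d) \<le> f (real k * d)"
      using d by (intro le) linarith+
    then show ?case using Suc by simp
  qed simp
  from this[of N] show ?thesis using d by simp
qed

text \<open>The root of y is not differentiable at zeros of y, which \<delta> repairs, and h is
  merely integrable. Instead of a chain rule, q is treated as nearly constant on short intervals: e
  is its permitted oscillation, and the extra factor in the exponent is the price.\<close>

lemma gronwall_sqrt_shifted:
  fixes y \<mu> h :: "real \<Rightarrow> real"
  assumes T: "0 \<le> T" and \<delta>: "0 < \<delta>" and e: "0 < e"
    and y: "\<And>t. t \<in> {0..T} \<Longrightarrow> 0 \<le> y t"
    and \<mu>: "set_integrable lborel {0..T} \<mu>" "\<And>t. 0 \<le> \<mu> t" and h: "set_integrable lborel {0..T} h"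
    and eq: "\<And>t. t \<in> {0..T} \<Longrightarrow> y t = y 0 + (LINT s:{0..t}|lborel. h s)"
    and le: "AE s in lborel. s \<in> {0..T} \<longrightarrow> h s \<le> 2 * \<mu> s * sqrt (y s + (y s)\<^sup>2)"
  shows "1 + sqrt (y T + \<delta>) \<le> (1 + sqrt (y 0 + \<delta>)) * exp ((1 + e / sqrt \<delta>) * (1 + e) * (LINT s:{0..T}|lborel. \<mu> s))"
proof -
  define q where "q t = sqrt (y t + \<delta>)" for t
  define \<Theta> where "\<Theta> t = (LINT s:{0..t}|lborel. \<mu> s)" for t
  define \<kappa> where "\<kappa> = (1 + e / sqrt \<delta>) * (1 + e)"
  have \<kappa>: "0 \<le> \<kappa>" unfolding \<kappa>_def using e \<delta> by simp
  have sub: "set_integrable lborel X g" if "set_integrable lborel {0..T} g" "X \<subseteq> {0..T}" "X \<in> sets borel" for g :: "real \<Rightarrow> real" and X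
    by (rule set_integrable_subset[OF that(1)]) (use that in auto)
  have q_sq: "(q t)\<^sup>2 = y t + \<delta>" and q_ge: "sqrt \<delta> \<le> q t" and sy: "sqrt (y t) \<le> q t" if "t \<in> {0..T}" for t
    using y[OF that] \<delta> by (auto simp: q_def)
  have sd: "0 < sqrt \<delta>" using \<delta> by simp
  have cont: "continuous_on {0..T} y"
  proof -
    have "h integrable_on {0..T}" by (rule set_borel_integral_eq_integral(1)[OF h])
    from continuous_on_add[OF continuous_on_const indefinite_integral_continuous_1[OF this]]
    have c: "continuous_on {0..T} (\<lambda>t. y 0 + integral {0..t} h)" .
    have yt: "y t = y 0 + integral {0..t} h" if "t \<in> {0..T}" for t
    proof -
      have "set_integrable lborel {0..t} h" by (rule sub[OF h]) (use that in auto)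
      from set_borel_integral_eq_integral(2)[OF this] show ?thesis by (subst eq[OF that]) (simp only:)
    qed
    show ?thesis by (rule continuous_on_eq[OF c]) (rule yt[symmetric])
  qed
  have uc: "uniformly_continuous_on {0..T} q"
    unfolding q_def
    by (intro compact_uniformly_continuous continuous_on_real_sqrt continuous_on_add cont continuous_on_const compact_Icc)
  obtain r where r': "r > 0 \<and> (\<forall>s\<in>{0..T}. \<forall>t\<in>{0..T}. dist t s < r \<longrightarrow> dist (q t) (q s) < e)"
    using uc e unfolding uniformly_continuous_on_def by blast
  then have r: "0 < r" and close: "\<And>s t. s \<in> {0..T} \<Longrightarrow> t \<in> {0..T} \<Longrightarrow> dist t s < r \<Longrightarrow> dist (q t) (q s) < e"
    by blast+
  define f where "f t = (1 + q t) * exp (- \<kappa> * \<Theta> t)" for t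
  have "f T \<le> f 0"
  proof (rule local_antitone_imp_le[OF T r])
    fix s t :: real assume st: "0 \<le> s" "s \<le> t" "t \<le> T" "t - s < r"
    then have sT: "s \<in> {0..T}" and tT: "t \<in> {0..T}" by auto
    have split: "(LINT x:{0..t}|lborel. g x) = (LINT x:{0..s}|lborel. g x) + (LINT x:{s<..t}|lborel. g x)"
      if g: "set_integrable lborel {0..T} g" for g :: "real \<Rightarrow> real"
    proof -
      have u: "{0..t} = {0..s} \<union> {s<..t}" using st by auto
      have i: "set_integrable lborel {0..s} g" "set_integrable lborel {s<..t} g"
        by (rule sub[OF g]; use st in auto)+
      show ?thesis unfolding u by (rule set_integral_Un[OF _ i]) auto
    qed
    define D where "D = (LINT x:{s<..t}|lborel. \<mu> x)"
    have D: "0 \<le> D" unfolding D_def set_lebesgue_integral_def by (rule integral_nonneg_AE) (simp add: \<mu>(2))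
    have \<Theta>t: "\<Theta> t = \<Theta> s + D" unfolding \<Theta>_def D_def by (rule split[OF \<mu>(1)])
    \<comment> \<open>The factor q s + q t is chosen to match y t - y s = (q s + q t)(q t - q s), so
      that it can be divided out below.\<close>
    define c where "c = \<kappa> * ((q s + q t) * (1 + q s))"
    have pos: "sqrt \<delta> \<le> q s" "sqrt \<delta> \<le> q t" "0 < q s" "0 < q t" using q_ge[OF sT] q_ge[OF tT] sd by linarith+
    have "y t - y s = (LINT x:{s<..t}|lborel. h x)"
      using eq[OF sT] eq[OF tT] split[OF h] by simp
    also have "\<dots> \<le> (LINT x:{s<..t}|lborel. c * \<mu> x)"
    proof (rule set_integral_mono_AE)
      show "set_integrable lborel {s<..t} h" by (rule sub[OF h]) (use st in auto)
      have "set_integrable lborel {s<..t} \<mu>" by (rule sub[OF \<mu>(1)]) (use st in auto)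
      then show "set_integrable lborel {s<..t} (\<lambda>x. c * \<mu> x)" by simp
      show "AE x\<in>{s<..t} in lborel. h x \<le> c * \<mu> x"
        using le
      proof (eventually_elim, intro impI)
        fix x assume x: "x \<in> {0..T} \<longrightarrow> h x \<le> 2 * \<mu> x * sqrt (y x + (y x)\<^sup>2)" and xs: "x \<in> {s<..t}"
        have xT: "x \<in> {0..T}" using xs st by auto
        have "dist (q x) (q s) < e" "dist (q x) (q t) < e"
          using close[OF sT xT] close[OF tT xT] xs st by (auto simp: dist_real_def)
        then have qx: "q x \<le> q s + e" "q x \<le> q t + e" by (auto simp: dist_real_def)
        \<comment> \<open>Here the nonlinear bound becomes linear: after division by 2q, the
          estimate sqrt (y + y^2) <= q (1 + q) leaves formally q' <= \<mu> (1 + q).\<close>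
        have "sqrt (y x + (y x)\<^sup>2) = sqrt (y x) * sqrt (1 + y x)"
          by (simp add: real_sqrt_mult[symmetric] algebra_simps power2_eq_square)
        also have "\<dots> \<le> q x * (1 + q x)"
        proof (rule mult_mono)
          have "sqrt (1 + y x) \<le> sqrt 1 + sqrt (y x)"
            using y[OF xT] by (intro sqrt_add_le_add_sqrt) auto
          then show "sqrt (1 + y x) \<le> 1 + q x" using sy[OF xT] by simp
          show "0 \<le> q x" using q_ge[OF xT] sd by linarith
        qed (use sy[OF xT] y[OF xT] in auto)
        finally have "2 * \<mu> x * sqrt (y x + (y x)\<^sup>2) \<le> 2 * \<mu> x * (q x * (1 + q x))"
          using \<mu>(2)[of x] by (intro mult_left_mono) auto
        moreover have "2 * (q x * (1 + q x)) \<le> c"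
        proof -
          \<comment> \<open>The additive error 2e becomes a multiplicative one because q is bounded
            below by sqrt \<delta>; this is where e / sqrt \<delta> comes from.\<close>
          have "2 * sqrt \<delta> \<le> q s + q t" using pos by simp
          then have "e * (2 * sqrt \<delta>) \<le> e * (q s + q t)" using e by (intro mult_left_mono) auto
          then have "2 * e \<le> e / sqrt \<delta> * (q s + q t)" using sd by (simp add: field_simps)
          then have 1: "2 * q x \<le> (1 + e / sqrt \<delta>) * (q s + q t)" using qx by (simp add: distrib_right)
          have "0 \<le> e * q s" using e pos by simp
          then have "1 + q x \<le> 1 + q s + e + e * q s" using qx by linarith
          then have 2: "1 + q x \<le> (1 + e) * (1 + q s)" by (simp add: algebra_simps)
          have "2 * q x * (1 + q x) \<le> ((1 + e / sqrt \<delta>) * (q s + q t)) * ((1 + e) * (1 + q s))"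
          proof (rule mult_mono[OF 1 2])
            show "0 \<le> (1 + e / sqrt \<delta>) * (q s + q t)" using e sd pos by simp
            show "0 \<le> 1 + q x" using q_ge[OF xT] sd by linarith
          qed
          then show ?thesis by (simp add: c_def \<kappa>_def mult_ac)
        qed
        then have "\<mu> x * (2 * (q x * (1 + q x))) \<le> \<mu> x * c" using \<mu>(2)[of x] by (rule mult_left_mono)
        ultimately show "h x \<le> c * \<mu> x" using x xT by (simp add: mult_ac)
      qed
    qed
    also have "\<dots> = c * D" unfolding D_def by (rule set_integral_mult_right)
    finally have "y t - y s \<le> c * D" .
    \<comment> \<open>The shift \<delta> cancels in the difference of the squares, so this
      factorisation takes the place of the derivative of a square root.\<close>
    moreover have "y t - y s = (q s + q t) * (q t - q s)"
      using q_sq[OF sT] q_sq[OF tT] by (simp add: power2_eq_square algebra_simps)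
    ultimately have "(q s + q t) * (q t - q s) \<le> (q s + q t) * (\<kappa> * (1 + q s) * D)"
      by (simp add: c_def mult_ac)
    then have "q t - q s \<le> \<kappa> * (1 + q s) * D" using pos by (simp add: mult_le_cancel_left)
    then have "1 + q t \<le> (1 + q s) * (1 + \<kappa> * D)" by (simp add: algebra_simps)
    also have "\<dots> \<le> (1 + q s) * exp (\<kappa> * D)" using pos by (intro mult_left_mono exp_ge_add_one_self) auto
    finally have "(1 + q t) * exp (- \<kappa> * \<Theta> t) \<le> (1 + q s) * exp (\<kappa> * D) * exp (- \<kappa> * \<Theta> t)"
      by (rule mult_right_mono) simp
    also have "\<dots> = (1 + q s) * exp (- \<kappa> * \<Theta> s)"
      unfolding mult.assoc exp_add[symmetric] \<Theta>t by (simp add: algebra_simps)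
    finally show "f t \<le> f s" unfolding f_def .
  qed
  moreover have "\<Theta> 0 = 0"
  proof -
    have "AE x in lborel. indicator {0..0::real} x *\<^sub>R \<mu> x = 0"
      using AE_lborel_singleton[of 0] by eventually_elim (auto simp: indicator_def)
    then show ?thesis unfolding \<Theta>_def set_lebesgue_integral_def by (rule integral_eq_zero_AE)
  qed
  ultimately have "(1 + q T) * exp (- \<kappa> * \<Theta> T) \<le> 1 + q 0" by (simp add: f_def)
  then have "(1 + q T) * exp (- \<kappa> * \<Theta> T) * exp (\<kappa> * \<Theta> T) \<le> (1 + q 0) * exp (\<kappa> * \<Theta> T)"
    by (rule mult_right_mono) simp
  moreover have "exp (- \<kappa> * \<Theta> T) * exp (\<kappa> * \<Theta> T) = 1" by (simp flip: exp_add)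
  ultimately have "1 + q T \<le> (1 + q 0) * exp (\<kappa> * \<Theta> T)"
    by (simp only: mult.assoc[of "1 + q T"] mult_1_right)
  then show ?thesis unfolding q_def \<kappa>_def \<Theta>_def .
qed

text \<open>First e and then \<delta> tends to 0; the order matters because the error in the
  exponent contains e / sqrt \<delta>.\<close>

lemma gronwall_sqrt:
  fixes y \<mu> h :: "real \<Rightarrow> real"
  assumes T: "0 \<le> T"
    and y: "\<And>t. t \<in> {0..T} \<Longrightarrow> 0 \<le> y t"
    and \<mu>: "set_integrable lborel {0..T} \<mu>" "\<And>t. 0 \<le> \<mu> t" and h: "set_integrable lborel {0..T} h"
    and eq: "\<And>t. t \<in> {0..T} \<Longrightarrow> y t = y 0 + (LINT s:{0..t}|lborel. h s)"
    and le: "AE s in lborel. s \<in> {0..T} \<longrightarrow> h s \<le> 2 * \<mu> s * sqrt (y s + (y s)\<^sup>2)"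
  defines "M \<equiv> LINT s:{0..T}|lborel. \<mu> s"
  shows "sqrt (y T) \<le> (M + sqrt (y 0)) * exp M"
proof -
  have 1: "1 + sqrt (y T + \<delta>) \<le> (1 + sqrt (y 0 + \<delta>)) * exp M" if \<delta>: "0 < \<delta>" for \<delta>
  proof (rule tendsto_lowerbound)
    have "((\<lambda>e. (1 + sqrt (y 0 + \<delta>)) * exp ((1 + e / sqrt \<delta>) * (1 + e) * M)) \<longlongrightarrow> (1 + sqrt (y 0 + \<delta>)) * exp ((1 + 0 / sqrt \<delta>) * (1 + 0) * M)) (at_right 0)"
      using \<delta> by (intro tendsto_intros) auto
    then show "((\<lambda>e. (1 + sqrt (y 0 + \<delta>)) * exp ((1 + e / sqrt \<delta>) * (1 + e) * M)) \<longlongrightarrow> (1 + sqrt (y 0 + \<delta>)) * exp M) (at_right 0)"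
      by simp
    show "\<forall>\<^sub>F e in at_right 0. 1 + sqrt (y T + \<delta>) \<le> (1 + sqrt (y 0 + \<delta>)) * exp ((1 + e / sqrt \<delta>) * (1 + e) * M)"
      unfolding eventually_at_filter M_def
      by (intro always_eventually allI impI gronwall_sqrt_shifted[OF T \<delta> _ y \<mu> h eq le]) auto
  qed simp
  have "1 + sqrt (y T) \<le> (1 + sqrt (y 0)) * exp M"
  proof (rule tendsto_le[of "at_right (0::real)"])
    have "((\<lambda>\<delta>. 1 + sqrt (y T + \<delta>)) \<longlongrightarrow> 1 + sqrt (y T + 0)) (at_right 0)"
      by (intro tendsto_intros)
    then show "((\<lambda>\<delta>. 1 + sqrt (y T + \<delta>)) \<longlongrightarrow> 1 + sqrt (y T)) (at_right 0)" by simp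
    have "((\<lambda>\<delta>. (1 + sqrt (y 0 + \<delta>)) * exp M) \<longlongrightarrow> (1 + sqrt (y 0 + 0)) * exp M) (at_right 0)"
      by (intro tendsto_intros)
    then show "((\<lambda>\<delta>. (1 + sqrt (y 0 + \<delta>)) * exp M) \<longlongrightarrow> (1 + sqrt (y 0)) * exp M) (at_right 0)" by simp
    show "\<forall>\<^sub>F \<delta> in at_right 0. 1 + sqrt (y T + \<delta>) \<le> (1 + sqrt (y 0 + \<delta>)) * exp M"
      unfolding eventually_at_filter by (intro always_eventually allI impI 1) auto
  qed simp
  \<comment> \<open>From 1 - M <= e^(-M). It absorbs the constants 1 of the inequality for 1 + sqrt
    y into M e^M.\<close>
  moreover have "exp M - 1 \<le> M * exp M"
  proof -
    have "(1 - M) * exp M \<le> exp (- M) * exp M"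
      using exp_ge_add_one_self[of "- M"] by (intro mult_right_mono) auto
    also have "\<dots> = 1" by (simp flip: exp_add)
    finally show ?thesis by (simp add: algebra_simps)
  qed
  ultimately show ?thesis by (simp add: algebra_simps)
qed

section \<open>The estimate\<close>

lemma smooth_slice_measurable:
  assumes "smooth_on ({0..T} \<times> UNIV) (\<lambda>(t, x). \<phi> t x)" "s \<in> {0..T}"
  shows "\<phi> s \<in> borel_measurable borel"
proof -
  have "continuous_on ({0..T} \<times> UNIV) (\<lambda>(t, x). \<phi> t x)"
    using assms(1) unfolding smooth_on_def by (metis Ck_on.simps(1))
  then have "continuous_on UNIV (\<lambda>x. (\<lambda>(t, x). \<phi> t x) (s, x))"
    using assms(2) by (intro continuous_on_compose2[of "{0..T} \<times> UNIV" "\<lambda>(t, x). \<phi> t x" UNIV "\<lambda>x. (s, x)"]) (auto intro: continuous_intros)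
  then show ?thesis by (intro borel_measurable_continuous_onI) simp
qed

text \<open>The exchange kernel and \<open>m_kernel\<close> differ only by a sign and a conjugation
  of one factor, so their absolute values agree and one is in L^2 with the other. The symmetries
  come from v being real and even.\<close>

lemma exchange_kernel_self_adjoint:
  assumes v: "v \<in> borel_measurable borel" "\<And>x. v (- x) = v x" and f: "f \<in> borel_measurable borel"
    and m: "sqint (m_kernel v f)"
  shows "sqint (exchange_kernel v f)" "adj (hs_of (exchange_kernel v f)) = hs_of (exchange_kernel v f)"
    "tp (hs_of (m_kernel v f)) = hs_of (m_kernel v f)"
proof -
  have [measurable]: "v \<in> borel_measurable borel" "f \<in> borel_measurable borel" by fact+
  have "(\<lambda>z. complex_of_real (v (fst z - snd z)) * f (fst z) * cnj (f (snd z))) \<in> borel_measurable borel"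
    by measurable
  then have mE: "exchange_kernel v f \<in> borel_measurable borel"
    by (simp add: exchange_kernel_def case_prod_beta')
  have "cmod (exchange_kernel v f z) = cmod (m_kernel v f z)" for z
    by (simp add: exchange_kernel_def m_kernel_def case_prod_beta norm_mult)
  then show E: "sqint (exchange_kernel v f)" using m mE by (simp add: sqint_def)
  have vs: "v (x - y) = v (y - x)" for x y using v(2)[of "x - y"] by simp
  have "kconj (ktranspose (exchange_kernel v f)) = exchange_kernel v f"
    by (auto simp: kconj_def ktranspose_def exchange_kernel_def fun_eq_iff vs mult_ac)
  then show "adj (hs_of (exchange_kernel v f)) = hs_of (exchange_kernel v f)"
    using E by (simp add: hs_of_ktranspose[symmetric] hs_of_kconj[symmetric] sqint_ktranspose)
  have "ktranspose (m_kernel v f) = m_kernel v f"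
    by (auto simp: ktranspose_def m_kernel_def fun_eq_iff vs mult_ac)
  then show "tp (hs_of (m_kernel v f)) = hs_of (m_kernel v f)"
    using m by (simp add: hs_of_ktranspose[symmetric])
qed

lemma hs_of_uminus: "sqint a \<Longrightarrow> hs_of (\<lambda>z. - a z) = - hs_of a"
  unfolding hs_of_def by (simp add: uminus_hs.abs_eq)

lemma hs_of_symD:
  assumes a: "sqint a" and t: "tp (hs_of a) = hs_of a"
  shows "AE z in lborel. a (prod.swap z) = a z"
proof -
  have "hs_of (ktranspose a) = hs_of a" using t a by (simp add: hs_of_ktranspose)
  from hs_of_eq_iff[THEN iffD1, OF sqint_ktranspose[OF a] a this] show ?thesis
    unfolding ktranspose_swap .
qed

lemma hs_of_adjD:
  assumes a: "sqint a" and t: "adj (hs_of a) = hs_of a"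
  shows "AE z in lborel. cnj (a (prod.swap z)) = a z"
proof -
  have "hs_of (kconj (ktranspose a)) = hs_of a"
    using t a by (simp add: hs_of_ktranspose hs_of_kconj sqint_ktranspose)
  from hs_of_eq_iff[THEN iffD1, OF sqint_kconj[OF sqint_ktranspose[OF a]] a this] show ?thesis
    unfolding ktranspose_swap kconj_def .
qed

text \<open>All the algebra at one fixed time. F and K are the sources left after the part of g
  without derivatives has been subtracted; S and W are the full ones, for which the equation of the
  theorem is available.\<close>

lemma Im_source_le:
  fixes u p F K S W r :: kernel
  assumes v: "v \<in> borel_measurable borel" "\<And>x. v (- x) = v x" and f: "f \<in> borel_measurable borel"
  defines "m \<equiv> m_kernel v f"
  assumes m: "sqint m" and u: "sqint u" and p: "sqint p"
    and U: "tp (hs_of u) = hs_of u" and P: "adj (hs_of p) = hs_of p"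
    and sq: "hs_of p + hs_of p + hs_of p * hs_of p = hs_of u * cj (hs_of u)"
    and S: "sqint S" and Bu: "sqint (g_sym v f u)" and F: "F = (\<lambda>z. S z - g_sym v f u z)"
    and W: "sqint W" and Bp: "sqint (g_comm v f p)" and K: "K = (\<lambda>z. W z - g_comm v f p z)"
    and symF: "AE z in lborel. F z = F (prod.swap z)" and symK: "AE z in lborel. K z = - cnj (K (prod.swap z))"
    and star: "AE z in lborel. (F \<odot> (\<lambda>z. cnj (u z))) z + (u \<odot> (\<lambda>z. - cnj (F z))) z
      = K z + K z + ((K \<odot> p) z + (p \<odot> K) z)"
    and r: "is_inverse_one_plus p r"
    and eqn: "AE z in lborel. S z - (m z + (p \<odot> m) z)
      = ((\<lambda>z'. W z' + (u \<odot> kconj m) z') \<odot> (\<lambda>z'. u z' + (r \<odot> u) z')) z"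
  shows "Im (\<integral>z. F z * cnj (u z) \<partial>lborel) \<le> l2n m * sqrt ((l2n u)\<^sup>2 + ((l2n u)\<^sup>2)\<^sup>2)"
proof -
  define E where "E = exchange_kernel v f"
  define V where "V = hartree_potential v f"
  define G where "G = (\<lambda>(x, y). complex_of_real (V x + V y) * u (x, y))"
  define H where "H = (\<lambda>(x, y). complex_of_real (V x - V y) * p (x, y))"
  note Em = exchange_kernel_self_adjoint[OF v f m[unfolded m_def]]
  have E: "sqint E" and aE: "adj (hs_of E) = hs_of E" and tM: "tp (hs_of m) = hs_of m"
    using Em by (simp_all only: E_def m_def)
  note tE = sqint_ktranspose[OF E]
  have Bu': "g_sym v f u = (\<lambda>z. G z + (E \<odot> u) z + (u \<odot> ktranspose E) z)"
    by (auto simp: g_sym_def G_def V_def E_def fun_eq_iff)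
  have Bp': "g_comm v f p = (\<lambda>z. H z + (E \<odot> p) z - (p \<odot> E) z)"
    by (auto simp: g_comm_def H_def V_def E_def fun_eq_iff)
  \<comment> \<open>The potential may be unbounded, so square integrability of G is not visible from
    u. It follows by difference: the whole of \<open>g_sym\<close> is in L^2, and so are the two
    exchange terms.\<close>
  have G: "sqint G"
  proof -
    have "sqint (\<lambda>z. g_sym v f u z - (E \<odot> u) z - (u \<odot> ktranspose E) z)"
      by (intro sqint_diff Bu sqint_kcomp E u tE)
    then show ?thesis by (simp add: Bu')
  qed
  have H: "sqint H"
  proof -
    have "sqint (\<lambda>z. g_comm v f p z - (E \<odot> p) z + (p \<odot> E) z)"
      by (intro sqint_diff sqint_add Bp sqint_kcomp E p)
    then show ?thesis by (simp add: Bp')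
  qed
  have sF: "sqint F" and sK: "sqint K" unfolding F K by (intro sqint_diff S Bu W Bp)+
  have sr: "sqint r" using r by (simp add: is_inverse_one_plus_def L2_kernel_iff_sqint)
  note cu = sqint_kconj[OF u] and cF = sqint_kconj[OF sF] and cm = sqint_kconj[OF m]
  have hF: "hs_of F = hs_of S - (hs_of G + hs_of E * hs_of u + hs_of u * tp (hs_of E))"
    unfolding F hs_of_diff[OF S Bu] unfolding Bu'
    by (simp only: hs_of_add sqint_add sqint_kcomp hs_of_kcomp hs_of_ktranspose G E u tE)
  have hK: "hs_of K = hs_of W - (hs_of H + hs_of E * hs_of p - hs_of p * hs_of E)"
    unfolding K hs_of_diff[OF W Bp] unfolding Bp'
    by (simp only: hs_of_add hs_of_diff sqint_add sqint_kcomp hs_of_kcomp H E p)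
  have tF: "tp (hs_of F) = hs_of F"
  proof -
    have "hs_of F = hs_of (ktranspose F)"
      by (rule hs_of_eq_iff[THEN iffD2, OF sF sqint_ktranspose[OF sF]]) (use symF in \<open>simp add: ktranspose_swap\<close>)
    then show ?thesis by (simp add: hs_of_ktranspose sF)
  qed
  have aK: "adj (hs_of K) = - hs_of K"
  proof -
    have "hs_of K = hs_of (\<lambda>z. - kconj (ktranspose K) z)"
      by (rule hs_of_eq_iff[THEN iffD2, OF sK sqint_uminus[OF sqint_kconj[OF sqint_ktranspose[OF sK]]]])
        (use symK in \<open>simp add: kconj_def ktranspose_swap\<close>)
    then have "hs_of K = - adj (hs_of K)"
      by (simp add: hs_of_uminus sqint_kconj sqint_ktranspose sK hs_of_kconj hs_of_ktranspose)
    then show ?thesis by (metis minus_minus)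
  qed
  have usym: "AE z in lborel. u (prod.swap z) = u z"
    by (rule hs_of_symD[OF u U])
  have psym: "AE z in lborel. cnj (p (prod.swap z)) = p z"
    by (rule hs_of_adjD[OF p P])
  have tG: "tp (hs_of G) = hs_of G"
  proof -
    have "AE z in lborel. ktranspose G z = G z"
      using usym by eventually_elim (auto simp: ktranspose_def G_def add.commute)
    then show ?thesis using G by (simp add: hs_of_ktranspose[symmetric] hs_of_eq_iff sqint_ktranspose)
  qed
  have aH: "adj (hs_of H) = - hs_of H"
  proof -
    have "AE z in lborel. kconj (ktranspose H) z = - H z"
      using psym by eventually_elim (auto simp: ktranspose_def kconj_def H_def algebra_simps)
    then have "hs_of (kconj (ktranspose H)) = hs_of (\<lambda>z. - H z)"
      using H by (simp add: hs_of_eq_iff sqint_ktranspose sqint_kconj sqint_uminus)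
    then show ?thesis using H by (simp add: hs_of_ktranspose hs_of_kconj sqint_ktranspose hs_of_uminus)
  qed
  have hS: "hs_of S = hs_of F + (hs_of G + hs_of E * hs_of u + hs_of u * tp (hs_of E))" using hF by simp
  have tS: "tp (hs_of S) = hs_of S"
    unfolding hS by (simp add: tp_add tp_mult tF tG U)
  have hW: "hs_of W = hs_of K + (hs_of H + hs_of E * hs_of p - hs_of p * hs_of E)" using hK by simp
  have aW: "adj (hs_of W) = - hs_of W"
    unfolding hW by (simp add: tp_add cj_add tp_diff cj_diff adj_mult aK aH aE P)
  have GH: "hs_of G * cj (hs_of u) - hs_of u * cj (hs_of G) = hs_of H + hs_of H + hs_of H * hs_of p + hs_of p * hs_of H"
    using potential_cancel[of u p V] u p G H sq unfolding G_def H_def by blast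
  have FK: "hs_of F * cj (hs_of u) - hs_of u * cj (hs_of F) = hs_of K + hs_of K + hs_of K * hs_of p + hs_of p * hs_of K"
  proof -
    let ?L = "\<lambda>z. (F \<odot> kconj u) z - (u \<odot> kconj F) z" and ?R = "\<lambda>z. K z + K z + ((K \<odot> p) z + (p \<odot> K) z)"
    have "(u \<odot> (\<lambda>z. - cnj (F z))) z = - (u \<odot> kconj F) z" for z
      using kcomp_cmult_right[of u "- 1" "kconj F"] by (simp add: kconj_def)
    then have "AE z in lborel. ?L z = ?R z" using star by (simp add: kconj_def)
    then have "hs_of ?L = hs_of ?R"
      by (rule hs_of_eq_iff[THEN iffD2, rotated 2]) (intro sqint_add sqint_diff sqint_kcomp u p sF sK cu cF)+
    moreover have "hs_of ?L = hs_of F * cj (hs_of u) - hs_of u * cj (hs_of F)"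
      by (simp only: hs_of_diff sqint_kcomp hs_of_kcomp hs_of_kconj u sF cu cF)
    moreover have "hs_of ?R = hs_of K + hs_of K + (hs_of K * hs_of p + hs_of p * hs_of K)"
      by (simp only: hs_of_add sqint_add sqint_kcomp hs_of_kcomp sK p)
    ultimately show ?thesis by (simp add: add.assoc)
  qed
  have r1: "hs_of p + hs_of r + hs_of p * hs_of r = 0" and r2: "hs_of p + hs_of r + hs_of r * hs_of p = 0"
  proof -
    have "hs_of (\<lambda>z. p z + r z + (p \<odot> r) z) = hs_of (\<lambda>z. 0)" "hs_of (\<lambda>z. p z + r z + (r \<odot> p) z) = hs_of (\<lambda>z. 0)"
      using r unfolding is_inverse_one_plus_def
      by (auto intro!: hs_of_eq_iff[THEN iffD2] sqint_add sqint_kcomp p sr)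
    then show "hs_of p + hs_of r + hs_of p * hs_of r = 0" "hs_of p + hs_of r + hs_of r * hs_of p = 0"
      by (simp_all only: hs_of_add sqint_add sqint_kcomp hs_of_kcomp hs_of_zero p sr)
  qed
  have eqn': "hs_of S - (hs_of m + hs_of p * hs_of m) = (hs_of W + hs_of u * cj (hs_of m)) * (hs_of u + hs_of r * hs_of u)"
  proof -
    have "hs_of (\<lambda>z. S z - (m z + (p \<odot> m) z)) = hs_of ((\<lambda>z'. W z' + (u \<odot> kconj m) z') \<odot> (\<lambda>z'. u z' + (r \<odot> u) z'))"
      by (rule hs_of_eq_iff[THEN iffD2, OF _ _ eqn]) (intro sqint_add sqint_diff sqint_kcomp S m p W u sr cm)+
    then show ?thesis
      by (simp only: hs_of_add hs_of_diff sqint_add sqint_diff sqint_kcomp hs_of_kcomp hs_of_kconj S m p W u sr cm)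
  qed
  have star': "hs_of S * cj (hs_of u) - hs_of u * cj (hs_of S) = hs_of W + hs_of W + hs_of W * hs_of p + hs_of p * hs_of W"
    by (rule source_commutator_identity[OF U sq aE hF hK GH FK])
  have ImS: "Im (tr2 (hs_of S) (cj (hs_of u))) = Im (tr2 (hs_of m) (cj (hs_of u) + cj (hs_of u) * hs_of p))"
    by (rule Im_trace_source[OF U P sq r1 r2 tS aW tM eqn' star'])
  \<comment> \<open>The potential is real, so it multiplies |u|^2 by a real function and contributes
    nothing to the growth of the norm.\<close>
  have ImG: "Im (tr2 (hs_of G) (cj (hs_of u))) = 0"
  proof -
    have "tr2 (hs_of G) (cj (hs_of u)) = (\<integral>z. G z * cnj (u z) \<partial>lborel)"
      using tr2_cj_tp_hs_of[OF G u] by (simp add: U)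
    also have "\<dots> = (\<integral>z. complex_of_real ((V (fst z) + V (snd z)) * (cmod (u z))\<^sup>2) \<partial>lborel)"
      by (intro Bochner_Integration.integral_cong refl)
        (auto simp: G_def mult.assoc complex_norm_square[symmetric])
    also have "\<dots> = complex_of_real (\<integral>z. (V (fst z) + V (snd z)) * (cmod (u z))\<^sup>2 \<partial>lborel)"
      by (rule integral_complex_of_real)
    finally show ?thesis by simp
  qed
  have "(\<integral>z. F z * cnj (u z) \<partial>lborel) = tr2 (hs_of F) (cj (hs_of u))"
    using tr2_cj_tp_hs_of[OF sF u] by (simp add: U)
  also have "Im \<dots> = Im (tr2 (hs_of S) (cj (hs_of u)))"
    using hs_im_zero[OF U aE] ImG unfolding hF by (simp add: tr2_diff tr2_add_left)
  also have "\<dots> \<le> cmod (tr2 (hs_of m) (cj (hs_of u) + cj (hs_of u) * hs_of p))"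
    unfolding ImS using abs_Im_le_cmod abs_ge_self order_trans by blast
  also have "\<dots> \<le> norm (hs_of m) * norm (cj (hs_of u) + cj (hs_of u) * hs_of p)" by (rule norm_tr2_le)
  also have "\<dots> \<le> norm (hs_of m) * sqrt ((norm (hs_of u))\<^sup>2 + ((norm (hs_of u))\<^sup>2)\<^sup>2)"
    by (intro mult_left_mono norm_sh_ch_le[OF U P sq] norm_ge_zero)
  finally show ?thesis by (simp add: norm_hs_of m u)
qed

theorem theorem3p2:
  fixes v :: "real^3 \<Rightarrow> real"
    and \<phi> :: "real \<Rightarrow> real^3 \<Rightarrow> complex"
    and k u p :: "real \<Rightarrow> kernel"
    and T :: real
  assumes "0 < T"
    and "v \<in> borel_measurable borel"
    and "\<And>x. v (- x) = v x"
    and "hartree_solution v T \<phi>"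
    and "L1_L2 T (\<lambda>t. m_kernel v (\<phi> t))"
    and "\<And>t. t \<in> {0..T} \<Longrightarrow> L2_kernel (k t) \<and> symmetric_kernel (k t)"
    and "\<And>t. t \<in> {0..T} \<Longrightarrow> is_sh (k t) (u t)"
    and "\<And>t. t \<in> {0..T} \<Longrightarrow> is_ch_minus_one (k t) (p t)"
    and "solves_u_equation v \<phi> T u p"
  shows "L2_norm (u T) \<le>
           ((LINT t:{0..T}|lborel. L2_norm (m_kernel v (\<phi> t))) + L2_norm (u 0))
             * exp (LINT t:{0..T}|lborel. L2_norm (m_kernel v (\<phi> t)))"
proof -
  have T: "0 \<le> T" using assms(1) by simp
  obtain S W where
    we_u: "weak_evolution T (\<lambda>\<psi> z. - lap_x \<psi> z - lap_y \<psi> z) u (\<lambda>t. g_sym v (\<phi> t) (u t)) S" and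
    we_p: "weak_evolution T (\<lambda>\<psi> z. - lap_x \<psi> z + lap_y \<psi> z) p (\<lambda>t. g_comm v (\<phi> t) (p t)) W" and
    eqn: "AE t in lborel. t \<in> {0..T} \<longrightarrow>
        (\<exists>r. is_inverse_one_plus (p t) r \<and>
           (AE z in lborel.
              S t z - (m_kernel v (\<phi> t) z + (p t \<odot> m_kernel v (\<phi> t)) z) =
              ((\<lambda>z'. W t z' + (u t \<odot> kconj (m_kernel v (\<phi> t))) z') \<odot> (\<lambda>z'. u t z' + (r \<odot> u t) z')) z))"
    using assms(9) unfolding solves_u_equation_def Let_def by blast
  \<comment> \<open>In the notation of \<open>wform\<close> the coefficients (c, d) are (-1, -1) for
    u and (-1, 1) for p.\<close>
  have Du: "(\<lambda>\<psi> z. - lap_x \<psi> z - lap_y \<psi> z) = (\<lambda>\<psi> z. of_real (- 1) * lap_x \<psi> z + of_real (- 1) * lap_y \<psi> z)"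
    and Dp: "(\<lambda>\<psi> z. - lap_x \<psi> z + lap_y \<psi> z) = (\<lambda>\<psi> z. of_real (- 1) * lap_x \<psi> z + of_real 1 * lap_y \<psi> z)"
    by (simp_all add: fun_eq_iff)
  obtain A F where A: "wsol T (- 1) (- 1) A F" and Au: "\<And>s z. s \<in> {0..T} \<Longrightarrow> A (s, z) = u s z"
    and FS: "AE s in lborel. s \<in> {0..T} \<longrightarrow> sqint (g_sym v (\<phi> s) (u s)) \<and> sqint (S s) \<and> (\<forall>z. F (s, z) = S s z - g_sym v (\<phi> s) (u s) z)"
    by (rule weak_evolution_wsol[OF we_u[unfolded Du] T]) (rule that)
  obtain Q K where Q: "wsol T (- 1) 1 Q K" and Qp: "\<And>s z. s \<in> {0..T} \<Longrightarrow> Q (s, z) = p s z"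
    and KW: "AE s in lborel. s \<in> {0..T} \<longrightarrow> sqint (g_comm v (\<phi> s) (p s)) \<and> sqint (W s) \<and> (\<forall>z. K (s, z) = W s z - g_comm v (\<phi> s) (p s) z)"
    by (rule weak_evolution_wsol[OF we_p[unfolded Dp] T]) (rule that)
  have Aeq: "(\<lambda>z. A (s, z)) = u s" and Qeq: "(\<lambda>z. Q (s, z)) = p s" if "s \<in> {0..T}" for s
    using Au[OF that] Qp[OF that] by (simp_all add: fun_eq_iff)
  have su: "sqint (u s)" and sp: "sqint (p s)" and U: "tp (hs_of (u s)) = hs_of (u s)"
    and P: "adj (hs_of (p s)) = hs_of (p s)"
    and sq: "hs_of (p s) + hs_of (p s) + hs_of (p s) * hs_of (p s) = hs_of (u s) * cj (hs_of (u s))" if "s \<in> {0..T}" for s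
    using sh_ch_identities[of "k s" "u s" "p s"] assms(6-8)[OF that] by (simp_all add: scaleR_2)
  have wA: "wform T (- 1) (- 1) A F" by (rule wsol_wform[OF A])
  have wQ: "wform T (- 1) 1 Q K" by (rule wsol_wform[OF Q])
  \<comment> \<open>Transposition exchanges the two coefficients, which are equal for u; so the
    transposed path solves an equation of the same form, with the transposed source.\<close>
  have symF: "AE s in lborel. s \<in> {0..T} \<longrightarrow> (AE z in lborel. F (s, z) = F (s, prod.swap z))"
  proof -
    have "AE s in lborel. s \<in> {0..T} \<longrightarrow> (AE z in lborel. F (s, z) = (case (s, z) of (s, z) \<Rightarrow> F (s, prod.swap z)))"
    proof (rule wform_unique[OF wA wform_swap[OF wA] T])
      fix s assume s: "s \<in> {0..T}"
      have "AE z in lborel. u s (prod.swap z) = u s z" by (rule hs_of_symD[OF su[OF s] U[OF s]])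
      then show "AE z in lborel. A (s, z) = (case (s, z) of (s, z) \<Rightarrow> A (s, prod.swap z))"
        by eventually_elim (simp add: Au[OF s])
    qed
    then show ?thesis by simp
  qed
  \<comment> \<open>Conjugation takes (-1, 1) to (1, -1) and transposition takes it back. The
    self-adjoint path p thus solves the same equation with minus the adjoint source.\<close>
  have symK: "AE s in lborel. s \<in> {0..T} \<longrightarrow> (AE z in lborel. K (s, z) = - cnj (K (s, prod.swap z)))"
  proof -
    have w: "wform T (- 1) 1 (\<lambda>(s, z). cnj (Q (s, prod.swap z))) (\<lambda>(s, z). - cnj (K (s, prod.swap z)))"
      using wform_swap[OF wsol_wform[OF wsol_cnj[OF Q]]] by simp
    have "AE s in lborel. s \<in> {0..T} \<longrightarrow> (AE z in lborel. K (s, z) = (case (s, z) of (s, z) \<Rightarrow> - cnj (K (s, prod.swap z))))"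
    proof (rule wform_unique[OF wQ w T])
      fix s assume s: "s \<in> {0..T}"
      have "AE z in lborel. cnj (p s (prod.swap z)) = p s z" by (rule hs_of_adjD[OF sp[OF s] P[OF s]])
      then show "AE z in lborel. Q (s, z) = (case (s, z) of (s, z) \<Rightarrow> cnj (Q (s, prod.swap z)))"
        by eventually_elim (simp add: Qp[OF s])
    qed
    then show ?thesis by simp
  qed
  \<comment> \<open>The compositions u (kconj u) and p p both have opposite coefficients at the
    contracted variable and (-1, 1) at the outer ones, just like p. The paths u (kconj u) and 2p + p
    p are equal at all times, so their sources agree.\<close>
  have star: "AE s in lborel. s \<in> {0..T} \<longrightarrow> (AE z in lborel.
      ((\<lambda>z. F (s, z)) \<odot> (\<lambda>z. cnj (A (s, z)))) z + ((\<lambda>z. A (s, z)) \<odot> (\<lambda>z. - cnj (F (s, z)))) z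
      = K (s, z) + K (s, z) + (((\<lambda>z. K (s, z)) \<odot> (\<lambda>z. Q (s, z))) z + ((\<lambda>z. Q (s, z)) \<odot> (\<lambda>z. K (s, z))) z))"
  proof -
    note w1 = wform_product[OF A wsol_cnj[OF A], simplified minus_minus]
    note w2 = wform_add[OF wform_add[OF wQ wQ] wform_product[OF Q Q]]
    have "AE s in lborel. s \<in> {0..T} \<longrightarrow> (AE z in lborel.
      (\<lambda>y. (\<lambda>(s, z). ((\<lambda>z. F (s, z)) \<odot> (\<lambda>z. cnj (A (s, z)))) z) y + (\<lambda>(s, z). ((\<lambda>z. A (s, z)) \<odot> (\<lambda>z. - cnj (F (s, z)))) z) y) (s, z)
      = (\<lambda>y. (K y + K y) + ((\<lambda>(s, z). ((\<lambda>z. K (s, z)) \<odot> (\<lambda>z. Q (s, z))) z) y + (\<lambda>(s, z). ((\<lambda>z. Q (s, z)) \<odot> (\<lambda>z. K (s, z))) z) y)) (s, z))"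
    proof (rule wform_unique[OF w1 w2 T])
      fix s assume s: "s \<in> {0..T}"
      have "hs_of (u s \<odot> kconj (u s)) = hs_of (\<lambda>z. p s z + p s z + (p s \<odot> p s) z)"
        using sq[OF s] by (simp only: hs_of_add sqint_add sqint_kcomp hs_of_kcomp hs_of_kconj sqint_kconj su[OF s] sp[OF s])
      then have "AE z in lborel. (u s \<odot> kconj (u s)) z = p s z + p s z + (p s \<odot> p s) z"
        by (rule hs_of_eq_iff[THEN iffD1, rotated 2]) (intro sqint_add sqint_kcomp sqint_kconj su[OF s] sp[OF s])+
      then show "AE z in lborel. (\<lambda>(s, z). ((\<lambda>z. A (s, z)) \<odot> (\<lambda>z. cnj (A (s, z)))) z) (s, z)
          = (\<lambda>y. (Q y + Q y) + (\<lambda>(s, z). ((\<lambda>z. Q (s, z)) \<odot> (\<lambda>z. Q (s, z))) z) y) (s, z)"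
        unfolding prod.case Au[OF s] Qp[OF s] kconj_def .
    qed
    then show ?thesis by simp
  qed
  have m: "AE s in lborel. s \<in> {0..T} \<longrightarrow> L2_kernel (m_kernel v (\<phi> s))"
    and \<mu>: "set_integrable lborel {0..T} (\<lambda>s. L2_norm (m_kernel v (\<phi> s)))"
    using assms(5) by (auto simp: L1_L2_def)
  \<comment> \<open>Gronwall is applied to the squared norm, whose density h is integrable by
    \<open>wsol_energy\<close> data; the bound on h is needed only at almost every time, which is
    all that the equation offers.\<close>
  define y where "y s = (l2n (\<lambda>z. A (s, z)))\<^sup>2" for s
  define h where "h s = 2 * Im (\<integral>z. F (s, z) * cnj (A (s, z)) \<partial>lborel)" for s
  have bound: "AE s in lborel. s \<in> {0..T} \<longrightarrow> h s \<le> 2 * L2_norm (m_kernel v (\<phi> s)) * sqrt (y s + (y s)\<^sup>2)"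
    using eqn FS KW symF symK star m
  proof eventually_elim
    case (elim s)
    show ?case
    proof
      assume s: "s \<in> {0..T}"
      obtain r where r: "is_inverse_one_plus (p s) r"
        "AE z in lborel.
              S s z - (m_kernel v (\<phi> s) z + (p s \<odot> m_kernel v (\<phi> s)) z) =
              ((\<lambda>z'. W s z' + (u s \<odot> kconj (m_kernel v (\<phi> s))) z') \<odot> (\<lambda>z'. u s z' + (r \<odot> u s) z')) z"
        using elim(1) s by blast
      have F: "(\<lambda>z. F (s, z)) = (\<lambda>z. S s z - g_sym v (\<phi> s) (u s) z)" and K: "(\<lambda>z. K (s, z)) = (\<lambda>z. W s z - g_comm v (\<phi> s) (p s) z)"
        using elim(2,3) s by (auto simp: fun_eq_iff)
      have f: "\<phi> s \<in> borel_measurable borel"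
        using assms(4) s unfolding hartree_solution_def by (intro smooth_slice_measurable[of T \<phi>]) blast+
      have "Im (\<integral>z. (\<lambda>z. F (s, z)) z * cnj (u s z) \<partial>lborel)
          \<le> l2n (m_kernel v (\<phi> s)) * sqrt ((l2n (u s))\<^sup>2 + ((l2n (u s))\<^sup>2)\<^sup>2)"
      proof (rule Im_source_le[OF assms(2,3) f _ su[OF s] sp[OF s] U[OF s] P[OF s] sq[OF s] _ _ F _ _ K _ _ _ r])
        show "sqint (m_kernel v (\<phi> s))" using elim(7) s by (simp add: L2_kernel_iff_sqint)
        show "sqint (S s)" "sqint (g_sym v (\<phi> s) (u s))" "sqint (W s)" "sqint (g_comm v (\<phi> s) (p s))"
          using elim(2,3) s by auto
        show "AE z in lborel. F (s, z) = F (s, prod.swap z)" using elim(4) s by blast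
        show "AE z in lborel. K (s, z) = - cnj (K (s, prod.swap z))" using elim(5) s by blast
        show "AE z in lborel. ((\<lambda>z. F (s, z)) \<odot> (\<lambda>z. cnj (u s z))) z + (u s \<odot> (\<lambda>z. - cnj (F (s, z)))) z
          = K (s, z) + K (s, z) + (((\<lambda>z. K (s, z)) \<odot> p s) z + (p s \<odot> (\<lambda>z. K (s, z))) z)"
          using elim(6) s unfolding Aeq[OF s] Qeq[OF s] Au[OF s] by blast
      qed
      then show "h s \<le> 2 * L2_norm (m_kernel v (\<phi> s)) * sqrt (y s + (y s)\<^sup>2)"
        by (simp add: h_def y_def Aeq[OF s] Au[OF s] L2_norm_eq_l2n)
    qed
  qed
  have h_int: "set_integrable lborel {0..T} h"
  proof -
    note mA = L1_pathD(1)[OF wsolD(1)[OF A]] and mF = L1_pathD(1)[OF wsolD(2)[OF A]]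
    note sA = L1_pathD(2)[OF wsolD(1)[OF A]] and sF = L1_pathD(2)[OF wsolD(2)[OF A]]
    obtain C where C: "\<And>s. l2n (\<lambda>z. A (s, z)) \<le> C" using wsolD(3)[OF A] by blast
    have [measurable]: "A \<in> borel_measurable borel" "F \<in> borel_measurable borel" by (fact mA, fact mF)
    have "integrable lborel (\<lambda>s. \<integral>z. F (s, z) * cnj (A (s, z)) \<partial>lborel)"
    proof (rule Bochner_Integration.integrable_bound)
      show "integrable lborel (\<lambda>s. l2n (\<lambda>z. F (s, z)) * C)"
        using L1_pathD(3)[OF wsolD(2)[OF A]] by simp
      show "(\<lambda>s. \<integral>z. F (s, z) * cnj (A (s, z)) \<partial>lborel) \<in> borel_measurable lborel" by measurable
      show "AE s in lborel. norm (\<integral>z. F (s, z) * cnj (A (s, z)) \<partial>lborel) \<le> norm (l2n (\<lambda>z. F (s, z)) * C)"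
      proof (rule AE_I2)
        fix s
        have "norm (\<integral>z. F (s, z) * cnj (A (s, z)) \<partial>lborel) \<le> l2n (\<lambda>z. F (s, z)) * l2n (\<lambda>z. A (s, z))"
          using cauchy_schwarz_l2n[OF sF sqint_cnj[OF sA], of s s] by simp
        also have "\<dots> \<le> l2n (\<lambda>z. F (s, z)) * C" by (intro mult_left_mono C l2n_nonneg)
        finally show "norm (\<integral>z. F (s, z) * cnj (A (s, z)) \<partial>lborel) \<le> norm (l2n (\<lambda>z. F (s, z)) * C)" by simp
      qed
    qed
    then have "integrable lborel h" unfolding h_def[abs_def] by (intro integrable_mult_right integrable_Im)
    then show ?thesis unfolding set_integrable_def by (intro integrable_mult_indicator) auto
  qed
  have "sqrt (y T) \<le> ((LINT s:{0..T}|lborel. L2_norm (m_kernel v (\<phi> s))) + sqrt (y 0))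
      * exp (LINT s:{0..T}|lborel. L2_norm (m_kernel v (\<phi> s)))"
  proof (rule gronwall_sqrt[OF T _ \<mu> _ h_int _ bound])
    show "0 \<le> y t" for t by (simp add: y_def)
    show "0 \<le> L2_norm (m_kernel v (\<phi> t))" for t by (simp add: L2_norm_eq_l2n)
    fix t assume t: "t \<in> {0..T}"
    show "y t = y 0 + (LINT s:{0..t}|lborel. h s)"
      using wsol_energy[OF A t] by (simp add: y_def h_def)
  qed
  moreover have "sqrt (y T) = L2_norm (u T)" "sqrt (y 0) = L2_norm (u 0)"
    using Aeq[of T] Aeq[of 0] T by (simp_all add: y_def L2_norm_eq_l2n)
  ultimately show ?thesis by simp
qed

end
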